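(* Let $U_t=e^{itH}$, $t\in\mathbb R$, with $H=H^*$ selfadjoint, be a unitary one-parameter group on a complex Hilbert space $\mathcal H$, let $J$ be a conjugation on $\mathcal H$ commuting with all $U_t$, and let $\mathtt V\subseteq\mathcal H$ be the standard subspace with $J_{\mathtt V}=J$ and $\Delta_{\mathtt V}=e^{-2\pi H}$, i.e. $\mathtt V=\operatorname{Fix}(J\Delta_{\mathtt V}^{1/2})$. Then $$\mathcal H^{-\omega}_{\rm KMS}=\{\eta\in\mathcal H^{-\omega}:\ \eta(v)\in\mathbb R\ \text{ for all } v\in\mathtt V'\cap\mathcal H^\omega\}.$$
   Context: Inner products are antilinear in the first argument. A conjugation is an antilinear isometric involution. $\mathtt V'=\{w\in\mathcal H:\operatorname{Im}\langle w,v\rangle=0\ \forall v\in\mathtt V\}$. $\mathcal H^\omega=\bigcup_{r>0}\mathcal H^\omega(r)$ is the space of analytic vectors of $(U_t)$, where $\mathcal H^\omega(r)=\mathcal D(e^{rH})\cap\mathcal D(e^{-rH})$ is topologized by the embedding $v\mapsto(e^{rH}v,e^{-rH}v)\in\mathcal H^{\oplus2}$, and $\mathcal H^\omega$ carries the locally convex direct limit topology. $\mathcal H^{-\omega}$ is the space of continuous antilinear functionals $\mathcal H^\omega\to\mathbb C$ with the weak-$*$-topology. On it $(U_t^{-\omega}\eta)(\xi)=\eta(U_{-t}\xi)$ and $(J\eta)(\xi)=\overline{\eta(J\xi)}$. Let $\mathcal S_\pi=\{z\in\mathbb C:0<\operatorname{Im}z<\pi\}$. $\mathcal H^{-\omega}_{\rm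 KMS}$ is the real linear subspace of those $\eta\in\mathcal H^{-\omega}$ whose orbit map $U^\eta(t)=U_t^{-\omega}\eta$, $t\in\mathbb R$, extends to a weak-$*$-continuous map $U^\eta:\overline{\mathcal S_\pi}\to\mathcal H^{-\omega}$, weak-$*$-holomorphic on $\mathcal S_\pi$, with $U^\eta(\pi i)=J\eta$. *)

theory Defs
  imports "HOL-Analysis.Analysis"
begin

section \<open>Complex Hilbert spaces\<close>

class complex_hilbert_space = real_inner + complete_space +
  fixes scaleC :: "complex \<Rightarrow> 'a \<Rightarrow> 'a"  (infixr "*\<^sub>C" 75)
    and cinner :: "'a \<Rightarrow> 'a \<Rightarrow> complex"
  assumes scaleC_add_right: "a *\<^sub>C (x + y) = a *\<^sub>C x + a *\<^sub>C y"
    and scaleC_add_left: "(a + b) *\<^sub>C x = a *\<^sub>C x + b *\<^sub>C x"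
    and scaleC_scaleC: "a *\<^sub>C (b *\<^sub>C x) = (a * b) *\<^sub>C x"
    and scaleR_scaleC: "scaleR r x = complex_of_real r *\<^sub>C x"
    and cinner_add_right: "cinner x (y + z) = cinner x y + cinner x z"
    and cinner_scaleC_right: "cinner x (a *\<^sub>C y) = a * cinner x y"
    and cinner_commute: "cinner x y = cnj (cinner y x)"
    and inner_Re_cinner: "inner x y = Re (cinner x y)"

definition clinear_map :: "('a::complex_hilbert_space \<Rightarrow> 'a) \<Rightarrow> bool" where
  "clinear_map A \<longleftrightarrow>
     (\<forall>x y. A (x + y) = A x + A y) \<and> (\<forall>c x. A (c *\<^sub>C x) = c *\<^sub>C A x)"

definition conjugation :: "('a::complex_hilbert_space \<Rightarrow> 'a) \<Rightarrow> bool" where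
  "conjugation J \<longleftrightarrow>
     (\<forall>x y. J (x + y) = J x + J y) \<and> (\<forall>c x. J (c *\<^sub>C x) = cnj c *\<^sub>C J x) \<and>
     (\<forall>x. norm (J x) = norm x) \<and> (\<forall>x. J (J x) = x)"

definition unitary_one_parameter_group ::
    "(real \<Rightarrow> 'a::complex_hilbert_space \<Rightarrow> 'a) \<Rightarrow> bool" where
  "unitary_one_parameter_group U \<longleftrightarrow>
     (\<forall>t. clinear_map (U t) \<and> surj (U t) \<and> (\<forall>x y. cinner (U t x) (U t y) = cinner x y)) \<and>
     (\<forall>x. U 0 x = x) \<and> (\<forall>s t x. U (s + t) x = U s (U t x)) \<and>
     (\<forall>x. continuous_on UNIV (\<lambda>t. U t x))"


section \<open>Unbounded operators and Borel functional calculus\<close>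

text \<open>A (partially defined) operator is identified with its graph; its domain is
  \<^const>\<open>Domain\<close> of the graph.\<close>

type_synonym 'a operator = "('a \<times> 'a) set"

definition op_app :: "'a operator \<Rightarrow> 'a \<Rightarrow> 'a" where
  "op_app T x = (THE y. (x, y) \<in> T)"

definition linear_operator :: "'a::complex_hilbert_space operator \<Rightarrow> bool" where
  "linear_operator T \<longleftrightarrow> (0, 0) \<in> T \<and> single_valued T \<and>
     (\<forall>x y x' y'. (x, y) \<in> T \<longrightarrow> (x', y') \<in> T \<longrightarrow> (x + x', y + y') \<in> T) \<and>
     (\<forall>c x y. (x, y) \<in> T \<longrightarrow> (c *\<^sub>C x, c *\<^sub>C y) \<in> T)"

definition op_adjoint :: "'a::complex_hilbert_space operator \<Rightarrow> 'a operator" where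
  "op_adjoint T = {(u, w). \<forall>x y. (x, y) \<in> T \<longrightarrow> cinner u y = cinner w x}"

definition selfadjoint :: "'a::complex_hilbert_space operator \<Rightarrow> bool" where
  "selfadjoint T \<longleftrightarrow> linear_operator T \<and> closure (Domain T) = UNIV \<and> op_adjoint T = T"

definition orthogonal_projection :: "('a::complex_hilbert_space \<Rightarrow> 'a) \<Rightarrow> bool" where
  "orthogonal_projection P \<longleftrightarrow>
     clinear_map P \<and> (\<forall>x. P (P x) = P x) \<and> (\<forall>x y. cinner (P x) y = cinner x (P y))"

definition projection_valued_measure ::
    "(real set \<Rightarrow> 'a::complex_hilbert_space \<Rightarrow> 'a) \<Rightarrow> bool" where
  "projection_valued_measure E \<longleftrightarrow>
     (\<forall>A\<in>sets borel. orthogonal_projection (E A)) \<and>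
     (\<forall>x. E UNIV x = x) \<and>
     (\<forall>A\<in>sets borel. \<forall>B\<in>sets borel. \<forall>x. E (A \<inter> B) x = E A (E B x)) \<and>
     (\<forall>A :: nat \<Rightarrow> real set. range A \<subseteq> sets borel \<longrightarrow> disjoint_family A \<longrightarrow>
        (\<forall>x. (\<lambda>n. E (A n) x) sums E (\<Union>n. A n) x))"

text \<open>The scalar measure \<open>A \<mapsto> \<langle>x, E A x\<rangle> = \<parallel>E A x\<parallel>\<^sup>2\<close>.\<close>

definition scalar_measure ::
    "(real set \<Rightarrow> 'a::complex_hilbert_space \<Rightarrow> 'a) \<Rightarrow> 'a \<Rightarrow> real measure" where
  "scalar_measure E x =
     measure_of UNIV (sets borel) (\<lambda>A. ennreal ((norm (E A x))\<^sup>2))"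

definition simple_spectral_integral ::
    "(real set \<Rightarrow> 'a::complex_hilbert_space \<Rightarrow> 'a) \<Rightarrow> (real \<Rightarrow> complex) \<Rightarrow> 'a \<Rightarrow> 'a" where
  "simple_spectral_integral E s x = (\<Sum>c\<in>range s. c *\<^sub>C E (s -` {c}) x)"

text \<open>The operator \<open>\<integral> f dE\<close> for a Borel function \<open>f\<close>: its domain consists of all \<open>x\<close> for which
  \<open>f\<close> is square integrable with respect to \<open>\<langle>x, E(\<cdot>) x\<rangle>\<close>. For simple \<open>s\<close> one has
  \<open>\<parallel>(\<integral> s dE) x\<parallel>\<^sup>2 = \<integral> |s|\<^sup>2 d\<langle>x, E(\<cdot>) x\<rangle>\<close>, and the value at \<open>x\<close> is obtained by extending
  this isometry from simple functions to \<open>L\<^sup>2\<close>; it does not depend on the approximating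
  sequence.\<close>

definition spectral_integral ::
    "(real set \<Rightarrow> 'a::complex_hilbert_space \<Rightarrow> 'a) \<Rightarrow> (real \<Rightarrow> complex) \<Rightarrow> 'a operator" where
  "spectral_integral E f = {(x, y).
     (\<integral>\<^sup>+ t. ennreal ((cmod (f t))\<^sup>2) \<partial>scalar_measure E x) < \<infinity> \<and>
     (\<exists>s :: nat \<Rightarrow> real \<Rightarrow> complex.
        (\<forall>n. simple_function borel (s n)) \<and>
        (\<lambda>n. \<integral>\<^sup>+ t. ennreal ((cmod (s n t - f t))\<^sup>2) \<partial>scalar_measure E x) \<longlonglongrightarrow> 0 \<and>
        (\<lambda>n. simple_spectral_integral E (s n) x) \<longlonglongrightarrow> y)}"

definition is_spectral_measure ::
    "'a::complex_hilbert_space operator \<Rightarrow> (real set \<Rightarrow> 'a \<Rightarrow> 'a) \<Rightarrow> bool" where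
  "is_spectral_measure T E \<longleftrightarrow>
     projection_valued_measure E \<and> T = spectral_integral E complex_of_real"

text \<open>The operator \<open>f(T) = \<integral> f dE\<close>, where \<open>E\<close> is the spectral measure of \<open>T\<close>. By the spectral
  theorem, a selfadjoint \<open>T\<close> has a spectral measure, and it is unique on Borel sets, so that the
  existential quantifier ranges over essentially one \<open>E\<close>.\<close>

definition fun_calculus ::
    "'a::complex_hilbert_space operator \<Rightarrow> (real \<Rightarrow> complex) \<Rightarrow> 'a operator" where
  "fun_calculus T f = {(x, y). \<exists>E. is_spectral_measure T E \<and> (x, y) \<in> spectral_integral E f}"

definition op_exp :: "complex \<Rightarrow> 'a::complex_hilbert_space operator \<Rightarrow> 'a operator" where
  "op_exp z T = fun_calculus T (\<lambda>t. exp (z * complex_of_real t))"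

text \<open>The positive square root; only used for positive selfadjoint \<open>T\<close>, so the values of
  \<^const>\<open>sqrt\<close> at negative arguments are irrelevant.\<close>

definition op_sqrt :: "'a::complex_hilbert_space operator \<Rightarrow> 'a operator" where
  "op_sqrt T = fun_calculus T (\<lambda>t. complex_of_real (sqrt t))"


section \<open>Standard subspaces\<close>

definition standard_subspace :: "'a::complex_hilbert_space set \<Rightarrow> bool" where
  "standard_subspace V \<longleftrightarrow> subspace V \<and> closed V \<and>
     V \<inter> {\<i> *\<^sub>C y |y. y \<in> V} = {0} \<and>
     closure {x + \<i> *\<^sub>C y |x y. x \<in> V \<and> y \<in> V} = UNIV"

definition tomita_operator :: "'a::complex_hilbert_space set \<Rightarrow> 'a operator" where
  "tomita_operator V = {(x + \<i> *\<^sub>C y, x - \<i> *\<^sub>C y) |x y. x \<in> V \<and> y \<in> V}"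

definition conj_comp :: "('a \<Rightarrow> 'a) \<Rightarrow> 'a operator \<Rightarrow> 'a operator" where
  "conj_comp J T = {(x, J y) |x y. (x, y) \<in> T}"

text \<open>\<open>J\<close> and \<open>\<Delta>\<close> are the modular objects of \<open>V\<close> if they are the constituents of the polar
  decomposition of the Tomita operator (which is unique).\<close>

definition modular_objects ::
    "'a::complex_hilbert_space set \<Rightarrow> ('a \<Rightarrow> 'a) \<Rightarrow> 'a operator \<Rightarrow> bool" where
  "modular_objects V J \<Delta> \<longleftrightarrow> tomita_operator V = conj_comp J (op_sqrt \<Delta>)"

definition op_Fix :: "'a operator \<Rightarrow> 'a set" where
  "op_Fix T = {x. (x, x) \<in> T}"

definition symplectic_complement :: "'a::complex_hilbert_space set \<Rightarrow> 'a set" where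
  "symplectic_complement V = {w. \<forall>v\<in>V. Im (cinner w v) = 0}"


section \<open>Analytic vectors and hyperfunction vectors\<close>

definition analytic_vectors_at ::
    "'a::complex_hilbert_space operator \<Rightarrow> real \<Rightarrow> 'a set" where
  "analytic_vectors_at H r =
     Domain (op_exp (complex_of_real r) H) \<inter> Domain (op_exp (complex_of_real (- r)) H)"

definition analytic_vectors :: "'a::complex_hilbert_space operator \<Rightarrow> 'a set" where
  "analytic_vectors H = (\<Union>r\<in>{0<..}. analytic_vectors_at H r)"

definition analytic_vectors_at_topology ::
    "'a::complex_hilbert_space operator \<Rightarrow> real \<Rightarrow> 'a topology" where
  "analytic_vectors_at_topology H r =
     pullback_topology (analytic_vectors_at H r)
       (\<lambda>v. (op_app (op_exp (complex_of_real r) H) v, op_app (op_exp (complex_of_real (- r)) H) v))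
       euclidean"

definition absolutely_convex :: "'a::complex_hilbert_space set \<Rightarrow> bool" where
  "absolutely_convex W \<longleftrightarrow> convex W \<and> (\<forall>c. \<forall>x\<in>W. cmod c \<le> 1 \<longrightarrow> c *\<^sub>C x \<in> W)"

text \<open>The locally convex direct limit topology: a base of neighbourhoods of \<open>0\<close> is given by the
  absolutely convex sets which meet every step of the limit in a neighbourhood of \<open>0\<close>.\<close>

definition limit_nhd_0 ::
    "'a::complex_hilbert_space operator \<Rightarrow> 'a set \<Rightarrow> bool" where
  "limit_nhd_0 H W \<longleftrightarrow> W \<subseteq> analytic_vectors H \<and> absolutely_convex W \<and>
     (\<forall>r>0. \<exists>S. openin (analytic_vectors_at_topology H r) S \<and> 0 \<in> S \<and> S \<subseteq> W)"

definition analytic_vectors_topology ::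
    "'a::complex_hilbert_space operator \<Rightarrow> 'a topology" where
  "analytic_vectors_topology H =
     topology (\<lambda>S. S \<subseteq> analytic_vectors H \<and>
       (\<forall>x\<in>S. \<exists>W. limit_nhd_0 H W \<and> (\<lambda>w. x + w) ` W \<subseteq> S))"

lemma limit_nhd_0_Int:
  assumes "limit_nhd_0 H V" "limit_nhd_0 H W"
  shows "limit_nhd_0 H (V \<inter> W)"
  unfolding limit_nhd_0_def
proof (intro conjI allI impI)
  show "V \<inter> W \<subseteq> analytic_vectors H" "absolutely_convex (V \<inter> W)"
    using assms by (auto simp: limit_nhd_0_def absolutely_convex_def convex_Int)
  fix r :: real assume "r > 0"
  with assms obtain S T where
    "openin (analytic_vectors_at_topology H r) S" "0 \<in> S" "S \<subseteq> V"
    "openin (analytic_vectors_at_topology H r) T" "0 \<in> T" "T \<subseteq> W"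
    unfolding limit_nhd_0_def by meson
  then show "\<exists>S. openin (analytic_vectors_at_topology H r) S \<and> 0 \<in> S \<and> S \<subseteq> V \<inter> W"
    by (intro exI[of _ "S \<inter> T"]) auto
qed

lemma openin_analytic_vectors_topology:
  "openin (analytic_vectors_topology H) S \<longleftrightarrow> S \<subseteq> analytic_vectors H \<and>
     (\<forall>x\<in>S. \<exists>W. limit_nhd_0 H W \<and> (\<lambda>w. x + w) ` W \<subseteq> S)"
proof -
  let ?P = "\<lambda>S. S \<subseteq> analytic_vectors H \<and>
     (\<forall>x\<in>S. \<exists>W. limit_nhd_0 H W \<and> (\<lambda>w. x + w) ` W \<subseteq> S)"
  have "istopology ?P"
    unfolding istopology_def
  proof (intro conjI allI impI)
    fix S T assume S: "?P S" and T: "?P T"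
    show "S \<inter> T \<subseteq> analytic_vectors H" using S by blast
    show "\<forall>x\<in>S \<inter> T. \<exists>W. limit_nhd_0 H W \<and> (\<lambda>w. x + w) ` W \<subseteq> S \<inter> T"
    proof
      fix x assume "x \<in> S \<inter> T"
      with S T obtain V W where "limit_nhd_0 H V" "(\<lambda>w. x + w) ` V \<subseteq> S"
        "limit_nhd_0 H W" "(\<lambda>w. x + w) ` W \<subseteq> T" by blast
      then show "\<exists>W. limit_nhd_0 H W \<and> (\<lambda>w. x + w) ` W \<subseteq> S \<inter> T"
        by (intro exI[of _ "V \<inter> W"]) (auto intro: limit_nhd_0_Int)
    qed
  next
    fix K assume K: "\<forall>S\<in>K. ?P S"
    show "\<Union>K \<subseteq> analytic_vectors H" using K by blast
    show "\<forall>x\<in>\<Union>K. \<exists>W. limit_nhd_0 H W \<and> (\<lambda>w. x + w) ` W \<subseteq> \<Union>K"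
      using K by (meson UnionE Union_upper subset_trans)
  qed
  then show ?thesis
    unfolding analytic_vectors_topology_def by (simp add: topology_inverse')
qed

text \<open>A functional on \<^term>\<open>analytic_vectors H\<close> is represented by a function on the whole space
  that is \<^const>\<open>undefined\<close> outside of \<^term>\<open>analytic_vectors H\<close> (\<^const>\<open>extensional\<close>), the
  convention of \<^const>\<open>product_topology\<close>.\<close>

definition hyperfunction_vectors ::
    "'a::complex_hilbert_space operator \<Rightarrow> ('a \<Rightarrow> complex) set" where
  "hyperfunction_vectors H = {\<eta> \<in> extensional (analytic_vectors H).
     (\<forall>x\<in>analytic_vectors H. \<forall>y\<in>analytic_vectors H. \<eta> (x + y) = \<eta> x + \<eta> y) \<and>
     (\<forall>c. \<forall>x\<in>analytic_vectors H. \<eta> (c *\<^sub>C x) = cnj c * \<eta> x) \<and>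
     continuous_map (analytic_vectors_topology H) euclidean \<eta>}"

definition weak_star_topology ::
    "'a::complex_hilbert_space operator \<Rightarrow> ('a \<Rightarrow> complex) topology" where
  "weak_star_topology H =
     subtopology (product_topology (\<lambda>_. euclidean) (analytic_vectors H)) (hyperfunction_vectors H)"

definition hyper_U ::
    "'a::complex_hilbert_space operator \<Rightarrow> (real \<Rightarrow> 'a \<Rightarrow> 'a) \<Rightarrow> real \<Rightarrow>
     ('a \<Rightarrow> complex) \<Rightarrow> ('a \<Rightarrow> complex)" where
  "hyper_U H U t \<eta> = (\<lambda>\<xi>\<in>analytic_vectors H. \<eta> (U (- t) \<xi>))"

definition hyper_J ::
    "'a::complex_hilbert_space operator \<Rightarrow> ('a \<Rightarrow> 'a) \<Rightarrow> ('a \<Rightarrow> complex) \<Rightarrow> ('a \<Rightarrow> complex)" where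
  "hyper_J H J \<eta> = (\<lambda>\<xi>\<in>analytic_vectors H. cnj (\<eta> (J \<xi>)))"

definition strip_pi :: "complex set" where
  "strip_pi = {z. 0 < Im z \<and> Im z < pi}"

definition hyperfunction_vectors_KMS ::
    "'a::complex_hilbert_space operator \<Rightarrow> (real \<Rightarrow> 'a \<Rightarrow> 'a) \<Rightarrow> ('a \<Rightarrow> 'a) \<Rightarrow>
     ('a \<Rightarrow> complex) set" where
  "hyperfunction_vectors_KMS H U J = {\<eta> \<in> hyperfunction_vectors H.
     \<exists>F :: complex \<Rightarrow> 'a \<Rightarrow> complex.
       (\<forall>t. F (complex_of_real t) = hyper_U H U t \<eta>) \<and>
       continuous_map (top_of_set (closure strip_pi)) (weak_star_topology H) F \<and>
       (\<forall>\<xi>\<in>analytic_vectors H. (\<lambda>z. F z \<xi>) holomorphic_on strip_pi) \<and>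
       F (complex_of_real pi * \<i>) = hyper_J H J \<eta>}"

end

theory Submission
  imports Defs "HOL-Probability.Levy" "HOL-Complex_Analysis.Conformal_Mappings"
    "HOL-Real_Asymp.Real_Asymp"
begin

text \<open>Fix the spectral measure \<open>E\<close> of \<open>H\<close>, and call \<open>x\<close> band-limited if \<open>E [- a, a] x = x\<close> for some
  \<open>a\<close>. For such \<open>x\<close> the map \<open>z \<mapsto> \<eta> (exp (- i cnj z H) x)\<close> is entire and extends
  \<open>t \<mapsto> (U\<^sub>t \<eta>) x\<close>, so the KMS condition forces \<open>\<eta> (exp (- \<pi> H) x) = cnj (\<eta> (J x))\<close>. Conversely, if
  this identity holds for all band-limited \<open>x\<close>, then on both boundary lines of the strip the entire
  function is bounded by \<open>C\<^sub>r\<close> times the norm of \<open>x\<close> in \<open>\<H>\<^sup>\<omega>(r)\<close>, hence by the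
  three lines theorem on the whole strip. The extension therefore passes, uniformly in \<open>z\<close>, from
  the cut-offs \<open>E [- n, n] x\<close> to arbitrary analytic vectors \<open>x\<close>.

  The symplectic complement \<open>V'\<close> is invariant under the cut-offs \<open>E [- n, n]\<close>, and a band-limited \<open>w\<close>
  belongs to it iff \<open>w = exp (- \<pi> H) J w\<close>. Applying the identity to \<open>x = J w\<close> shows that \<open>\<eta>\<close> is
  real on \<open>V'\<close>; applying reality to \<open>w = c exp (- \<pi> H) x + cnj c J x\<close> with \<open>c = 1\<close> and \<open>c = i\<close> gives the
  identity back.\<close>

section \<open>Complex Hilbert spaces\<close>

text \<open>The cut-offs are forced by domains: an analytic vector lies in the domain of
  \<open>exp (r H)\<close> only for some, possibly small, \<open>r\<close>, so
  \<open>exp (- pi H)\<close> cannot be applied to it, while on a band every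
  \<open>exp (z H)\<close> is bounded. The estimate on the strip is uniform because the norm at
  level \<open>r\<close> is unchanged by \<open>U t\<close> and by \<open>J\<close>: the orbit is
  \<open>\<eta> (U (- t) x)\<close> on the lower line and, by the boundary identity, the conjugate
  of \<open>\<eta> (J (U (- t) x))\<close> on the upper one, so one constant covers both. The
  exponent arises from \<open>- i cnj (pi i) = - pi\<close>. Moving \<open>J\<close> across
  \<open>exp (- pi H)\<close> flips the sign of the exponent, since an antilinear map that commutes
  with all \<open>exp (i t H)\<close> reflects the spectrum of \<open>H\<close>. A second obstacle
  is that \<open>fun_calculus\<close> quantifies over all spectral measures. Those of
  \<open>H\<close> all yield the same \<open>U t\<close>, and characteristic functions then
  determine the measure. For the modular operator no unitary group is given to compare with;
  single-valuedness of the Tomita operator takes its place.\<close>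

lemma scaleC_of_real: "complex_of_real r *\<^sub>C x = r *\<^sub>R (x::'a::complex_hilbert_space)"
  by (simp add: scaleR_scaleC)

lemma scaleC_one [simp]: "1 *\<^sub>C (x::'a::complex_hilbert_space) = x"
  using scaleC_of_real[of 1 x] by simp

lemma scaleC_zero_left [simp]: "0 *\<^sub>C (x::'a::complex_hilbert_space) = 0"
  using scaleC_of_real[of 0 x] by simp

lemma scaleC_zero_right [simp]: "a *\<^sub>C (0::'a::complex_hilbert_space) = 0"
  using scaleC_add_right[of a 0 0] by simp

lemma scaleC_minus_right: "a *\<^sub>C (- x) = - (a *\<^sub>C (x::'a::complex_hilbert_space))"
  using scaleC_add_right[of a x "-x"] by (simp add: eq_neg_iff_add_eq_0 add.commute)

lemma scaleC_minus_left: "(- a) *\<^sub>C x = - (a *\<^sub>C (x::'a::complex_hilbert_space))"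
  using scaleC_add_left[of a "-a" x] by (simp add: eq_neg_iff_add_eq_0 add.commute)

lemma scaleC_diff_right: "a *\<^sub>C (x - y) = a *\<^sub>C x - a *\<^sub>C (y::'a::complex_hilbert_space)"
  using scaleC_add_right[of a x "-y"] by (simp add: scaleC_minus_right)

lemma scaleC_diff_left: "(a - b) *\<^sub>C x = a *\<^sub>C x - b *\<^sub>C (x::'a::complex_hilbert_space)"
  using scaleC_add_left[of a "-b" x] by (simp add: scaleC_minus_left)

lemma scaleC_sum_right: "a *\<^sub>C (\<Sum>i\<in>I. f i) = (\<Sum>i\<in>I. a *\<^sub>C (f i::'a::complex_hilbert_space))"
  by (induction I rule: infinite_finite_induct) (auto simp: scaleC_add_right)

lemma cinner_add_left: "cinner (x + y) z = cinner x z + cinner (y::'a::complex_hilbert_space) z"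
  by (metis cinner_add_right cinner_commute complex_cnj_add)

lemma cinner_scaleC_left: "cinner (a *\<^sub>C x) y = cnj a * cinner (x::'a::complex_hilbert_space) y"
  by (metis cinner_commute cinner_scaleC_right complex_cnj_mult)

lemma cinner_zero_right [simp]: "cinner x (0::'a::complex_hilbert_space) = 0"
  using cinner_add_right[of x 0 0] by simp

lemma cinner_sum_right: "cinner x (\<Sum>i\<in>I. f i) = (\<Sum>i\<in>I. cinner x (f i::'a::complex_hilbert_space))"
  by (induction I rule: infinite_finite_induct) (auto simp: cinner_add_right)

text \<open>Both components are real inner products because \<open>Im w = Re (- i w)\<close>;
  continuity and invariance of \<open>cinner\<close> then follow from those of
  \<open>inner\<close>.\<close>

lemma cinner_eq_Complex:
  "cinner x y = Complex (inner x y) (inner x ((-\<i>) *\<^sub>C (y::'a::complex_hilbert_space)))"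
  by (simp add: complex_eq_iff inner_Re_cinner cinner_scaleC_right)

lemma cinner_self: "cinner x x = complex_of_real ((norm (x::'a::complex_hilbert_space))\<^sup>2)"
proof -
  have "Im (cinner x x) = 0"
    using cinner_commute[of x x] by (simp add: complex_eq_iff)
  thus ?thesis
    by (simp add: complex_eq_iff power2_norm_eq_inner inner_Re_cinner)
qed

lemma norm_scaleC [simp]: "norm (a *\<^sub>C x) = cmod a * norm (x::'a::complex_hilbert_space)"
proof -
  have "cinner (a *\<^sub>C x) (a *\<^sub>C x) = (a * cnj a) * cinner x x"
    by (simp add: cinner_scaleC_left cinner_scaleC_right mult_ac)
  hence "complex_of_real ((norm (a *\<^sub>C x))\<^sup>2) = complex_of_real ((cmod a * norm x)\<^sup>2)"
    unfolding cinner_self complex_norm_square[symmetric] by (simp add: power_mult_distrib)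
  hence "(norm (a *\<^sub>C x))\<^sup>2 = (cmod a * norm x)\<^sup>2" unfolding of_real_eq_iff .
  thus ?thesis by simp
qed

lemma bounded_linear_scaleC: "bounded_linear (\<lambda>x::'a::complex_hilbert_space. a *\<^sub>C x)"
proof (rule bounded_linear_intro[where K="cmod a"])
  show "a *\<^sub>C (r *\<^sub>R x) = r *\<^sub>R (a *\<^sub>C x)" for r x
    by (simp add: scaleR_scaleC scaleC_scaleC mult.commute)
qed (auto simp: scaleC_add_right)

lemmas tendsto_scaleC = bounded_linear.tendsto[OF bounded_linear_scaleC]

lemma tendsto_cinner:
  fixes x y :: "'a::complex_hilbert_space"
  assumes "(f \<longlongrightarrow> x) F" "(g \<longlongrightarrow> y) F"
  shows "((\<lambda>n. cinner (f n) (g n)) \<longlongrightarrow> cinner x y) F"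
  unfolding cinner_eq_Complex
  by (intro tendsto_Complex tendsto_inner tendsto_scaleC assms)

text \<open>Evaluating the form at \<open>x + P x\<close> leaves
  \<open>2 * inner (P x) (P x) = 0\<close>. Symmetry is essential: a rotation by a right angle has
  vanishing form. Projections are later compared through their norms in this way.\<close>

lemma symmetric_form_zero:
  fixes P :: "'a::real_inner \<Rightarrow> 'a"
  assumes add: "\<And>x y. P (x + y) = P x + P y"
    and sym: "\<And>x y. inner (P x) y = inner x (P y)"
    and zero: "\<And>x. inner x (P x) = 0"
  shows "P x = 0"
proof -
  have "inner (x + P x) (P (x + P x)) = 0" by (rule zero)
  hence "inner x (P (P x)) + inner (P x) (P x) = 0"
    by (simp only: add inner_add_left inner_add_right zero add_0_left add_0_right)
  thus ?thesis using sym[of x "P x"] by simp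
qed

section \<open>Projection valued measures\<close>

lemma vimage_singleton_empty: "c \<notin> range p \<Longrightarrow> p -` {c} = {}"
  by auto

locale pvm =
  fixes E :: "real set \<Rightarrow> 'a::complex_hilbert_space \<Rightarrow> 'a"
  assumes pvm: "projection_valued_measure E"
begin

lemma proj: "A \<in> sets borel \<Longrightarrow> orthogonal_projection (E A)"
  using pvm by (auto simp: projection_valued_measure_def)

lemma
  assumes "A \<in> sets borel"
  shows E_add: "E A (x + y) = E A x + E A y"
    and E_scaleC: "E A (c *\<^sub>C x) = c *\<^sub>C E A x"
    and E_idem [simp]: "E A (E A x) = E A x"
    and E_cinner: "cinner (E A x) y = cinner x (E A y)"
  using proj[OF assms] by (auto simp: orthogonal_projection_def clinear_map_def)

lemma E_UNIV [simp]: "E UNIV x = x"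
  using pvm by (auto simp: projection_valued_measure_def)

lemma E_Int: "A \<in> sets borel \<Longrightarrow> B \<in> sets borel \<Longrightarrow> E A (E B x) = E (A \<inter> B) x"
  using pvm by (auto simp: projection_valued_measure_def)

lemma E_sums:
  "range A \<subseteq> sets borel \<Longrightarrow> disjoint_family A \<Longrightarrow> (\<lambda>n::nat. E (A n) x) sums E (\<Union>n. A n) x"
  using pvm unfolding projection_valued_measure_def by blast

text \<open>Countable additivity for the constant family \<open>{}\<close> gives a convergent series
  with all terms equal, so that term is 0.\<close>

lemma E_empty [simp]: "E {} x = 0"
proof -
  have "(\<lambda>n::nat. E {} x) sums E (\<Union>n::nat. {}) x"
    by (rule E_sums) (auto simp: disjoint_family_on_def)
  hence "(\<lambda>n::nat. E {} x) \<longlonglongrightarrow> 0" by (intro summable_LIMSEQ_zero) (simp add: sums_iff)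
  thus ?thesis by (simp add: LIMSEQ_const_iff)
qed

lemma E_inner: "A \<in> sets borel \<Longrightarrow> inner (E A x) y = inner x (E A y)"
  by (simp add: inner_Re_cinner E_cinner)

lemma norm_E: "A \<in> sets borel \<Longrightarrow> (norm (E A x))\<^sup>2 = inner x (E A x)"
  by (simp add: power2_norm_eq_inner E_inner)

lemma norm_E_le: assumes "A \<in> sets borel" shows "norm (E A x) \<le> norm x"
proof (cases "E A x = 0")
  case False
  have "(norm (E A x))\<^sup>2 \<le> norm x * norm (E A x)"
    unfolding norm_E[OF assms] by (rule norm_cauchy_schwarz)
  thus ?thesis using False by (simp add: power2_eq_square)
qed auto

lemma E_bounded_linear: assumes "A \<in> sets borel" shows "bounded_linear (E A)"
proof (rule bounded_linear_intro[where K=1])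
  show "E A (r *\<^sub>R x) = r *\<^sub>R E A x" for r x
    by (simp add: scaleR_scaleC E_scaleC assms)
qed (auto simp: assms E_add norm_E_le)

lemma E_diff: "A \<in> sets borel \<Longrightarrow> E A (x - y) = E A x - E A y"
  by (rule linear_diff) (simp add: E_bounded_linear bounded_linear.linear)

lemma E_sum: "A \<in> sets borel \<Longrightarrow> E A (\<Sum>i\<in>I. f i) = (\<Sum>i\<in>I. E A (f i))"
  by (rule linear_sum) (simp add: E_bounded_linear bounded_linear.linear)

lemma E_tendsto: "A \<in> sets borel \<Longrightarrow> (f \<longlongrightarrow> x) F \<Longrightarrow> ((\<lambda>n. E A (f n)) \<longlongrightarrow> E A x) F"
  by (rule bounded_linear.tendsto[OF E_bounded_linear])

lemma E_Un:
  assumes "A \<in> sets borel" "B \<in> sets borel" "A \<inter> B = {}"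
  shows "E (A \<union> B) x = E A x + E B x"
proof -
  have "(\<lambda>n. E (binaryset A B n) x) sums E (\<Union>n. binaryset A B n) x"
    using assms by (intro E_sums)
      (auto simp: binaryset_def disjoint_family_on_def)
  moreover have "(\<lambda>n. E (binaryset A B n) x) sums (E A x + E B x)"
    by (rule binaryset_sums) simp
  ultimately show ?thesis by (simp add: UN_binaryset_eq sums_unique2)
qed

lemma E_UN_finite:
  assumes "finite I" "\<And>i. i \<in> I \<Longrightarrow> A i \<in> sets borel" "disjoint_family_on A I"
  shows "E (\<Union>i\<in>I. A i) x = (\<Sum>i\<in>I. E (A i) x)"
  using assms
proof (induction I rule: finite_induct)
  case (insert i I)
  have "E (A i \<union> (\<Union>i\<in>I. A i)) x = E (A i) x + E (\<Union>i\<in>I. A i) x"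
    using insert by (intro E_Un) (auto simp: disjoint_family_on_def)
  with insert show ?case by (auto simp: disjoint_family_on_def)
qed auto

abbreviation mu :: "'a \<Rightarrow> real measure" where "mu x \<equiv> scalar_measure E x"

lemma sets_mu [simp, measurable_cong]: "sets (mu x) = sets borel"
  unfolding scalar_measure_def
  by (subst sets_measure_of) (auto simp: sets.sigma_sets_eq[of borel, simplified])

lemma space_mu [simp]: "space (mu x) = UNIV"
  unfolding scalar_measure_def by (subst space_measure_of) auto

lemma emeasure_mu:
  assumes "A \<in> sets borel" shows "emeasure (mu x) A = ennreal ((norm (E A x))\<^sup>2)"
  unfolding scalar_measure_def
proof (rule emeasure_measure_of_sigma)
  show "sigma_algebra UNIV (sets borel :: real set set)"
    using sets.sigma_algebra_axioms[of borel] by simp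
  show "positive (sets borel) (\<lambda>A. ennreal ((norm (E A x))\<^sup>2))"
    by (auto simp: positive_def)
  show "countably_additive (sets borel) (\<lambda>A. ennreal ((norm (E A x))\<^sup>2))"
    unfolding countably_additive_def
  proof (intro allI impI)
    fix A :: "nat \<Rightarrow> real set"
    assume A: "range A \<subseteq> sets borel" "disjoint_family A" "\<Union> (range A) \<in> sets borel"
    \<comment> \<open>The squared norm equals \<open>inner x (E A x)\<close>, which depends linearly
      on \<open>E A x\<close>; strong additivity of \<open>E\<close> therefore carries over.\<close>
    have "(\<lambda>n. inner x (E (A n) x)) sums inner x (E (\<Union>n. A n) x)"
      by (rule bounded_linear.sums[OF bounded_linear_inner_right E_sums[OF A(1,2)]])
    hence "(\<lambda>n. (norm (E (A n) x))\<^sup>2) sums (norm (E (\<Union>n. A n) x))\<^sup>2"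
      using A by (subst norm_E, simp) (subst (asm) norm_E[symmetric], auto simp flip: norm_E)
    thus "(\<Sum>n. ennreal ((norm (E (A n) x))\<^sup>2)) = ennreal ((norm (E (\<Union>n. A n) x))\<^sup>2)"
      by (intro suminf_ennreal_eq) auto
  qed
qed (use assms in auto)

lemma finite_measure_mu: "finite_measure (mu x)"
  by (rule finite_measureI) (simp add: emeasure_mu)

section \<open>Spectral integrals of simple functions\<close>

abbreviation simple :: "(real \<Rightarrow> 'b) \<Rightarrow> bool" where "simple \<equiv> simple_function borel"
abbreviation SSI :: "(real \<Rightarrow> complex) \<Rightarrow> 'a \<Rightarrow> 'a" where "SSI \<equiv> simple_spectral_integral E"

lemma simple_range: "simple s \<Longrightarrow> finite (range s)"
  by (auto simp: simple_function_def)

lemma simple_vimage: "simple s \<Longrightarrow> s -` B \<in> sets borel"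
  using simple_functionD(2)[of borel s B] by simp

text \<open>\<open>simple_spectral_integral\<close> sums over the values of the integrand, so the
  sums for two functions run over different sets. Summing over the values of a finer
  \<open>p\<close> repairs this: with \<open>p = (s, t)\<close> both live on one partition.\<close>

lemma SSI_comp:
  fixes p :: "real \<Rightarrow> 'b"
  assumes "simple p"
  shows "SSI (\<lambda>t. g (p t)) x = (\<Sum>b\<in>range p. g b *\<^sub>C E (p -` {b}) x)"
proof -
  note fin = simple_range[OF assms] and meas = simple_vimage[OF assms]
  have "(\<Sum>b\<in>range p. g b *\<^sub>C E (p -` {b}) x) =
      (\<Sum>c\<in>g ` range p. \<Sum>b\<in>{b \<in> range p. g b = c}. g b *\<^sub>C E (p -` {b}) x)"
    by (rule sum.image_gen[OF fin])
  also have "\<dots> = (\<Sum>c\<in>g ` range p. c *\<^sub>C E ((\<lambda>t. g (p t)) -` {c}) x)"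
  proof (intro sum.cong refl)
    fix c
    have "(\<lambda>t. g (p t)) -` {c} = (\<Union>b\<in>{b \<in> range p. g b = c}. p -` {b})" by auto
    moreover have "E (\<Union>b\<in>{b \<in> range p. g b = c}. p -` {b}) x =
        (\<Sum>b\<in>{b \<in> range p. g b = c}. E (p -` {b}) x)"
      using fin meas by (intro E_UN_finite) (auto simp: disjoint_family_on_def)
    ultimately show "(\<Sum>b\<in>{b \<in> range p. g b = c}. g b *\<^sub>C E (p -` {b}) x) =
        c *\<^sub>C E ((\<lambda>t. g (p t)) -` {c}) x"
      by (simp add: scaleC_sum_right)
  qed
  finally show ?thesis by (simp add: simple_spectral_integral_def image_image)
qed

lemma SSI_add:
  assumes "simple s" "simple t"
  shows "SSI (\<lambda>u. s u + t u) x = SSI s x + SSI t x"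
proof -
  have p: "simple (\<lambda>u. (s u, t u))" by (rule simple_function_Pair[OF assms])
  show ?thesis
    using SSI_comp[OF p, of "\<lambda>(a, b). a + b" x] SSI_comp[OF p, of fst x] SSI_comp[OF p, of snd x]
    by (simp add: case_prod_beta scaleC_add_left sum.distrib)
qed

lemma SSI_diff:
  assumes "simple s" "simple t"
  shows "SSI (\<lambda>u. s u - t u) x = SSI s x - SSI t x"
proof -
  have p: "simple (\<lambda>u. (s u, t u))" by (rule simple_function_Pair[OF assms])
  show ?thesis
    using SSI_comp[OF p, of "\<lambda>(a, b). a - b" x] SSI_comp[OF p, of fst x] SSI_comp[OF p, of snd x]
    by (simp add: case_prod_beta scaleC_diff_left sum_subtractf)
qed

lemma SSI_vec_add: "simple s \<Longrightarrow> SSI s (x + y) = SSI s x + SSI s y"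
  by (simp add: simple_spectral_integral_def E_add simple_vimage scaleC_add_right sum.distrib)

lemma SSI_mult:
  assumes "simple s" "simple t"
  shows "SSI (\<lambda>u. s u * t u) x = SSI s (SSI t x)"
proof -
  have p: "simple (\<lambda>u. (s u, t u))" by (rule simple_function_Pair[OF assms])
  have "SSI (\<lambda>u. s u * t u) x =
      (\<Sum>c\<in>range (\<lambda>u. (s u, t u)). (fst c * snd c) *\<^sub>C E ((\<lambda>u. (s u, t u)) -` {c}) x)"
    using SSI_comp[OF p, of "\<lambda>(a, b). a * b" x] by (simp add: case_prod_beta)
  \<comment> \<open>Pairs of values that are never attained together have an empty preimage and
    contribute 0.\<close>
  also have "\<dots> = (\<Sum>c\<in>range s \<times> range t. (fst c * snd c) *\<^sub>C E ((\<lambda>u. (s u, t u)) -` {c}) x)"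
  proof (rule sum.mono_neutral_left)
    show "\<forall>c\<in>range s \<times> range t - range (\<lambda>u. (s u, t u)).
        (fst c * snd c) *\<^sub>C E ((\<lambda>u. (s u, t u)) -` {c}) x = 0"
    proof
      fix c :: "complex \<times> complex" assume "c \<in> range s \<times> range t - range (\<lambda>u. (s u, t u))"
      hence "(\<lambda>u. (s u, t u)) -` {c} = {}" by (intro vimage_singleton_empty) simp
      thus "(fst c * snd c) *\<^sub>C E ((\<lambda>u. (s u, t u)) -` {c}) x = 0" by simp
    qed
  qed (use assms in \<open>auto simp: simple_range\<close>)
  also have "\<dots> = (\<Sum>a\<in>range s. \<Sum>b\<in>range t. (a * b) *\<^sub>C E (s -` {a}) (E (t -` {b}) x))"
    unfolding sum.cartesian_product
    by (rule sum.cong) (use assms in \<open>auto simp: E_Int simple_vimage vimage_def Int_def\<close>)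
  also have "\<dots> = SSI s (SSI t x)"
    using assms by (simp add: simple_spectral_integral_def E_sum E_scaleC simple_vimage
        scaleC_sum_right scaleC_scaleC)
  finally show ?thesis .
qed

lemma SSI_const: "SSI (\<lambda>_. c) x = c *\<^sub>C x"
  by (simp add: simple_spectral_integral_def)

lemma SSI_indicator:
  assumes "A \<in> sets borel" shows "SSI (indicator A) x = E A x"
proof -
  have p: "simple (\<lambda>t. t \<in> A)"
    using simple_function_compose1[OF simple_function_indicator[of A borel],
        of "\<lambda>b::complex. b = 1"] assms by (simp add: indicator_eq_1_iff)
  have 1: "indicator A = (\<lambda>t. of_bool (t \<in> A) :: complex)" by (auto simp: fun_eq_iff)
  have "SSI (indicator A) x = (\<Sum>b\<in>range (\<lambda>t. t \<in> A). of_bool b *\<^sub>C E ((\<lambda>t. t \<in> A) -` {b}) x)"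
    unfolding 1 by (rule SSI_comp[OF p])
  \<comment> \<open>If \<open>A\<close> is empty or everything, one truth value is missing from the
    range; its preimage is empty, so adding it changes nothing.\<close>
  also have "\<dots> = (\<Sum>b\<in>UNIV. of_bool b *\<^sub>C E ((\<lambda>t. t \<in> A) -` {b}) x)"
  proof (rule sum.mono_neutral_left)
    show "\<forall>b\<in>UNIV - range (\<lambda>t. t \<in> A). of_bool b *\<^sub>C E ((\<lambda>t. t \<in> A) -` {b}) x = 0"
    proof
      fix b assume "b \<in> UNIV - range (\<lambda>t. t \<in> A)"
      hence "(\<lambda>t. t \<in> A) -` {b} = {}" by auto
      thus "of_bool b *\<^sub>C E ((\<lambda>t. t \<in> A) -` {b}) x = 0" by (simp only: E_empty scaleC_zero_right)
    qed
  qed auto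
  also have "\<dots> = E A x" by (simp add: UNIV_bool vimage_def)
  finally show ?thesis .
qed

lemma SSI_cinner:
  assumes "simple s" shows "cinner (SSI s x) y = cinner x (SSI (\<lambda>t. cnj (s t)) y)"
proof -
  have "cinner (SSI s x) y = cnj (cinner y (SSI s x))" by (rule cinner_commute)
  also have "\<dots> = (\<Sum>c\<in>range s. cnj c * cinner (E (s -` {c}) x) y)"
    by (simp add: simple_spectral_integral_def cinner_sum_right cinner_scaleC_right cnj_sum
        flip: cinner_commute)
  also have "\<dots> = cinner x (SSI (\<lambda>t. cnj (s t)) y)"
    using assms unfolding SSI_comp[OF assms]
    by (simp add: cinner_sum_right cinner_scaleC_right E_cinner simple_vimage)
  finally show ?thesis .
qed

text \<open>The squared L2 norm of \<open>f\<close> with respect to \<open>mu x\<close>, in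
  \<open>ennreal\<close> so that no integrability has to be known in advance.\<close>

definition N2 :: "'a \<Rightarrow> (real \<Rightarrow> complex) \<Rightarrow> ennreal" where
  "N2 x f = (\<integral>\<^sup>+ t. ennreal ((cmod (f t))\<^sup>2) \<partial>mu x)"

text \<open>Preimages of distinct values are disjoint, so the summands are orthogonal and Pythagoras
  applies. This is the isometry by which the calculus extends from simple functions to L2.\<close>

lemma SSI_norm:
  assumes "simple s" shows "ennreal ((norm (SSI s x))\<^sup>2) = N2 x s"
proof -
  note fin = simple_range[OF assms] and meas = simple_vimage[OF assms]
  have "(norm (SSI s x))\<^sup>2 = (\<Sum>c\<in>range s. (norm (c *\<^sub>C E (s -` {c}) x))\<^sup>2)"
    unfolding simple_spectral_integral_def
  proof (rule norm_sum_Pythagorean[OF fin], rule pairwiseI)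
    fix c d :: complex assume "c \<noteq> d"
    have "cinner (E (s -` {c}) x) (E (s -` {d}) x) = cinner x (E (s -` {c} \<inter> s -` {d}) x)"
      by (simp add: E_cinner meas E_Int)
    also have "s -` {c} \<inter> s -` {d} = {}" using \<open>c \<noteq> d\<close> by auto
    finally show "orthogonal (c *\<^sub>C E (s -` {c}) x) (d *\<^sub>C E (s -` {d}) x)"
      by (simp add: orthogonal_def inner_Re_cinner cinner_scaleC_left cinner_scaleC_right)
  qed
  hence "ennreal ((norm (SSI s x))\<^sup>2) =
      (\<Sum>c\<in>range s. ennreal ((cmod c)\<^sup>2) * emeasure (mu x) (s -` {c}))"
    by (simp add: power_mult_distrib emeasure_mu meas sum_ennreal flip: ennreal_mult)
  also have "\<dots> = (\<Sum>c\<in>range s. \<integral>\<^sup>+ t. ennreal ((cmod c)\<^sup>2) * indicator (s -` {c}) t \<partial>mu x)"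
    by (intro sum.cong refl) (simp add: nn_integral_cmult_indicator meas)
  also have "\<dots> = (\<integral>\<^sup>+ t. (\<Sum>c\<in>range s. ennreal ((cmod c)\<^sup>2) * indicator (s -` {c}) t) \<partial>mu x)"
    using meas by (intro nn_integral_sum[symmetric]) auto
  also have "\<dots> = N2 x s"
    unfolding N2_def
  proof (rule nn_integral_cong)
    fix t
    have "(\<Sum>c\<in>range s. ennreal ((cmod c)\<^sup>2) * indicator (s -` {c}) t) =
        (\<Sum>c\<in>{s t}. ennreal ((cmod c)\<^sup>2) * indicator (s -` {c}) t)"
      using fin by (intro sum.mono_neutral_right) (auto simp: indicator_def)
    thus "(\<Sum>c\<in>range s. ennreal ((cmod c)\<^sup>2) * indicator (s -` {c}) t) = ennreal ((cmod (s t))\<^sup>2)"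
      by simp
  qed
  finally show ?thesis .
qed

lemma SSI_bounded:
  assumes "simple s" shows "bounded_linear (SSI s)"
  unfolding simple_spectral_integral_def
  by (intro bounded_linear_sum bounded_linear_compose[OF bounded_linear_scaleC] E_bounded_linear
      simple_vimage assms)

end

section \<open>Holomorphic functions on a strip\<close>

lemma closure_strip_pi: "closure strip_pi = {z. 0 \<le> Im z \<and> Im z \<le> pi}"
proof
  have "closed {z. 0 \<le> Im z \<and> Im z \<le> pi}"
    by (intro closed_Collect_conj closed_Collect_le continuous_intros)
  thus "closure strip_pi \<subseteq> {z. 0 \<le> Im z \<and> Im z \<le> pi}"
    by (intro closure_minimal) (auto simp: strip_pi_def)
  show "{z. 0 \<le> Im z \<and> Im z \<le> pi} \<subseteq> closure strip_pi"
  proof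
    fix z assume "z \<in> {z. 0 \<le> Im z \<and> Im z \<le> pi}"
    hence z: "0 \<le> Im z" "Im z \<le> pi" by auto
    show "z \<in> closure strip_pi"
      unfolding closure_approachable
    proof (intro allI impI)
      fix e :: real assume e: "e > 0"
      \<comment> \<open>\<open>w\<close> moves \<open>z\<close> towards the middle line
        \<open>Im = pi / 2\<close> by the fraction \<open>s\<close>; a shift by at most
        \<open>s * pi\<close> stays below \<open>e\<close>, and \<open>s > 0\<close> makes
        \<open>w\<close> interior.\<close>
      define s where "s = min (1/2) (e / (2 * pi))"
      have s: "0 < s" "s \<le> 1/2" "s * pi < e"
        using e pi_gt_zero by (auto simp: s_def min_def field_simps)
      define w where "w = Complex (Re z) ((1 - s) * Im z + s * (pi / 2))"
      have "(1 - s) * Im z \<ge> 0" "(1 - s) * Im z \<le> (1 - s) * pi" "s * pi > 0"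
        using z s by (auto intro!: mult_left_mono)
      hence "w \<in> strip_pi" by (auto simp: strip_pi_def w_def algebra_simps)
      moreover have "dist w z < e"
      proof -
        have "w - z = Complex 0 (s * (pi / 2 - Im z))"
          by (simp add: w_def complex_eq_iff algebra_simps)
        hence "dist w z = s * \<bar>pi / 2 - Im z\<bar>"
          using s by (simp add: dist_norm cmod_def abs_mult)
        also have "\<dots> \<le> s * pi"
          using s z by (intro mult_left_mono) auto
        finally show ?thesis using s by simp
      qed
      ultimately show "\<exists>y\<in>strip_pi. dist y z < e" by blast
    qed
  qed
qed

lemma open_strip_pi: "open strip_pi"
  unfolding strip_pi_def by (intro open_Collect_conj open_Collect_less continuous_intros)

text \<open>Extending by \<open>0\<close> below the real axis gives a holomorphic function with interior zeros.\<close>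

lemma strip_pi_eq_0:
  assumes cont: "continuous_on (closure strip_pi) g" and hol: "g holomorphic_on strip_pi"
    and zero: "\<And>t. g (complex_of_real t) = 0" and z: "z \<in> closure strip_pi"
  shows "g z = 0"
proof -
  define S where "S = {z. - pi < Im z \<and> Im z < pi}"
  define h where "h z = (if Im z \<ge> 0 then g z else 0)" for z
  have "open S" unfolding S_def by (intro open_Collect_conj open_Collect_less continuous_intros)
  have "convex S"
  proof -
    have "S = {z. \<i> \<bullet> z > - pi} \<inter> {z. \<i> \<bullet> z < pi}" by (auto simp: S_def inner_complex_def)
    moreover have "convex ({z. \<i> \<bullet> z > - pi} \<inter> {z. \<i> \<bullet> z < pi})"
      by (intro convex_Int convex_halfspace_gt convex_halfspace_lt)
    ultimately show ?thesis by simp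
  qed
  have hol_h: "h holomorphic_on S"
  proof (rule holomorphic_on_paste_across_line[OF \<open>open S\<close>, of \<i> _ 0])
    show "h holomorphic_on S \<inter> {z. \<i> \<bullet> z < 0}"
      by (rule holomorphic_transform[of "\<lambda>_. 0"]) (auto simp: h_def inner_complex_def)
    show "h holomorphic_on S \<inter> {z. 0 < \<i> \<bullet> z}"
    proof (rule holomorphic_transform)
      show "g holomorphic_on S \<inter> {z. 0 < \<i> \<bullet> z}"
        by (rule holomorphic_on_subset[OF hol]) (auto simp: inner_complex_def S_def strip_pi_def)
    qed (auto simp: h_def inner_complex_def)
    have "continuous_on S (\<lambda>z. if Im z \<le> 0 then 0 else g z)"
    proof (rule continuous_on_cases_le)
      show "continuous_on {z \<in> S. 0 \<le> Im z} g"
        by (rule continuous_on_subset[OF cont]) (auto simp: closure_strip_pi S_def)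
      show "0 = g z" if "z \<in> S" "Im z = 0" for z
        using zero[of "Re z"] that by (simp add: complex_is_Real_iff of_real_Re)
    qed (auto intro: continuous_intros)
    moreover have "h z = (if Im z \<le> 0 then 0 else g z)" for z
      using zero[of "Re z"] by (auto simp: h_def complex_is_Real_iff of_real_Re)
    ultimately show "continuous_on S h" by presburger
  qed auto
  have g0: "g w = 0" if w: "w \<in> strip_pi" for w
  proof -
    have "h w = 0"
    proof (rule analytic_continuation_open[OF _ \<open>open S\<close> _ convex_connected[OF \<open>convex S\<close>] _ hol_h])
      show "open (S \<inter> {z. Im z < 0})"
        using \<open>open S\<close> by (intro open_Int open_Collect_less continuous_intros)
      have "- \<i> \<in> S \<inter> {z. Im z < 0}" using pi_ge_two by (auto simp: S_def)
      thus "S \<inter> {z. Im z < 0} \<noteq> {}" by blast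
      show "w \<in> S" using w by (auto simp: S_def strip_pi_def)
    qed (auto simp: h_def)
    thus ?thesis using w by (auto simp: h_def strip_pi_def split: if_splits)
  qed
  show ?thesis
    by (rule continuous_constant_on_closure[OF cont g0 z])
qed

text \<open>The Gaussian factor \<open>exp (- \<epsilon> z\<^sup>2)\<close> makes the function decay along the strip, so that
  the maximum principle applies to large rectangles.\<close>

lemma three_lines_strip_pi:
  assumes hol: "f holomorphic_on UNIV"
    and K: "\<And>z. z \<in> closure strip_pi \<Longrightarrow> cmod (f z) \<le> K"
    and M: "\<And>t. cmod (f (complex_of_real t)) \<le> M"
      "\<And>t. cmod (f (complex_of_real t + complex_of_real pi * \<i>)) \<le> M"
    and z: "z \<in> closure strip_pi"
  shows "cmod (f z) \<le> M"
proof -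
  have M0: "M \<ge> 0" using order_trans[OF norm_ge_zero M(1)] .
  \<comment> \<open>On the vertical sides the Gaussian beats \<open>K\<close> and leaves at most
    \<open>\<epsilon>\<close>; on the horizontal ones \<open>f\<close> is bounded by
    \<open>M\<close>. The factor \<open>exp (\<epsilon> * pi\<^sup>2)\<close> is what the Gaussian
    may gain, since \<open>Re (- w\<^sup>2) = (Im w)\<^sup>2 - (Re w)\<^sup>2\<close>.\<close>
  have main: "cmod (f z) * exp (- \<epsilon> * (Re z)\<^sup>2) \<le> (M + \<epsilon>) * exp (\<epsilon> * pi\<^sup>2)" if \<epsilon>: "\<epsilon> > 0" for \<epsilon>
  proof -
    define g where "g w = f w * exp (- complex_of_real \<epsilon> * w\<^sup>2)" for w
    have norm_g: "cmod (g w) = cmod (f w) * exp (\<epsilon> * ((Im w)\<^sup>2 - (Re w)\<^sup>2))" for w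
      by (simp add: g_def norm_mult Re_power2 algebra_simps)
    have "((\<lambda>R. K * exp (- \<epsilon> * R\<^sup>2)) \<longlongrightarrow> 0) at_top"
      using \<epsilon> by real_asymp
    hence "\<forall>\<^sub>F R in at_top. K * exp (- \<epsilon> * R\<^sup>2) < \<epsilon> \<and> R > \<bar>Re z\<bar>"
      by (intro eventually_conj order_tendstoD(2)[OF _ \<epsilon>] eventually_gt_at_top)
    from eventually_happens'[OF trivial_limit_at_top_linorder this]
    obtain R where R: "K * exp (- \<epsilon> * R\<^sup>2) < \<epsilon>" "R > \<bar>Re z\<bar>" by blast
    define S where "S = cbox (Complex (- R) 0) (Complex R pi)"
    have S_iff: "w \<in> S \<longleftrightarrow> - R \<le> Re w \<and> Re w \<le> R \<and> 0 \<le> Im w \<and> Im w \<le> pi" for w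
      by (auto simp: S_def in_cbox_complex_iff)
    have hol_g: "g holomorphic_on UNIV"
      unfolding g_def by (intro holomorphic_intros hol)
    have "cmod (g z) \<le> (M + \<epsilon>) * exp (\<epsilon> * pi\<^sup>2)"
    proof (rule maximum_modulus_frontier[where f=g and S=S])
      show "g holomorphic_on interior S" using hol_g by (rule holomorphic_on_subset) auto
      show "continuous_on (closure S) g"
        using holomorphic_on_imp_continuous_on[OF hol_g] by (rule continuous_on_subset) auto
      show "bounded S" by (simp add: S_def)
      show "z \<in> S" using z R by (auto simp: S_iff closure_strip_pi)
      fix w assume w: "w \<in> frontier S"
      have "closed S" unfolding S_def by (rule closed_cbox)
      hence wS: "w \<in> S" using w frontier_subset_closed by blast
      have im: "(Im w)\<^sup>2 \<le> pi\<^sup>2" using wS by (intro power_mono) (auto simp: S_iff)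
      have "w \<notin> box (Complex (- R) 0) (Complex R pi)"
        using w by (simp add: S_def frontier_cbox)
      hence "\<bar>Re w\<bar> = R \<or> Im w = 0 \<or> Im w = pi"
        using wS R(2) by (auto simp: S_iff in_box_complex_iff)
      thus "cmod (g w) \<le> (M + \<epsilon>) * exp (\<epsilon> * pi\<^sup>2)"
      proof
        assume "\<bar>Re w\<bar> = R"
        hence "(Re w)\<^sup>2 = R\<^sup>2" by (metis power2_abs)
        hence "cmod (g w) = (cmod (f w) * exp (- \<epsilon> * R\<^sup>2)) * exp (\<epsilon> * (Im w)\<^sup>2)"
          by (simp add: norm_g algebra_simps flip: exp_add)
        also have "\<dots> \<le> (M + \<epsilon>) * exp (\<epsilon> * pi\<^sup>2)"
        proof (intro mult_mono)
          have "cmod (f w) * exp (- \<epsilon> * R\<^sup>2) \<le> K * exp (- \<epsilon> * R\<^sup>2)"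
            using wS by (intro mult_right_mono K) (auto simp: S_iff closure_strip_pi)
          thus "cmod (f w) * exp (- \<epsilon> * R\<^sup>2) \<le> M + \<epsilon>" using R(1) M0 by linarith
        qed (use \<epsilon> im M0 in auto)
        finally show ?thesis .
      next
        assume "Im w = 0 \<or> Im w = pi"
        hence "w = complex_of_real (Re w) \<or> w = complex_of_real (Re w) + complex_of_real pi * \<i>"
          by (auto simp: complex_eq_iff)
        hence fw: "cmod (f w) \<le> M" using M by metis
        have "(Im w)\<^sup>2 - (Re w)\<^sup>2 \<le> pi\<^sup>2" using im by (simp add: add_increasing2 diff_le_eq)
        hence "exp (\<epsilon> * ((Im w)\<^sup>2 - (Re w)\<^sup>2)) \<le> exp (\<epsilon> * pi\<^sup>2)" using \<epsilon> by simp
        thus ?thesis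
          unfolding norm_g using fw \<epsilon> M0 by (intro mult_mono) auto
      qed
    qed
    moreover have "cmod (f z) * exp (- \<epsilon> * (Re z)\<^sup>2) \<le> cmod (g z)"
      unfolding norm_g using \<epsilon> by (intro mult_left_mono) (auto simp: algebra_simps)
    ultimately show ?thesis by linarith
  qed
  have "((\<lambda>\<epsilon>. cmod (f z) * exp (- \<epsilon> * (Re z)\<^sup>2)) \<longlongrightarrow> cmod (f z) * exp (- 0 * (Re z)\<^sup>2)) (at_right 0)"
    by (intro tendsto_intros)
  moreover have "((\<lambda>\<epsilon>. (M + \<epsilon>) * exp (\<epsilon> * pi\<^sup>2)) \<longlongrightarrow> (M + 0) * exp (0 * pi\<^sup>2)) (at_right 0)"
    by (intro tendsto_intros)
  ultimately show ?thesis
    using main tendsto_le[of "at_right (0::real)" "\<lambda>\<epsilon>. (M + \<epsilon>) * exp (\<epsilon> * pi\<^sup>2)" _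
        "\<lambda>\<epsilon>. cmod (f z) * exp (- \<epsilon> * (Re z)\<^sup>2)"]
    by (simp add: eventually_at_right_less eventually_mono[OF eventually_at_right_less])
qed

section \<open>Spectral integrals of square integrable functions\<close>

text \<open>One fixed choice makes \<open>SI\<close> a function. The factor 2 comes from the
  approximation theorem for metric spaces with base point 0 and supplies the dominating
  function.\<close>

definition simple_approx :: "(real \<Rightarrow> complex) \<Rightarrow> nat \<Rightarrow> real \<Rightarrow> complex" where
  "simple_approx f = (SOME s. (\<forall>n. simple_function borel (s n)) \<and> (\<forall>t. (\<lambda>n. s n t) \<longlonglongrightarrow> f t) \<and>
     (\<forall>n t. cmod (s n t) \<le> 2 * cmod (f t)))"

lemma
  assumes "f \<in> borel_measurable borel"
  shows simple_approx: "simple_function borel (simple_approx f n)"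
    and simple_approx_tendsto: "(\<lambda>n. simple_approx f n t) \<longlonglongrightarrow> f t"
    and simple_approx_bound: "cmod (simple_approx f n t) \<le> 2 * cmod (f t)"
proof -
  have "\<exists>s. (\<forall>n. simple_function borel (s n)) \<and> (\<forall>t. (\<lambda>n. s n t) \<longlonglongrightarrow> f t) \<and>
     (\<forall>n t. cmod (s n t) \<le> 2 * cmod (f t))"
    using borel_measurable_implies_sequence_metric[OF assms, of 0] by simp
  from someI_ex[OF this]
  show "simple_function borel (simple_approx f n)" "(\<lambda>n. simple_approx f n t) \<longlonglongrightarrow> f t"
    "cmod (simple_approx f n t) \<le> 2 * cmod (f t)"
    unfolding simple_approx_def by auto
qed

lemma simple_approx_measurable [measurable (raw)]:
  "f \<in> borel_measurable borel \<Longrightarrow> simple_approx f n \<in> borel_measurable borel"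
  by (rule borel_measurable_simple_function[OF simple_approx])

lemma cmod_add_square_le: "(cmod (a + b))\<^sup>2 \<le> 2 * ((cmod a)\<^sup>2 + (cmod b)\<^sup>2)"
proof -
  have "(cmod (a + b))\<^sup>2 \<le> (cmod a + cmod b)\<^sup>2"
    by (intro power_mono norm_triangle_ineq) auto
  also have "\<dots> \<le> 2 * ((cmod a)\<^sup>2 + (cmod b)\<^sup>2)"
    using sum_squares_bound[of "cmod a" "cmod b"] by (simp add: power2_sum algebra_simps)
  finally show ?thesis .
qed

lemma enn2real_tendsto_0: "(X \<longlongrightarrow> 0) F \<Longrightarrow> ((\<lambda>n. enn2real (X n)) \<longlongrightarrow> 0) F"
  using tendsto_enn2real[of X 0 F] by simp

lemma borel_measurable_cnj [measurable (raw)]: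
  "f \<in> borel_measurable M \<Longrightarrow> (\<lambda>x. cnj (f x)) \<in> borel_measurable M"
  by (rule measurable_compose[OF _ borel_measurable_continuous_onI]) (auto intro: continuous_intros)

context pvm begin

lemma N2_add:
  assumes [measurable]: "f \<in> borel_measurable borel" "g \<in> borel_measurable borel"
  shows "N2 x (\<lambda>t. f t + g t) \<le> 2 * (N2 x f + N2 x g)"
proof -
  have "N2 x (\<lambda>t. f t + g t) \<le> (\<integral>\<^sup>+t. 2 * (ennreal ((cmod (f t))\<^sup>2) + ennreal ((cmod (g t))\<^sup>2)) \<partial>mu x)"
    unfolding N2_def
  proof (rule nn_integral_mono)
    fix t
    show "ennreal ((cmod (f t + g t))\<^sup>2) \<le> 2 * (ennreal ((cmod (f t))\<^sup>2) + ennreal ((cmod (g t))\<^sup>2))"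
      using ennreal_leI[OF cmod_add_square_le[of "f t" "g t"]]
      by (simp add: ennreal_mult ennreal_plus)
  qed
  also have "\<dots> = 2 * (N2 x f + N2 x g)"
    unfolding N2_def by (simp add: nn_integral_cmult nn_integral_add)
  finally show ?thesis .
qed

lemma N2_uminus: "N2 x (\<lambda>t. - f t) = N2 x f"
  by (simp add: N2_def)

lemma N2_mono: "(\<And>t. cmod (f t) \<le> cmod (g t)) \<Longrightarrow> N2 x f \<le> N2 x g"
  unfolding N2_def by (intro nn_integral_mono ennreal_leI power_mono) auto

lemma N2_cmult:
  assumes [measurable]: "f \<in> borel_measurable borel"
  shows "N2 x (\<lambda>t. c * f t) = ennreal ((cmod c)\<^sup>2) * N2 x f"
  unfolding N2_def
  by (simp add: norm_mult power_mult_distrib ennreal_mult nn_integral_cmult)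

definition L2 :: "'a \<Rightarrow> (real \<Rightarrow> complex) \<Rightarrow> bool" where
  "L2 x f \<longleftrightarrow> f \<in> borel_measurable borel \<and> N2 x f < \<infinity>"

lemma L2_measurable: "L2 x f \<Longrightarrow> f \<in> borel_measurable borel"
  by (simp add: L2_def)

lemma L2_simple: "simple s \<Longrightarrow> L2 x s"
  by (simp add: L2_def borel_measurable_simple_function SSI_norm[symmetric])

lemma L2_add: "L2 x f \<Longrightarrow> L2 x g \<Longrightarrow> L2 x (\<lambda>t. f t + g t)"
  unfolding L2_def
  by (auto intro!: le_less_trans[OF N2_add] simp: ennreal_mult_less_top)

lemma L2_uminus: "L2 x f \<Longrightarrow> L2 x (\<lambda>t. - f t)"
  by (auto simp: L2_def N2_uminus)

lemma L2_diff: "L2 x f \<Longrightarrow> L2 x g \<Longrightarrow> L2 x (\<lambda>t. f t - g t)"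
  using L2_add[OF _ L2_uminus, of x f g] by simp

lemma L2_mono:
  "L2 x g \<Longrightarrow> f \<in> borel_measurable borel \<Longrightarrow> (\<And>t. cmod (f t) \<le> cmod (g t)) \<Longrightarrow> L2 x f"
  unfolding L2_def using N2_mono[of f g x] le_less_trans by auto

lemma L2_cmult: "L2 x f \<Longrightarrow> L2 x (\<lambda>t. c * f t)"
  by (auto simp: L2_def N2_cmult ennreal_mult_less_top)

lemma L2_cnj: "L2 x f \<Longrightarrow> L2 x (\<lambda>t. cnj (f t))"
  by (auto simp: L2_def N2_def)

lemma N2_bounded:
  assumes "\<And>t. cmod (f t) \<le> B" "B \<ge> 0"
  shows "N2 x f \<le> ennreal ((B * norm x)\<^sup>2)"
proof -
  have "N2 x f \<le> N2 x (\<lambda>_. complex_of_real B)"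
    by (rule N2_mono) (use assms in auto)
  also have "\<dots> = ennreal ((B * norm x)\<^sup>2)"
    using SSI_norm[of "\<lambda>_. complex_of_real B" x] assms(2) by (simp add: SSI_const)
  finally show ?thesis .
qed

lemma L2_bounded: "f \<in> borel_measurable borel \<Longrightarrow> (\<And>t. cmod (f t) \<le> B) \<Longrightarrow> L2 x f"
  unfolding L2_def
  by (auto intro!: le_less_trans[OF N2_bounded, of f B] intro: order_trans[OF norm_ge_zero])

lemma N2_add_tendsto_0:
  assumes [measurable]: "\<And>n. f n \<in> borel_measurable borel" "\<And>n. g n \<in> borel_measurable borel"
    and "(\<lambda>n. N2 x (f n)) \<longlonglongrightarrow> 0" "(\<lambda>n. N2 x (g n)) \<longlonglongrightarrow> 0"
  shows "(\<lambda>n. N2 x (\<lambda>t. f n t + g n t)) \<longlonglongrightarrow> 0"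
proof (rule tendsto_sandwich[OF _ _ tendsto_const])
  show "(\<lambda>n. 2 * (N2 x (f n) + N2 x (g n))) \<longlonglongrightarrow> 0"
    using ennreal_tendsto_cmult[of 2, OF _ tendsto_add[OF assms(3,4)]] by simp
  show "\<forall>\<^sub>F n in sequentially. N2 x (\<lambda>t. f n t + g n t) \<le> 2 * (N2 x (f n) + N2 x (g n))"
    by (intro always_eventually allI N2_add) auto
qed auto

lemma N2_dominated:
  assumes "L2 x w" and [measurable]: "\<And>n. f n \<in> borel_measurable borel" "g \<in> borel_measurable borel"
    and "\<And>n t. cmod (f n t) \<le> cmod (w t)" "\<And>t. (\<lambda>n. f n t) \<longlonglongrightarrow> g t"
  shows "(\<lambda>n. N2 x (f n)) \<longlonglongrightarrow> N2 x g"
  unfolding N2_def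
proof (rule nn_integral_dominated_convergence[where w="\<lambda>t. ennreal ((cmod (w t))\<^sup>2)"])
  note [measurable] = L2_measurable[OF assms(1)]
  show "(\<lambda>t. ennreal ((cmod (w t))\<^sup>2)) \<in> borel_measurable (mu x)" by measurable
  show "(\<integral>\<^sup>+ t. ennreal ((cmod (w t))\<^sup>2) \<partial>mu x) < \<infinity>"
    using assms(1) by (simp add: L2_def N2_def)
  show "AE t in mu x. (\<lambda>n. ennreal ((cmod (f n t))\<^sup>2)) \<longlonglongrightarrow> ennreal ((cmod (g t))\<^sup>2)"
    using assms(5) by (intro always_eventually allI tendsto_ennrealI tendsto_power tendsto_norm)
qed (use assms(4) in \<open>auto intro!: ennreal_leI power_mono\<close>)

text \<open>Bounds survive pointwise limits even when no dominating function is known, which is the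
  situation when membership in the domain is still to be shown.\<close>

lemma N2_Fatou:
  assumes [measurable]: "\<And>n. f n \<in> borel_measurable borel" "g \<in> borel_measurable borel"
    and lim: "\<And>t. (\<lambda>n. f n t) \<longlonglongrightarrow> g t" and K: "\<And>n. N2 x (f n) \<le> K"
  shows "N2 x g \<le> K"
proof -
  have "(\<lambda>n. ennreal ((cmod (f n t))\<^sup>2)) \<longlonglongrightarrow> ennreal ((cmod (g t))\<^sup>2)" for t
    using lim by (intro tendsto_ennrealI tendsto_power tendsto_norm)
  hence "liminf (\<lambda>n. ennreal ((cmod (f n t))\<^sup>2)) = ennreal ((cmod (g t))\<^sup>2)" for t
    by (intro lim_imp_Liminf sequentially_bot)
  hence "N2 x g = (\<integral>\<^sup>+ t. liminf (\<lambda>n. ennreal ((cmod (f n t))\<^sup>2)) \<partial>mu x)"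
    by (simp add: N2_def)
  also have "\<dots> \<le> liminf (\<lambda>n. N2 x (f n))"
    unfolding N2_def by (rule nn_integral_liminf) measurable
  also have "\<dots> \<le> liminf (\<lambda>n. K)"
    by (intro Liminf_mono always_eventually allI K)
  finally show ?thesis by (simp add: Liminf_const)
qed

lemma N2_simple_approx:
  assumes "L2 x f" shows "(\<lambda>n. N2 x (simple_approx f n)) \<longlonglongrightarrow> N2 x f"
proof (rule N2_dominated)
  note [measurable] = L2_measurable[OF assms]
  show "L2 x (\<lambda>t. 2 * f t)" by (rule L2_cmult[OF assms])
  show "cmod (simple_approx f n t) \<le> cmod (2 * f t)" for n t
    using simple_approx_bound[of f n t] by (simp add: norm_mult)
qed (use L2_measurable[OF assms] in \<open>auto intro: simple_approx_tendsto\<close>)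

lemma N2_simple_approx_diff:
  assumes "L2 x f" shows "(\<lambda>n. N2 x (\<lambda>t. simple_approx f n t - f t)) \<longlonglongrightarrow> 0"
proof -
  note [measurable] = L2_measurable[OF assms]
  have "(\<lambda>n. N2 x (\<lambda>t. simple_approx f n t - f t)) \<longlonglongrightarrow> N2 x (\<lambda>t. 0)"
  proof (rule N2_dominated)
    show "L2 x (\<lambda>t. 3 * f t)" by (rule L2_cmult[OF assms])
    show "cmod (simple_approx f n t - f t) \<le> cmod (3 * f t)" for n t
      using simple_approx_bound[of f n t] norm_triangle_ineq4[of "simple_approx f n t" "f t"]
      by (simp add: norm_mult)
    show "(\<lambda>n. simple_approx f n t - f t) \<longlonglongrightarrow> 0" for t
      using tendsto_diff[OF simple_approx_tendsto[of f t] tendsto_const[of "f t"]] by simp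
  qed auto
  thus ?thesis by (simp add: N2_def)
qed

text \<open>Applied to two members of one approximating sequence this gives the Cauchy property,
  applied to two different sequences the independence of the limit.\<close>

lemma SSI_close:
  assumes f: "L2 x f" and s: "simple s" and t: "simple t"
  shows "(norm (SSI s x - SSI t x))\<^sup>2 \<le>
    2 * (enn2real (N2 x (\<lambda>u. s u - f u)) + enn2real (N2 x (\<lambda>u. t u - f u)))"
proof -
  have L: "L2 x (\<lambda>u. s u - f u)" "L2 x (\<lambda>u. t u - f u)"
    using f s t by (auto intro: L2_diff L2_simple)
  have "ennreal ((norm (SSI s x - SSI t x))\<^sup>2) = N2 x (\<lambda>u. s u - t u)"
    using s t by (simp add: SSI_norm flip: SSI_diff)
  also have "\<dots> = N2 x (\<lambda>u. (s u - f u) + - (t u - f u))" by simp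
  also have "\<dots> \<le> 2 * (N2 x (\<lambda>u. s u - f u) + N2 x (\<lambda>u. - (t u - f u)))"
    using L L2_uminus[OF L(2)] by (intro N2_add) (auto dest: L2_measurable)
  also have "\<dots> = ennreal (2 * (enn2real (N2 x (\<lambda>u. s u - f u)) + enn2real (N2 x (\<lambda>u. t u - f u))))"
    using L unfolding N2_uminus by (simp add: L2_def ennreal_mult ennreal_plus)
  finally show ?thesis by (subst (asm) ennreal_le_iff) auto
qed

text \<open>The value of the spectral integral as a total function; it carries meaning only when
  \<open>L2 x f\<close> holds, which is the domain condition.\<close>

definition SI :: "(real \<Rightarrow> complex) \<Rightarrow> 'a \<Rightarrow> 'a" where
  "SI f x = lim (\<lambda>n. SSI (simple_approx f n) x)"

lemma SSI_simple_approx_convergent: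
  assumes "L2 x f" shows "convergent (\<lambda>n. SSI (simple_approx f n) x)"
proof (rule Cauchy_convergent)
  let ?s = "\<lambda>n. SSI (simple_approx f n) x"
  let ?a = "\<lambda>n. enn2real (N2 x (\<lambda>t. simple_approx f n t - f t))"
  have a: "?a \<longlonglongrightarrow> 0"
    by (rule enn2real_tendsto_0[OF N2_simple_approx_diff[OF assms]])
  show "Cauchy ?s"
  proof (rule CauchyI)
    fix e :: real assume "e > 0"
    hence "e\<^sup>2 / 4 > 0" by simp
    from order_tendstoD(2)[OF a this] obtain N where N: "\<And>n. n \<ge> N \<Longrightarrow> ?a n < e\<^sup>2 / 4"
      by (auto simp: eventually_sequentially)
    have "norm (?s m - ?s n) < e" if "m \<ge> N" "n \<ge> N" for m n
    proof -
      have "(norm (?s m - ?s n))\<^sup>2 \<le> 2 * (?a m + ?a n)"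
        using assms by (intro SSI_close simple_approx) (auto dest: L2_measurable)
      also have "\<dots> < e\<^sup>2" using N[OF that(1)] N[OF that(2)] by simp
      finally show ?thesis using \<open>e > 0\<close> by (simp add: power_less_imp_less_base)
    qed
    thus "\<exists>M. \<forall>m\<ge>M. \<forall>n\<ge>M. norm (?s m - ?s n) < e" by blast
  qed
qed

lemma SI_tendsto:
  assumes f: "L2 x f" and s: "\<And>n. simple (s n)"
    and lim: "(\<lambda>n. N2 x (\<lambda>t. s n t - f t)) \<longlonglongrightarrow> 0"
  shows "(\<lambda>n. SSI (s n) x) \<longlonglongrightarrow> SI f x"
proof -
  let ?q = "simple_approx f"
  have q: "(\<lambda>n. SSI (?q n) x) \<longlonglongrightarrow> SI f x"
    unfolding SI_def using SSI_simple_approx_convergent[OF f] by (simp add: convergent_LIMSEQ_iff)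
  have "(\<lambda>n. 2 * (enn2real (N2 x (\<lambda>u. s n u - f u)) + enn2real (N2 x (\<lambda>u. ?q n u - f u)))) \<longlonglongrightarrow>
      2 * (0 + 0)"
    by (rule tendsto_mult[OF tendsto_const tendsto_add[OF enn2real_tendsto_0[OF lim]
          enn2real_tendsto_0[OF N2_simple_approx_diff[OF f]]]])
  hence lim2: "(\<lambda>n. 2 * (enn2real (N2 x (\<lambda>u. s n u - f u)) +
      enn2real (N2 x (\<lambda>u. ?q n u - f u)))) \<longlonglongrightarrow> 0"
    by simp
  have "(\<lambda>n. (norm (SSI (s n) x - SSI (?q n) x))\<^sup>2) \<longlonglongrightarrow> 0"
  proof (rule Lim_null_comparison[OF always_eventually lim2], rule allI)
    fix n
    show "norm ((norm (SSI (s n) x - SSI (?q n) x))\<^sup>2) \<le> 2 * (enn2real (N2 x (\<lambda>u. s n u - f u)) +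
        enn2real (N2 x (\<lambda>u. ?q n u - f u)))"
      using SSI_close[OF f s simple_approx[OF L2_measurable[OF f]], of n n] by simp
  qed
  hence "(\<lambda>n. sqrt ((norm (SSI (s n) x - SSI (?q n) x))\<^sup>2)) \<longlonglongrightarrow> sqrt 0"
    by (rule tendsto_real_sqrt)
  hence "(\<lambda>n. SSI (s n) x - SSI (?q n) x) \<longlonglongrightarrow> 0"
    by (simp add: tendsto_norm_zero_iff)
  from tendsto_add[OF this q] show ?thesis by simp
qed

lemma spectral_integral_eq:
  assumes "f \<in> borel_measurable borel"
  shows "spectral_integral E f = {(x, SI f x) |x. L2 x f}"
proof -
  have "(x, y) \<in> spectral_integral E f \<longleftrightarrow> L2 x f \<and> y = SI f x" for x y
  proof
    assume "(x, y) \<in> spectral_integral E f"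
    then obtain s where f: "L2 x f" and s: "\<And>n. simple (s n)"
      "(\<lambda>n. N2 x (\<lambda>t. s n t - f t)) \<longlonglongrightarrow> 0" "(\<lambda>n. SSI (s n) x) \<longlonglongrightarrow> y"
      using assms by (auto simp: spectral_integral_def N2_def L2_def)
    from LIMSEQ_unique[OF s(3) SI_tendsto[OF f s(1,2)]] f
    show "L2 x f \<and> y = SI f x" by simp
  next
    assume *: "L2 x f \<and> y = SI f x"
    hence "\<exists>s. (\<forall>n. simple (s n)) \<and> (\<lambda>n. N2 x (\<lambda>t. s n t - f t)) \<longlonglongrightarrow> 0 \<and> (\<lambda>n. SSI (s n) x) \<longlonglongrightarrow> y"
      using SI_tendsto[OF _ simple_approx[OF assms] N2_simple_approx_diff]
      by (intro exI[of _ "simple_approx f"]) (auto intro: simple_approx assms N2_simple_approx_diff)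
    with * show "(x, y) \<in> spectral_integral E f"
      by (auto simp: spectral_integral_def N2_def L2_def)
  qed
  thus ?thesis by auto
qed

lemma SI_simple: assumes "simple s" shows "SI s x = SSI s x"
proof -
  have "(\<lambda>n::nat. SSI s x) \<longlonglongrightarrow> SI s x"
    using assms by (intro SI_tendsto L2_simple) (auto simp: N2_def)
  thus ?thesis by (simp add: LIMSEQ_const_iff)
qed

lemma SI_simple_approx: "L2 x f \<Longrightarrow> (\<lambda>n. SSI (simple_approx f n) x) \<longlonglongrightarrow> SI f x"
  by (intro SI_tendsto simple_approx N2_simple_approx_diff) (auto dest: L2_measurable)

lemma SI_norm:
  assumes "L2 x f" shows "ennreal ((norm (SI f x))\<^sup>2) = N2 x f"
proof (rule LIMSEQ_unique)
  show "(\<lambda>n. N2 x (simple_approx f n)) \<longlonglongrightarrow> N2 x f" by (rule N2_simple_approx[OF assms])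
  have "(\<lambda>n. ennreal ((norm (SSI (simple_approx f n) x))\<^sup>2)) \<longlonglongrightarrow> ennreal ((norm (SI f x))\<^sup>2)"
    by (intro tendsto_ennrealI tendsto_power tendsto_norm SI_simple_approx assms)
  thus "(\<lambda>n. N2 x (simple_approx f n)) \<longlonglongrightarrow> ennreal ((norm (SI f x))\<^sup>2)"
    using assms by (simp add: SSI_norm simple_approx L2_measurable)
qed

lemma SI_add:
  assumes "L2 x f" "L2 x g"
  shows "SI (\<lambda>t. f t + g t) x = SI f x + SI g x"
proof (rule LIMSEQ_unique)
  note [measurable] = assms[THEN L2_measurable]
  let ?s = "\<lambda>n t. simple_approx f n t + simple_approx g n t"
  show "(\<lambda>n. SSI (?s n) x) \<longlonglongrightarrow> SI f x + SI g x"
    using assms by (simp add: SSI_add simple_approx L2_measurable tendsto_add SI_simple_approx)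
  have "(\<lambda>n. N2 x (\<lambda>t. (simple_approx f n t - f t) + (simple_approx g n t - g t))) \<longlonglongrightarrow> 0"
    by (intro N2_add_tendsto_0 N2_simple_approx_diff assms) auto
  thus "(\<lambda>n. SSI (?s n) x) \<longlonglongrightarrow> SI (\<lambda>t. f t + g t) x"
    by (intro SI_tendsto L2_add assms simple_function_add simple_approx) (auto simp: algebra_simps)
qed

lemma SI_indicator: "A \<in> sets borel \<Longrightarrow> SI (indicator A) x = E A x"
  by (simp add: SI_simple SSI_indicator)

lemma SI_const: "SI (\<lambda>_. c) x = c *\<^sub>C x"
  by (simp add: SI_simple SSI_const)

lemma simple_bounded:
  fixes s :: "real \<Rightarrow> complex"
  assumes s: "simple s"
  obtains K where "K \<ge> 0" "\<And>t. cmod (s t) \<le> K"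
proof -
  have "finite ((\<lambda>t. cmod (s t)) ` UNIV)"
    using simple_range[OF s] by (metis finite_imageI image_image)
  hence "bdd_above (range (\<lambda>t. cmod (s t)))" by (rule bdd_above_finite)
  then obtain K where K: "\<And>t. cmod (s t) \<le> K" by (auto simp: bdd_above_def)
  thus ?thesis using that[of K] order_trans[OF norm_ge_zero K[of 0]] by blast
qed

lemma L2_simple_mult:
  assumes s: "simple s" and f: "L2 x f" shows "L2 x (\<lambda>t. s t * f t)"
proof -
  note [measurable] = L2_measurable[OF f] borel_measurable_simple_function[OF s]
  obtain K where "K \<ge> 0" "\<And>t. cmod (s t) \<le> K" using simple_bounded[OF s] by auto
  thus ?thesis
    by (intro L2_mono[OF L2_cmult[OF f, of "of_real K"]]) (auto simp: norm_mult mult_right_mono)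
qed

lemma SSI_SI:
  assumes s: "simple s" and f: "L2 x f"
  shows "SSI s (SI f x) = SI (\<lambda>t. s t * f t) x"
proof (rule LIMSEQ_unique)
  note [measurable] = L2_measurable[OF f] borel_measurable_simple_function[OF s]
  let ?q = "\<lambda>n t. s t * simple_approx f n t"
  have q: "simple (?q n)" for n
    by (intro simple_function_mult s simple_approx) auto
  show "(\<lambda>n. SSI (?q n) x) \<longlonglongrightarrow> SSI s (SI f x)"
    using bounded_linear.tendsto[OF SSI_bounded[OF s] SI_simple_approx[OF f]]
    by (simp add: SSI_mult s simple_approx)
  obtain K where K: "K \<ge> 0" "\<And>t. cmod (s t) \<le> K" using simple_bounded[OF s] by auto
  have "(\<lambda>n. N2 x (\<lambda>t. ?q n t - s t * f t)) \<longlonglongrightarrow> 0"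
  proof (rule tendsto_sandwich[OF _ _ tendsto_const])
    show "\<forall>\<^sub>F n in sequentially. N2 x (\<lambda>t. ?q n t - s t * f t) \<le>
        ennreal (K\<^sup>2) * N2 x (\<lambda>t. simple_approx f n t - f t)"
    proof (intro always_eventually allI)
      fix n
      have "N2 x (\<lambda>t. ?q n t - s t * f t) \<le> N2 x (\<lambda>t. of_real K * (simple_approx f n t - f t))"
        by (rule N2_mono) (use K in \<open>auto simp: norm_mult mult_right_mono simp flip: right_diff_distrib\<close>)
      thus "N2 x (\<lambda>t. ?q n t - s t * f t) \<le> ennreal (K\<^sup>2) * N2 x (\<lambda>t. simple_approx f n t - f t)"
        by (simp add: N2_cmult)
    qed
    show "(\<lambda>n. ennreal (K\<^sup>2) * N2 x (\<lambda>t. simple_approx f n t - f t)) \<longlonglongrightarrow> 0"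
      using ennreal_tendsto_cmult[OF _ N2_simple_approx_diff[OF f], of "ennreal (K\<^sup>2)"] by simp
  qed auto
  thus "(\<lambda>n. SSI (?q n) x) \<longlonglongrightarrow> SI (\<lambda>t. s t * f t) x"
    by (intro SI_tendsto L2_simple_mult s f q)
qed

text \<open>Since \<open>E A (SI f x)\<close> is the integral of \<open>indicator A * f\<close>, the
  isometry reads off the density. It turns every domain question for a composed operator into an
  integral against \<open>mu x\<close>.\<close>

lemma mu_SI:
  assumes f: "L2 x f" shows "mu (SI f x) = density (mu x) (\<lambda>t. ennreal ((cmod (f t))\<^sup>2))"
proof (rule measure_eqI)
  note [measurable] = L2_measurable[OF f]
  fix A assume "A \<in> sets (mu (SI f x))"
  hence A: "A \<in> sets borel" by simp
  have s: "simple (indicator A :: real \<Rightarrow> complex)" using A by auto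
  have "emeasure (mu (SI f x)) A = ennreal ((norm (SSI (indicator A) (SI f x)))\<^sup>2)"
    using A by (simp add: emeasure_mu SSI_indicator)
  also have "\<dots> = N2 x (\<lambda>t. indicator A t * f t)"
    using SSI_SI[OF s f] SI_norm[OF L2_simple_mult[OF s f]] by simp
  also have "\<dots> = (\<integral>\<^sup>+t. ennreal ((cmod (f t))\<^sup>2) * indicator A t \<partial>mu x)"
    unfolding N2_def by (intro nn_integral_cong) (auto simp: indicator_def)
  also have "\<dots> = emeasure (density (mu x) (\<lambda>t. ennreal ((cmod (f t))\<^sup>2))) A"
    using A by (simp add: emeasure_density)
  finally show "emeasure (mu (SI f x)) A = \<dots>" .
qed simp

lemma N2_SI:
  assumes "L2 x g" and [measurable]: "f \<in> borel_measurable borel"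
  shows "N2 (SI g x) f = N2 x (\<lambda>t. f t * g t)"
proof -
  note [measurable] = L2_measurable[OF assms(1)]
  have "N2 (SI g x) f = (\<integral>\<^sup>+t. ennreal ((cmod (g t))\<^sup>2) * ennreal ((cmod (f t))\<^sup>2) \<partial>mu x)"
    unfolding N2_def mu_SI[OF assms(1)] by (rule nn_integral_density) measurable
  thus ?thesis
    by (simp add: N2_def norm_mult power_mult_distrib ennreal_mult mult.commute)
qed

lemma L2_SI:
  assumes "L2 x g" "f \<in> borel_measurable borel"
  shows "L2 (SI g x) f \<longleftrightarrow> L2 x (\<lambda>t. f t * g t)"
  using assms N2_SI[OF assms] by (auto simp: L2_def)

lemma SI_cmult: "L2 x f \<Longrightarrow> SI (\<lambda>t. c * f t) x = c *\<^sub>C SI f x"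
  using SSI_SI[of "\<lambda>_. c" x f] by (simp add: SSI_const)

lemma SI_diff: "L2 x f \<Longrightarrow> L2 x g \<Longrightarrow> SI (\<lambda>t. f t - g t) x = SI f x - SI g x"
  using SI_add[of x f "\<lambda>t. -1 * g t"] SI_cmult[of x g "-1"] L2_cmult[of x g "-1"]
  by (simp add: scaleC_minus_left)

text \<open>The approximants of \<open>f\<close> are chosen with respect to \<open>SI g x\<close>,
  not \<open>x\<close>; \<open>N2_SI\<close> translates their error into the norm of
  \<open>(s - f) * g\<close> at \<open>x\<close>.\<close>

lemma SI_SI:
  assumes g: "L2 x g" and fg: "L2 x (\<lambda>t. f t * g t)" and f: "f \<in> borel_measurable borel"
  shows "SI f (SI g x) = SI (\<lambda>t. f t * g t) x"
proof (rule LIMSEQ_unique)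
  note [measurable] = L2_measurable[OF g] f
  have L: "L2 (SI g x) f" using L2_SI[OF g f] fg by simp
  let ?s = "simple_approx f"
  show "(\<lambda>n. SSI (?s n) (SI g x)) \<longlonglongrightarrow> SI f (SI g x)" by (rule SI_simple_approx[OF L])
  have Ls: "L2 x (\<lambda>t. ?s n t * g t)" for n by (rule L2_simple_mult[OF simple_approx[OF f] g])
  have "ennreal ((norm (SSI (?s n) (SI g x) - SI (\<lambda>t. f t * g t) x))\<^sup>2) =
      N2 (SI g x) (\<lambda>t. ?s n t - f t)" for n
  proof -
    have "SSI (?s n) (SI g x) - SI (\<lambda>t. f t * g t) x = SI (\<lambda>t. ?s n t * g t - f t * g t) x"
      by (simp add: SSI_SI simple_approx g f SI_diff[OF Ls fg])
    thus ?thesis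
      by (simp add: SI_norm[OF L2_diff[OF Ls fg]] N2_SI[OF g] left_diff_distrib)
  qed
  hence "(\<lambda>n. ennreal ((norm (SSI (?s n) (SI g x) - SI (\<lambda>t. f t * g t) x))\<^sup>2)) \<longlonglongrightarrow> 0"
    using N2_simple_approx_diff[OF L] by simp
  from enn2real_tendsto_0[OF this]
  have "(\<lambda>n. (norm (SSI (?s n) (SI g x) - SI (\<lambda>t. f t * g t) x))\<^sup>2) \<longlonglongrightarrow> 0" by simp
  from tendsto_real_sqrt[OF this]
  show "(\<lambda>n. SSI (?s n) (SI g x)) \<longlonglongrightarrow> SI (\<lambda>t. f t * g t) x"
    by (simp add: LIM_zero_iff tendsto_norm_zero_iff)
qed

text \<open>For simple functions the isometry reduces this to
  \<open>(a + b)\<^sup>2 \<le> 2 (a\<^sup>2 + b\<^sup>2)\<close> for norms, and Fatou passes to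
  \<open>f\<close>. The 4 is the square of the factor 2 in the bound on
  \<open>simple_approx\<close>.\<close>

lemma L2_vec_add:
  assumes "L2 x f" "L2 y f" shows "L2 (x + y) f"
proof -
  note [measurable] = L2_measurable[OF assms(1)]
  have "N2 (x + y) f \<le> 2 * (4 * N2 x f + 4 * N2 y f)"
  proof (rule N2_Fatou[where f="simple_approx f"])
    fix n
    let ?s = "simple_approx f n"
    have s: "simple ?s" by (rule simple_approx) simp
    have 4: "N2 z ?s \<le> 4 * N2 z f" for z
    proof -
      have "N2 z ?s \<le> N2 z (\<lambda>t. 2 * f t)"
        by (rule N2_mono) (simp add: norm_mult simple_approx_bound)
      thus ?thesis by (simp add: N2_cmult)
    qed
    have "(norm (SSI ?s (x + y)))\<^sup>2 \<le> 2 * ((norm (SSI ?s x))\<^sup>2 + (norm (SSI ?s y))\<^sup>2)"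
    proof -
      have "(norm (SSI ?s (x + y)))\<^sup>2 \<le> (norm (SSI ?s x) + norm (SSI ?s y))\<^sup>2"
        unfolding SSI_vec_add[OF s] by (intro power_mono norm_triangle_ineq) auto
      also have "\<dots> \<le> 2 * ((norm (SSI ?s x))\<^sup>2 + (norm (SSI ?s y))\<^sup>2)"
        using sum_squares_bound[of "norm (SSI ?s x)" "norm (SSI ?s y)"]
        by (simp add: power2_sum algebra_simps)
      finally show ?thesis .
    qed
    from ennreal_leI[OF this] have "N2 (x + y) ?s \<le> 2 * (N2 x ?s + N2 y ?s)"
      by (simp add: ennreal_mult ennreal_plus SSI_norm s)
    also have "\<dots> \<le> 2 * (4 * N2 x f + 4 * N2 y f)"
      by (intro mult_left_mono add_mono 4) auto
    finally show "N2 (x + y) ?s \<le> 2 * (4 * N2 x f + 4 * N2 y f)" .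
  qed (auto intro: simple_approx_tendsto)
  also have "\<dots> < \<infinity>" using assms by (auto simp: L2_def ennreal_mult_less_top)
  finally show ?thesis by (simp add: L2_def)
qed

lemma SI_vec_add:
  assumes "L2 x f" "L2 y f" shows "SI f (x + y) = SI f x + SI f y"
proof (rule LIMSEQ_unique)
  show "(\<lambda>n. SSI (simple_approx f n) (x + y)) \<longlonglongrightarrow> SI f (x + y)"
    by (rule SI_simple_approx[OF L2_vec_add[OF assms]])
  show "(\<lambda>n. SSI (simple_approx f n) (x + y)) \<longlonglongrightarrow> SI f x + SI f y"
    using assms
    by (simp add: SSI_vec_add simple_approx L2_measurable tendsto_add SI_simple_approx)
qed

lemma
  assumes "L2 x f"
  shows L2_vec_scaleC: "L2 (c *\<^sub>C x) f" and SI_vec_scaleC: "SI f (c *\<^sub>C x) = c *\<^sub>C SI f x"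
proof -
  note [measurable] = L2_measurable[OF assms]
  have c: "L2 x (\<lambda>_. c)" by (rule L2_bounded) auto
  have L: "L2 x (\<lambda>t. f t * c)" using L2_cmult[OF assms, of c] by (simp add: mult.commute)
  show "L2 (c *\<^sub>C x) f" using L2_SI[OF c, of f] L by (simp add: SI_const)
  show "SI f (c *\<^sub>C x) = c *\<^sub>C SI f x"
    using SI_SI[OF c L] SI_cmult[OF assms, of c] by (simp add: SI_const mult.commute)
qed

lemma SI_cinner:
  assumes "L2 x f" "L2 y f" shows "cinner (SI f x) y = cinner x (SI (\<lambda>t. cnj (f t)) y)"
proof (rule LIMSEQ_unique)
  let ?s = "simple_approx f"
  note f = L2_measurable[OF assms(1)]
  show "(\<lambda>n. cinner (SSI (?s n) x) y) \<longlonglongrightarrow> cinner (SI f x) y"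
    by (intro tendsto_cinner SI_simple_approx assms tendsto_const)
  have "(\<lambda>n. SSI (\<lambda>t. cnj (?s n t)) y) \<longlonglongrightarrow> SI (\<lambda>t. cnj (f t)) y"
  proof (rule SI_tendsto)
    show "simple (\<lambda>t. cnj (?s n t))" for n
      by (rule simple_function_compose1[OF simple_approx[OF f]])
    show "(\<lambda>n. N2 y (\<lambda>t. cnj (?s n t) - cnj (f t))) \<longlonglongrightarrow> 0"
      using N2_simple_approx_diff[OF assms(2)] by (simp add: N2_def flip: complex_cnj_diff)
  qed (rule L2_cnj[OF assms(2)])
  thus "(\<lambda>n. cinner (SSI (?s n) x) y) \<longlonglongrightarrow> cinner x (SI (\<lambda>t. cnj (f t)) y)"
    by (simp add: SSI_cinner simple_approx f tendsto_cinner)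
qed

lemma E_SI:
  assumes "A \<in> sets borel" "L2 x f"
  shows "E A (SI f x) = SI (\<lambda>t. indicator A t * f t) x"
  using SSI_SI[of "indicator A" x f] assms by (simp add: SSI_indicator)

text \<open>\<open>E A x\<close> is the spectral integral of \<open>indicator A\<close>, so both
  parts are cases of the composition rule.\<close>

lemma
  assumes A: "A \<in> sets borel" and f: "f \<in> borel_measurable borel"
  shows L2_E: "L2 (E A x) f \<longleftrightarrow> L2 x (\<lambda>t. indicator A t * f t)"
    and SI_E: "L2 x (\<lambda>t. indicator A t * f t) \<Longrightarrow> SI f (E A x) = SI (\<lambda>t. indicator A t * f t) x"
proof -
  have I: "L2 x (indicator A)" using A by (intro L2_simple) auto
  show "L2 (E A x) f \<longleftrightarrow> L2 x (\<lambda>t. indicator A t * f t)"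
    using L2_SI[OF I f] A by (simp add: SI_indicator mult.commute)
  show "SI f (E A x) = SI (\<lambda>t. indicator A t * f t) x" if "L2 x (\<lambda>t. indicator A t * f t)"
    using SI_SI[OF I, of f] that f A by (simp add: SI_indicator mult.commute)
qed

text \<open>With \<open>f\<close> an imaginary exponential this is the characteristic function of
  \<open>mu x\<close>, the link to Levy's uniqueness theorem.\<close>

lemma SI_quadratic_form:
  assumes f [measurable]: "f \<in> borel_measurable borel" and B: "\<And>t. cmod (f t) \<le> B"
  shows "cinner x (SI f x) = (\<integral>t. f t \<partial>mu x)"
proof (rule LIMSEQ_unique)
  interpret finite_measure "mu x" by (rule finite_measure_mu)
  let ?s = "simple_approx f"
  have s: "simple (?s n)" for n by (rule simple_approx[OF f])
  have simple_case: "cinner x (SSI s x) = (\<integral>t. s t \<partial>mu x)" if s: "simple s" for s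
  proof -
    note fin = simple_range[OF s] and meas = simple_vimage[OF s]
    have "(\<integral>t. s t \<partial>mu x) = (\<integral>t. (\<Sum>c\<in>range s. indicator (s -` {c}) t *\<^sub>R c) \<partial>mu x)"
    proof (rule Bochner_Integration.integral_cong[OF refl])
      fix t
      have "(\<Sum>c\<in>range s. indicator (s -` {c}) t *\<^sub>R c) = (\<Sum>c\<in>{s t}. indicator (s -` {c}) t *\<^sub>R c)"
        using fin by (intro sum.mono_neutral_right) (auto simp: indicator_def)
      thus "s t = (\<Sum>c\<in>range s. indicator (s -` {c}) t *\<^sub>R c)" by simp
    qed
    also have "\<dots> = (\<Sum>c\<in>range s. measure (mu x) (s -` {c}) *\<^sub>R c)"
    proof (subst Bochner_Integration.integral_sum)
      show int: "integrable (mu x) (\<lambda>t. indicat_real (s -` {c}) t *\<^sub>R c)" for c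
        using meas[of "{c}"] by (intro integrable_scaleR_left integrable_real_indicator)
          (auto simp: emeasure_mu)
      show "(\<Sum>c\<in>range s. LINT t|mu x. indicat_real (s -` {c}) t *\<^sub>R c) =
          (\<Sum>c\<in>range s. measure (mu x) (s -` {c}) *\<^sub>R c)"
        using meas by (intro sum.cong refl, subst integral_scaleR_left)
          (auto simp: emeasure_mu intro!: integrable_real_indicator)
    qed
    also have "\<dots> = (\<Sum>c\<in>range s. c * cinner x (E (s -` {c}) x))"
    proof (intro sum.cong refl)
      fix c
      have "cinner x (E (s -` {c}) x) = cinner (E (s -` {c}) x) (E (s -` {c}) x)"
        by (simp add: E_cinner meas)
      also have "\<dots> = measure (mu x) (s -` {c})"
        unfolding cinner_self by (simp add: measure_def emeasure_mu meas)
      finally show "measure (mu x) (s -` {c}) *\<^sub>R c = c * cinner x (E (s -` {c}) x)"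
        by (simp add: scaleR_conv_of_real)
    qed
    finally show ?thesis
      by (simp add: simple_spectral_integral_def cinner_sum_right cinner_scaleC_right)
  qed
  show "(\<lambda>n. cinner x (SSI (?s n) x)) \<longlonglongrightarrow> cinner x (SI f x)"
    by (intro tendsto_cinner tendsto_const SI_simple_approx L2_bounded[OF f B])
  have "(\<lambda>n. \<integral>t. ?s n t \<partial>mu x) \<longlonglongrightarrow> (\<integral>t. f t \<partial>mu x)"
  proof (rule integral_dominated_convergence[where w="\<lambda>_. 2 * B"])
    show "AE t in mu x. cmod (?s n t) \<le> 2 * B" for n
      using simple_approx_bound[OF f] B by (intro always_eventually allI) (meson mult_left_mono order_trans zero_le_numeral)
  qed (auto simp: simple_approx_tendsto)
  thus "(\<lambda>n. cinner x (SSI (?s n) x)) \<longlonglongrightarrow> (\<integral>t. f t \<partial>mu x)"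
    by (simp add: simple_case s)
qed

end

section \<open>Uniqueness of spectral measures and commuting conjugations\<close>

text \<open>Off the Borel sets a projection valued measure is arbitrary, so two spectral measures
  can only be expected to agree on Borel sets.\<close>

lemma spectral_integral_cong:
  assumes "\<And>A x. A \<in> sets borel \<Longrightarrow> E A x = E' A x"
  shows "spectral_integral E f = spectral_integral E' f"
proof -
  have "scalar_measure E x = scalar_measure E' x" for x
    unfolding scalar_measure_def
    by (rule measure_of_eq) (auto simp: assms sets.sigma_sets_eq[of borel, simplified])
  moreover have "simple_spectral_integral E s x = simple_spectral_integral E' s x"
    if "simple_function borel s" for s x
    unfolding simple_spectral_integral_def
    by (intro sum.cong refl) (use simple_functionD(2)[OF that] in \<open>auto intro!: arg_cong2[of _ _ _ _ scaleC] assms\<close>)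
  ultimately have "(x, y) \<in> spectral_integral E f \<longleftrightarrow> (x, y) \<in> spectral_integral E' f" for x y
    by (auto simp: spectral_integral_def)
  thus ?thesis by auto
qed

lemma pvm_char:
  assumes "pvm E" "norm x = 1"
  shows "real_distribution (scalar_measure E x)"
    and "char (scalar_measure E x) t =
      cinner x (pvm.SI E (\<lambda>s. exp (\<i> * complex_of_real t * complex_of_real s)) x)"
proof -
  interpret pvm E by fact
  have "prob_space (mu x)"
    by (rule prob_spaceI) (simp add: emeasure_mu assms(2))
  thus "real_distribution (mu x)"
    by (simp add: real_distribution_def real_distribution_axioms_def)
  have "cinner x (SI (\<lambda>s. exp (\<i> * complex_of_real t * complex_of_real s)) x) =
      (\<integral>s. exp (\<i> * complex_of_real t * complex_of_real s) \<partial>mu x)"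
    by (rule SI_quadratic_form[where B=1]) auto
  thus "char (mu x) t = cinner x (SI (\<lambda>s. exp (\<i> * complex_of_real t * complex_of_real s)) x)"
    by (simp add: char_def mult.assoc)
qed

text \<open>Levy's theorem speaks of probability measures, which \<open>mu x\<close> is for unit
  vectors only; homogeneity gives the rest.\<close>

lemma norm_eq_of_unit:
  fixes P Q :: "'a::real_normed_vector \<Rightarrow> 'b::real_normed_vector"
  assumes "linear P" "linear Q" and unit: "\<And>x. norm x = 1 \<Longrightarrow> norm (P x) = norm (Q x)"
  shows "norm (P x) = norm (Q x)"
proof (cases "x = 0")
  case False
  have "norm (P (x /\<^sub>R norm x)) = norm (Q (x /\<^sub>R norm x))"
    by (rule unit) (use False in simp)
  thus ?thesis using False assms(1,2) by (simp add: linear_scale)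
qed (use assms(1,2) in \<open>simp add: linear_0\<close>)

text \<open>Equal unitary groups give equal characteristic functions of the scalar measures, hence
  equal quadratic forms of the projections, and a symmetric operator is determined by its
  form.\<close>

lemma pvm_unique:
  assumes "pvm E" "pvm E'"
    and eq: "\<And>t x. pvm.SI E (\<lambda>s. exp (\<i> * complex_of_real t * complex_of_real s)) x =
      pvm.SI E' (\<lambda>s. exp (\<i> * complex_of_real t * complex_of_real s)) x"
    and A: "A \<in> sets borel"
  shows "E A x = E' A x"
proof -
  interpret E: pvm E by fact
  interpret E': pvm E' by fact
  note lin = bounded_linear.linear[OF E.E_bounded_linear[OF A]]
    bounded_linear.linear[OF E'.E_bounded_linear[OF A]]
  have *: "norm (E A x) = norm (E' A x)" if "norm x = 1" for x
  proof -
    have "scalar_measure E x = scalar_measure E' x"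
    proof (rule Levy_uniqueness)
      show "char (scalar_measure E x) = char (scalar_measure E' x)"
        using pvm_char(2)[OF assms(1) that] pvm_char(2)[OF assms(2) that] eq by auto
    qed (rule pvm_char(1)[OF _ that], fact)+
    from arg_cong[OF this, of "\<lambda>M. emeasure M A"] show ?thesis
      using A by (simp add: E.emeasure_mu E'.emeasure_mu)
  qed
  have norm_eq: "norm (E A x) = norm (E' A x)" for x
    by (rule norm_eq_of_unit[OF lin *])
  have "E A x - E' A x = 0"
  proof (rule symmetric_form_zero[where P="\<lambda>x. E A x - E' A x"])
    fix x y
    show "E A (x + y) - E' A (x + y) = E A x - E' A x + (E A y - E' A y)"
      using A by (simp add: E.E_add E'.E_add)
    show "inner (E A x - E' A x) y = inner x (E A y - E' A y)"
      using A by (simp add: inner_diff_left inner_diff_right E.E_inner E'.E_inner)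
    show "inner x (E A x - E' A x) = 0"
      using A norm_eq[of x] by (simp add: inner_diff_right flip: E.norm_E E'.norm_E)
  qed
  thus ?thesis by simp
qed

section \<open>Conjugations commuting with the unitary group reflect the spectral measure\<close>

locale pvm_conjugation = pvm +
  fixes U :: "real \<Rightarrow> 'a \<Rightarrow> 'a" and J :: "'a \<Rightarrow> 'a"
  assumes U_def: "U t x = SI (\<lambda>s. exp (\<i> * complex_of_real t * complex_of_real s)) x"
    and conj: "conjugation J"
    and J_U: "J (U t x) = U t (J x)"
begin

lemma J_add: "J (x + y) = J x + J y"
  and J_scaleC: "J (c *\<^sub>C x) = cnj c *\<^sub>C J x"
  and norm_J [simp]: "norm (J x) = norm x"
  and J_J [simp]: "J (J x) = x"
  using conj by (auto simp: conjugation_def)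

lemma J_linear: "bounded_linear J"
  by (rule bounded_linear_intro[where K=1]) (auto simp: J_add scaleR_scaleC J_scaleC)

lemma J_sum: "J (\<Sum>i\<in>I. f i) = (\<Sum>i\<in>I. J (f i))"
  by (rule linear_sum[OF bounded_linear.linear[OF J_linear]])

lemmas J_tendsto = bounded_linear.tendsto[OF J_linear]

lemma J_inner: "inner (J x) (J y) = inner x y"
  using norm_J[of "x + y"] norm_J[of x] norm_J[of y]
  by (simp add: J_add norm_eq_sqrt_inner inner_add_left inner_add_right inner_commute)

lemma J_inner_commute: "inner (J x) y = inner x (J y)"
  using J_inner[of x "J y"] by simp

lemma J_cinner: "cinner (J x) (J y) = cinner y x"
proof -
  have "inner (J x) ((-\<i>) *\<^sub>C J y) = inner x (\<i> *\<^sub>C y)"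
    using J_inner[of x "\<i> *\<^sub>C y"] by (simp add: J_scaleC)
  also have "\<dots> = inner y ((-\<i>) *\<^sub>C x)"
    using cinner_commute[of x y] by (simp add: inner_Re_cinner cinner_scaleC_right)
  finally show ?thesis
    by (simp add: cinner_eq_Complex J_inner inner_commute)
qed

lemma U_cinner: "cinner (U t x) y = cinner x (U (- t) y)"
proof -
  have "L2 z (\<lambda>s. exp (\<i> * complex_of_real t * complex_of_real s))" for z
    by (rule L2_bounded[where B=1]) auto
  from SI_cinner[OF this this] show ?thesis
    unfolding U_def by (simp add: exp_cnj)
qed

text \<open>\<open>cinner (J x) (J y) = cinner y x\<close> swaps the arguments, so commuting with
  \<open>U t\<close> replaces \<open>t\<close> by \<open>- t\<close> in the characteristic function:
  the distribution is reflected.\<close>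

lemma mu_J_unit:
  assumes "norm x = 1" shows "mu (J x) = distr (mu x) borel uminus"
proof (rule Levy_uniqueness)
  have J1: "norm (J x) = 1" using assms by simp
  show "real_distribution (mu (J x))" by (rule pvm_char(1)[OF pvm_axioms J1])
  interpret real_distribution "mu x" by (rule pvm_char(1)[OF pvm_axioms assms])
  show "real_distribution (distr (mu x) borel uminus)"
    by (rule real_distribution_distr) simp
  show "char (mu (J x)) = char (distr (mu x) borel uminus)"
  proof
    fix t
    have "char (mu (J x)) t = cinner (J x) (J (U t x))"
      using pvm_char(2)[OF pvm_axioms J1, of t] by (simp add: U_def[symmetric] J_U)
    also have "\<dots> = cinner x (U (-t) x)" by (simp add: J_cinner U_cinner)
    also have "\<dots> = char (mu x) (- t)"
      using pvm_char(2)[OF pvm_axioms assms, of "-t"] by (simp add: U_def)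
    also have "\<dots> = char (distr (mu x) borel uminus) t"
      unfolding char_def by (subst integral_distr) auto
    finally show "char (mu (J x)) t = char (distr (mu x) borel uminus) t" .
  qed
qed

text \<open>Conjugating \<open>E A\<close> by \<open>J\<close> gives an operator that is symmetric
  for the real inner product and, by the reflection of the scalar measures, has the same form as the
  projection of the reflected set.\<close>

lemma J_E:
  assumes A: "A \<in> sets borel" shows "J (E A x) = E (uminus -` A) (J x)"
proof -
  have A': "uminus -` A \<in> sets borel"
    using measurable_sets[of uminus borel borel A] A by simp
  have *: "norm (E A (J x)) = norm (E (uminus -` A) x)" if "norm x = 1" for x
  proof -
    from arg_cong[OF mu_J_unit[OF that], of "\<lambda>M. emeasure M A"] show ?thesis
      using A A' by (simp add: emeasure_mu emeasure_distr)
  qed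
  have norm_eq: "norm (E A (J x)) = norm (E (uminus -` A) x)" for x
    by (rule norm_eq_of_unit[OF _ _ *])
      (use A A' in \<open>auto intro!: bounded_linear.linear E_bounded_linear
        bounded_linear_compose[OF E_bounded_linear J_linear]\<close>)
  have P0: "J (E A (J y)) - E (uminus -` A) y = 0" for y
  proof (rule symmetric_form_zero[where P="\<lambda>x. J (E A (J x)) - E (uminus -` A) x"])
    fix x y
    show "J (E A (J (x + y))) - E (uminus -` A) (x + y) =
        J (E A (J x)) - E (uminus -` A) x + (J (E A (J y)) - E (uminus -` A) y)"
      using A A' by (simp add: E_add J_add)
    show "inner (J (E A (J x)) - E (uminus -` A) x) y =
        inner x (J (E A (J y)) - E (uminus -` A) y)"
      using A A' by (simp add: inner_diff_left inner_diff_right E_inner J_inner_commute)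
    show "inner x (J (E A (J x)) - E (uminus -` A) x) = 0"
      using A A' norm_eq[of x]
      by (simp add: inner_diff_right flip: norm_E J_inner_commute)
  qed
  show ?thesis using P0[of "J x"] by simp
qed

lemma mu_J: "mu (J x) = distr (mu x) borel uminus"
proof (rule measure_eqI)
  fix A assume "A \<in> sets (mu (J x))"
  hence A: "A \<in> sets borel" by simp
  have A': "uminus -` A \<in> sets borel"
    using measurable_sets[of uminus borel borel A] A by simp
  have "uminus -` uminus -` A = A" by auto
  hence "E A (J x) = J (E (uminus -` A) x)" using J_E[OF A', of x] by simp
  thus "emeasure (mu (J x)) A = emeasure (distr (mu x) borel uminus) A"
    using A A' by (simp add: emeasure_mu emeasure_distr)
qed simp

lemma N2_J:
  assumes [measurable]: "f \<in> borel_measurable borel"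
  shows "N2 (J x) f = N2 x (\<lambda>t. f (- t))"
  unfolding N2_def mu_J by (subst nn_integral_distr) auto

lemma L2_J:
  assumes "L2 x f" shows "L2 (J x) (\<lambda>t. f (- t))"
proof -
  note [measurable] = L2_measurable[OF assms]
  show ?thesis using assms by (auto simp: L2_def N2_J)
qed

lemma J_SSI:
  assumes s: "simple s" and s': "simple (\<lambda>t. s (- t))"
  shows "J (SSI s x) = SSI (\<lambda>t. cnj (s (- t))) (J x)"
proof -
  have "SSI (\<lambda>t. cnj (s (- t))) (J x) =
      (\<Sum>c\<in>range (\<lambda>t. s (- t)). cnj c *\<^sub>C E ((\<lambda>t. s (- t)) -` {c}) (J x))"
    by (rule SSI_comp[OF s'])
  also have "range (\<lambda>t. s (- t)) = range s"
    by (metis fun.set_map surj_uminus image_image)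
  finally show ?thesis
    using s by (simp add: simple_spectral_integral_def J_sum J_scaleC J_E simple_vimage vimage_def)
qed

lemma J_SI:
  assumes f: "L2 x f"
  shows "J (SI f x) = SI (\<lambda>t. cnj (f (- t))) (J x)"
proof (rule LIMSEQ_unique)
  note [measurable] = L2_measurable[OF f]
  let ?s = "simple_approx f"
  have s: "simple (?s n)" for n by (rule simple_approx) simp
  have [measurable]: "?s n \<in> borel_measurable borel" for n by simp
  have s': "simple (\<lambda>t. ?s n (- t))" for n
    using simple_function_comp[of uminus borel borel "?s n"] s by simp
  show "(\<lambda>n. J (SSI (?s n) x)) \<longlonglongrightarrow> J (SI f x)"
    by (intro J_tendsto SI_simple_approx f)
  have "(\<lambda>n. SSI (\<lambda>t. cnj (?s n (- t))) (J x)) \<longlonglongrightarrow> SI (\<lambda>t. cnj (f (- t))) (J x)"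
  proof (rule SI_tendsto)
    show "L2 (J x) (\<lambda>t. cnj (f (- t)))" by (rule L2_cnj[OF L2_J[OF f]])
    show "simple (\<lambda>t. cnj (?s n (- t)))" for n by (rule simple_function_compose1[OF s'])
    have "N2 (J x) (\<lambda>t. cnj (?s n (- t)) - cnj (f (- t))) = N2 x (\<lambda>t. ?s n t - f t)" for n
      by (subst N2_J, measurable) (simp add: N2_def flip: complex_cnj_diff)
    thus "(\<lambda>n. N2 (J x) (\<lambda>t. cnj (?s n (- t)) - cnj (f (- t)))) \<longlonglongrightarrow> 0"
      using N2_simple_approx_diff[OF f] by simp
  qed
  thus "(\<lambda>n. J (SSI (?s n) x)) \<longlonglongrightarrow> SI (\<lambda>t. cnj (f (- t))) (J x)"
    by (simp add: J_SSI s s')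
qed

end

section \<open>Exponentials and band-limited vectors\<close>

context pvm begin

abbreviation ex :: "complex \<Rightarrow> real \<Rightarrow> complex" where
  "ex z \<equiv> \<lambda>t. exp (z * complex_of_real t)"

definition expH :: "complex \<Rightarrow> 'a \<Rightarrow> 'a" where "expH z x = SI (ex z) x"

definition band :: "real \<Rightarrow> 'a \<Rightarrow> bool" where "band a x \<longleftrightarrow> E {- a..a} x = x"

abbreviation cut :: "nat \<Rightarrow> 'a \<Rightarrow> 'a" where "cut n \<equiv> E {- real n..real n}"

text \<open>Only the values of \<open>f\<close> on \<open>[- a, a]\<close> matter for such
  \<open>x\<close>: multiplying \<open>f\<close> by the indicator of this interval gives a globally
  bounded function.\<close>

lemma
  assumes x: "band a x" and f: "f \<in> borel_measurable borel" and "B \<ge> 0"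
    and B: "\<And>t. \<bar>t\<bar> \<le> a \<Longrightarrow> cmod (f t) \<le> B"
  shows band_L2: "L2 x f" and band_norm_SI_le: "norm (SI f x) \<le> B * norm x"
proof -
  let ?g = "\<lambda>t. indicator {- a..a} t * f t"
  have bound: "cmod (?g t) \<le> B" for t
    using B[of t] \<open>B \<ge> 0\<close> by (auto simp: indicator_def abs_le_iff)
  have g: "L2 x ?g" using f by (intro L2_bounded[OF _ bound]) measurable
  show "L2 x f" using L2_E[OF _ f, of "{-a..a}" x] g x by (simp add: band_def)
  have "SI f x = SI ?g x" using SI_E[OF _ f g] x by (simp add: band_def)
  moreover have "ennreal ((norm (SI ?g x))\<^sup>2) \<le> ennreal ((B * norm x)\<^sup>2)"
    using SI_norm[OF g] N2_bounded[of ?g B x] bound \<open>B \<ge> 0\<close> by simp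
  ultimately have "(norm (SI f x))\<^sup>2 \<le> (B * norm x)\<^sup>2"
    by (subst (asm) ennreal_le_iff) auto
  thus "norm (SI f x) \<le> B * norm x"
    by (rule power2_le_imp_le) (use \<open>B \<ge> 0\<close> in auto)
qed

lemma cmod_ex_le: "\<bar>t\<bar> \<le> a \<Longrightarrow> cmod (ex z t) \<le> exp (\<bar>Re z\<bar> * a)"
proof -
  assume "\<bar>t\<bar> \<le> a"
  hence "\<bar>Re z\<bar> * \<bar>t\<bar> \<le> \<bar>Re z\<bar> * a" by (intro mult_left_mono) auto
  hence "Re z * t \<le> \<bar>Re z\<bar> * a"
    using abs_ge_self[of "Re z * t"] by (simp add: abs_mult)
  thus ?thesis by simp
qed

lemma
  assumes "band a x"
  shows band_L2_ex: "L2 x (ex z)" and band_norm_expH_le: "norm (expH z x) \<le> exp (\<bar>Re z\<bar> * a) * norm x"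
  using band_L2[OF assms, of "ex z" "exp (\<bar>Re z\<bar> * a)"]
    band_norm_SI_le[OF assms, of "ex z" "exp (\<bar>Re z\<bar> * a)"] cmod_ex_le[of _ a z]
  unfolding expH_def by auto

lemma
  assumes A: "A \<in> sets borel" and f: "L2 x f"
  shows L2_E_vec: "L2 (E A x) f" and E_SI_commute: "E A (SI f x) = SI f (E A x)"
proof -
  note [measurable] = L2_measurable[OF f] A
  have "L2 x (\<lambda>t. indicator A t * f t)"
    by (rule L2_mono[OF f]) (auto simp: indicator_def)
  thus "L2 (E A x) f" "E A (SI f x) = SI f (E A x)"
    using L2_E[OF A, of f x] SI_E[OF A, of f x] E_SI[OF A f] by auto
qed

lemma band_SI: "band a x \<Longrightarrow> L2 x f \<Longrightarrow> band a (SI f x)"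
  using E_SI_commute[of "{-a..a}" x f] by (simp add: band_def)

lemma band_expH: "band a x \<Longrightarrow> band a (expH z x)"
  unfolding expH_def by (intro band_SI band_L2_ex)

lemma expH_expH:
  assumes "L2 x (ex w)" "L2 x (ex (z + w))"
  shows "L2 (expH w x) (ex z)" and "expH z (expH w x) = expH (z + w) x"
proof -
  have *: "(\<lambda>t. ex z t * ex w t) = ex (z + w)" by (simp add: distrib_right exp_add)
  show "L2 (expH w x) (ex z)" unfolding expH_def using assms L2_SI[OF assms(1), of "ex z"] * by simp
  show "expH z (expH w x) = expH (z + w) x"
    unfolding expH_def using assms SI_SI[OF assms(1), of "ex z"] * by simp
qed

lemma band_expH_expH: "band a x \<Longrightarrow> expH z (expH w x) = expH (z + w) x"
  by (intro expH_expH band_L2_ex)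

lemma expH_0 [simp]: "expH 0 x = x"
  using SI_const[of 1 x] by (simp add: expH_def)

lemma expH_add: "L2 x (ex z) \<Longrightarrow> L2 y (ex z) \<Longrightarrow> expH z (x + y) = expH z x + expH z y"
  by (simp add: expH_def SI_vec_add)

lemma expH_scaleC: "L2 x (ex z) \<Longrightarrow> expH z (c *\<^sub>C x) = c *\<^sub>C expH z x"
  by (simp add: expH_def SI_vec_scaleC)

lemma expH_cinner: "L2 x (ex z) \<Longrightarrow> L2 y (ex z) \<Longrightarrow> cinner (expH z x) y = cinner x (expH (cnj z) y)"
  unfolding expH_def by (subst SI_cinner) (auto simp: exp_cnj)

lemma E_expH: "A \<in> sets borel \<Longrightarrow> L2 x (ex z) \<Longrightarrow> E A (expH z x) = expH z (E A x)"
  unfolding expH_def by (rule E_SI_commute)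

lemma band_add: "band a x \<Longrightarrow> band a y \<Longrightarrow> band a (x + y)"
  by (simp add: band_def E_add)

lemma band_scaleC: "band a x \<Longrightarrow> band a (c *\<^sub>C x)"
  by (simp add: band_def E_scaleC)

lemma band_diff: "band a x \<Longrightarrow> band a y \<Longrightarrow> band a (x - y)"
  by (simp add: band_def E_diff)

lemma band_mono: assumes "band a x" "a \<le> b" shows "band b x"
proof -
  have "E {-b..b} (E {-a..a} x) = E ({-b..b} \<inter> {-a..a}) x" by (rule E_Int) auto
  also have "{-b..b} \<inter> {-a..a} = {-a..a}" using assms(2) by auto
  finally show ?thesis using assms(1) by (simp add: band_def)
qed

lemma band_cut: "band (real n) (cut n x)"
  by (simp add: band_def)

text \<open>The squared distance is the \<open>mu x\<close> measure of the complement of the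
  interval; these complements decrease to the empty set.\<close>

lemma cut_tendsto: "(\<lambda>n. cut n x) \<longlonglongrightarrow> x"
proof -
  interpret finite_measure "mu x" by (rule finite_measure_mu)
  let ?C = "\<lambda>n::nat. - {- real n..real n}"
  have "(\<lambda>n. measure (mu x) (?C n)) \<longlonglongrightarrow> measure (mu x) (\<Inter>n. ?C n)"
    by (rule finite_Lim_measure_decseq) (auto simp: decseq_def)
  also have "(\<Inter>n. ?C n) = {}"
  proof -
    have "t \<notin> (\<Inter>n. ?C n)" for t
    proof -
      obtain n :: nat where "\<bar>t\<bar> \<le> real n" using real_arch_simple by blast
      hence "t \<notin> ?C n" by (simp add: abs_le_iff)
      thus ?thesis by blast
    qed
    thus ?thesis by blast
  qed
  finally have "(\<lambda>n. measure (mu x) (?C n)) \<longlonglongrightarrow> 0" by simp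
  moreover have "measure (mu x) (?C n) = (norm (x - cut n x))\<^sup>2" for n
  proof -
    have "E (UNIV) x = cut n x + E (?C n) x"
      using E_Un[of "{- real n..real n}" "?C n" x] by (simp add: Compl_partition)
    hence "E (?C n) x = x - cut n x" by (simp only: E_UNIV) (simp add: algebra_simps)
    thus ?thesis by (simp add: measure_def emeasure_mu)
  qed
  ultimately have "(\<lambda>n. (norm (x - cut n x))\<^sup>2) \<longlonglongrightarrow> 0" by simp
  from tendsto_real_sqrt[OF this] have "(\<lambda>n. x - cut n x) \<longlonglongrightarrow> 0"
    by (simp add: tendsto_norm_zero_iff)
  from tendsto_diff[OF tendsto_const[of x] this] show ?thesis by simp
qed

text \<open>The domain predicate \<open>P\<close> stays abstract since the rule serves both for
  bands, where the derivative is computed, and for all analytic vectors.\<close>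

lemma antilinear_diff:
  fixes \<eta> :: "'a \<Rightarrow> complex"
  assumes "\<And>y w. P y \<Longrightarrow> P w \<Longrightarrow> \<eta> (y + w) = \<eta> y + \<eta> w"
    and "\<And>c y. P y \<Longrightarrow> \<eta> (c *\<^sub>C y) = cnj c * \<eta> y" and "\<And>c y. P y \<Longrightarrow> P (c *\<^sub>C y)"
    and "P y" "P w"
  shows "\<eta> (y - w) = \<eta> y - \<eta> w"
  using assms(1)[of y "(-1) *\<^sub>C w"] assms(2)[of w "-1"] assms(3)[of w "-1"] assms(4,5)
  by (simp add: scaleC_minus_left)

text \<open>For fixed \<open>x\<close> the vector \<open>expH (cnj z) x\<close> is antiholomorphic
  in \<open>z\<close>, and the antilinear \<open>\<eta>\<close> undoes the conjugation. The
  derivative is \<open>\<eta>\<close> at \<open>H exp (cnj z H) x\<close>; the band makes the Taylor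
  remainder uniform in the spectral variable.\<close>

lemma antilinear_expH_has_derivative:
  fixes \<eta> :: "'a \<Rightarrow> complex"
  assumes x: "band a x" and "a \<ge> 0"
    and add: "\<And>y w. band a y \<Longrightarrow> band a w \<Longrightarrow> \<eta> (y + w) = \<eta> y + \<eta> w"
    and scale: "\<And>c y. band a y \<Longrightarrow> \<eta> (c *\<^sub>C y) = cnj c * \<eta> y"
    and bound: "\<And>y. band a y \<Longrightarrow> cmod (\<eta> y) \<le> K * norm y" and "K \<ge> 0"
  shows "((\<lambda>z. \<eta> (expH (cnj z) x)) has_field_derivative
    \<eta> (SI (\<lambda>t. complex_of_real t * ex (cnj z) t) x)) (at z)"
  unfolding DERIV_def
proof (rule LIM_zero_cancel, rule Lim_null_comparison)
  let ?d = "SI (\<lambda>t. complex_of_real t * ex (cnj z) t) x"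
  \<comment> \<open>The first factor bounds \<open>ex (cnj z)\<close> on the band. The second comes
    from the second order Taylor remainder of the exponential at \<open>cnj h * t\<close> with
    \<open>cmod h \<le> 1\<close> and \<open>t\<close> in the band.\<close>
  let ?B = "exp (\<bar>Re z\<bar> * a) * (exp a * a\<^sup>2)"
  have Ld: "L2 x (\<lambda>t. complex_of_real t * ex (cnj z) t)"
  proof (rule band_L2[OF x, where B="a * exp (\<bar>Re z\<bar> * a)"])
    show "cmod (complex_of_real t * ex (cnj z) t) \<le> a * exp (\<bar>Re z\<bar> * a)" if "\<bar>t\<bar> \<le> a" for t
      using that cmod_ex_le[OF that, of "cnj z"] unfolding norm_mult by (intro mult_mono) auto
  qed (use \<open>a \<ge> 0\<close> in auto)
  show "\<forall>\<^sub>F h in at 0. norm ((\<eta> (expH (cnj (z + h)) x) - \<eta> (expH (cnj z) x)) / h - \<eta> ?d) \<le>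
      (K * ?B * norm x) * cmod h"
    unfolding eventually_at
  proof (intro exI[of _ 1] conjI ballI impI)
    fix h :: complex assume "h \<noteq> 0 \<and> dist h 0 < 1"
    hence h: "h \<noteq> 0" "cmod h \<le> 1" by auto
    \<comment> \<open>The remainder of the first order expansion; by antilinearity
      \<open>\<eta> ?y / h\<close> is the difference quotient minus the claimed derivative.\<close>
    let ?y = "expH (cnj (z + h)) x - expH (cnj z) x - cnj h *\<^sub>C ?d"
    let ?f = "\<lambda>t. ex (cnj z) t * (exp (cnj h * complex_of_real t) - 1 - cnj h * complex_of_real t)"
    have "?y = SI (\<lambda>t. (ex (cnj (z + h)) t - ex (cnj z) t) - cnj h * (complex_of_real t * ex (cnj z) t)) x"
      unfolding expH_def
      by (simp only: SI_diff SI_cmult L2_diff L2_cmult Ld band_L2_ex[OF x])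
    also have "\<dots> = SI ?f x"
      by (rule arg_cong[of _ _ "\<lambda>f. SI f x"]) (auto simp: algebra_simps exp_add)
    finally have y: "?y = SI ?f x" .
    have "norm (SI ?f x) \<le> (?B * (cmod h)\<^sup>2) * norm x"
    proof (rule band_norm_SI_le[OF x])
      fix t :: real assume t: "\<bar>t\<bar> \<le> a"
      let ?u = "cnj h * complex_of_real t"
      have "cmod (exp ?u - (\<Sum>k\<le>1. ?u ^ k / fact k)) \<le> exp \<bar>Re ?u\<bar> * cmod ?u ^ Suc 1 / fact 1"
        by (rule Taylor_exp)
      hence "cmod (exp ?u - 1 - ?u) \<le> exp \<bar>Re ?u\<bar> * (cmod ?u)\<^sup>2"
        by (simp add: power2_eq_square diff_diff_eq)
      also have "\<dots> \<le> exp a * (a * cmod h)\<^sup>2"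
      proof (intro mult_mono)
        have "\<bar>Re ?u\<bar> \<le> cmod ?u" by (rule abs_Re_le_cmod)
        also have "\<dots> = cmod h * \<bar>t\<bar>" by (simp add: norm_mult)
        also have "\<dots> \<le> 1 * a" using t h by (intro mult_mono) auto
        finally show "exp \<bar>Re ?u\<bar> \<le> exp a" by simp
        show "(cmod ?u)\<^sup>2 \<le> (a * cmod h)\<^sup>2"
          using t by (intro power_mono) (auto simp: norm_mult mult.commute[of a] mult_left_mono)
      qed auto
      finally have u: "cmod (exp ?u - 1 - ?u) \<le> exp a * (a * cmod h)\<^sup>2" .
      have "cmod (?f t) \<le> exp (\<bar>Re z\<bar> * a) * (exp a * (a * cmod h)\<^sup>2)"
        using cmod_ex_le[OF t, of "cnj z"] u unfolding norm_mult by (intro mult_mono) auto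
      thus "cmod (?f t) \<le> ?B * (cmod h)\<^sup>2" by (simp add: power_mult_distrib mult_ac)
    qed auto
    hence ny: "norm ?y \<le> ?B * (cmod h)\<^sup>2 * norm x" unfolding y .
    have b: "band a (expH w x)" "band a ?d" for w
      by (intro band_expH band_SI x Ld)+
    have diff: "\<eta> (u - v) = \<eta> u - \<eta> v" if "band a u" "band a v" for u v
      using that by (intro antilinear_diff[where P="band a"] add scale band_scaleC)
    have "\<eta> ?y = \<eta> (expH (cnj (z + h)) x) - \<eta> (expH (cnj z) x) - h * \<eta> ?d"
      using b by (simp add: diff band_diff band_scaleC scale)
    hence "(\<eta> (expH (cnj (z + h)) x) - \<eta> (expH (cnj z) x)) / h - \<eta> ?d = \<eta> ?y / h"
      using h by (simp add: field_simps)
    hence "norm ((\<eta> (expH (cnj (z + h)) x) - \<eta> (expH (cnj z) x)) / h - \<eta> ?d) = cmod (\<eta> ?y) / cmod h"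
      by (simp add: norm_divide)
    also have "\<dots> \<le> (K * norm ?y) / cmod h"
      using b by (intro divide_right_mono bound band_diff band_scaleC) auto
    also have "\<dots> \<le> (K * (?B * (cmod h)\<^sup>2 * norm x)) / cmod h"
      using ny \<open>K \<ge> 0\<close> by (intro divide_right_mono mult_left_mono) auto
    also have "\<dots> = (K * ?B * norm x) * cmod h"
      using h by (simp add: power2_eq_square)
    finally show "norm ((\<eta> (expH (cnj (z + h)) x) - \<eta> (expH (cnj z) x)) / h - \<eta> ?d) \<le>
      (K * ?B * norm x) * cmod h" .
  qed auto
  show "((\<lambda>h. (K * ?B * norm x) * cmod h) \<longlongrightarrow> 0) (at 0)"
    by (auto intro!: tendsto_eq_intros)
qed

section \<open>Analytic vectors\<close>

definition analytic :: "real \<Rightarrow> 'a \<Rightarrow> bool" where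
  "analytic r x \<longleftrightarrow> L2 x (ex (complex_of_real r)) \<and> L2 x (ex (complex_of_real (- r)))"

text \<open>\<open>pr r\<close> is a norm defining the topology of \<open>\<H>\<^sup>\<omega>(r)\<close>.\<close>

definition pr :: "real \<Rightarrow> 'a \<Rightarrow> real" where
  "pr r x = norm (expH (complex_of_real r) x) + norm (expH (complex_of_real (- r)) x)"

lemma analytic_add: "analytic r x \<Longrightarrow> analytic r y \<Longrightarrow> analytic r (x + y)"
  by (auto simp: analytic_def L2_vec_add)

lemma analytic_scaleC: "analytic r x \<Longrightarrow> analytic r (c *\<^sub>C x)"
  by (auto simp: analytic_def L2_vec_scaleC)

lemma analytic_diff: "analytic r x \<Longrightarrow> analytic r y \<Longrightarrow> analytic r (x - y)"
  using analytic_add[of r x "(-1) *\<^sub>C y"] analytic_scaleC[of r y "-1"]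
  by (simp add: scaleC_minus_left)

text \<open>For \<open>q\<close> between \<open>- s\<close> and \<open>s\<close> the function
  \<open>exp (q t)\<close> is dominated by \<open>exp (s t) + exp (- s t)\<close>, whichever sign
  \<open>t\<close> has.\<close>

lemma analytic_mono:
  assumes "analytic s x" "0 \<le> r" "r \<le> s" shows "analytic r x"
proof -
  let ?w = "\<lambda>t. ex (complex_of_real s) t + ex (complex_of_real (- s)) t"
  have w: "L2 x ?w" using assms by (auto simp: analytic_def intro!: L2_add)
  have bound: "cmod (ex (complex_of_real q) t) \<le> cmod (?w t)" if "\<bar>q\<bar> \<le> s" for q t
  proof -
    have "?w t = complex_of_real (exp (s * t) + exp (- s * t))"
      by (simp flip: exp_of_real)
    moreover have "exp (q * t) \<le> exp (s * t) + exp (- s * t)"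
    proof -
      have "q * t \<le> \<bar>q\<bar> * \<bar>t\<bar>" using abs_ge_self[of "q * t"] by (simp add: abs_mult)
      also have "\<dots> \<le> s * \<bar>t\<bar>" using that by (intro mult_right_mono) auto
      finally have "q * t \<le> s * t \<or> q * t \<le> - s * t" by (auto simp: abs_if split: if_splits)
      thus ?thesis using exp_gt_zero[of "s * t"] exp_gt_zero[of "- s * t"]
        exp_mono[of "q * t" "s * t"] exp_mono[of "q * t" "- s * t"] by linarith
    qed
    ultimately show ?thesis by (simp only: norm_of_real norm_exp_eq_Re) simp
  qed
  show ?thesis
    unfolding analytic_def using assms(2,3) by (intro conjI L2_mono[OF w] bound) auto
qed

lemma band_analytic: "band a x \<Longrightarrow> analytic r x"
  unfolding analytic_def by (intro conjI band_L2_ex)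

lemma pr_nonneg: "pr r x \<ge> 0" by (simp add: pr_def)

lemma pr_add: "analytic r x \<Longrightarrow> analytic r y \<Longrightarrow> pr r (x + y) \<le> pr r x + pr r y"
  using norm_triangle_ineq[of "expH (complex_of_real r) x" "expH (complex_of_real r) y"]
    norm_triangle_ineq[of "expH (complex_of_real (- r)) x" "expH (complex_of_real (- r)) y"]
  unfolding pr_def analytic_def by (simp add: expH_add)

lemma pr_scaleC: "analytic r x \<Longrightarrow> pr r (c *\<^sub>C x) = cmod c * pr r x"
  by (simp add: pr_def analytic_def expH_scaleC distrib_left)

lemma pr_band_le: "band a x \<Longrightarrow> pr r x \<le> 2 * exp (\<bar>r\<bar> * a) * norm x"
  using band_norm_expH_le[of a x "complex_of_real r"] band_norm_expH_le[of a x "complex_of_real (-r)"]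
  by (simp add: pr_def)

lemma analytic_cut: "analytic r x \<Longrightarrow> analytic r (cut n x)"
  by (simp add: analytic_def L2_E_vec)

lemma expH_cut_diff_tendsto:
  assumes "L2 x (ex z)" shows "(\<lambda>n. expH z (x - cut n x)) \<longlonglongrightarrow> 0"
proof -
  have "expH z (x - cut n x) = expH z x - cut n (expH z x)" for n
  proof -
    have "expH z (x - cut n x + cut n x) = expH z (x - cut n x) + expH z (cut n x)"
      using assms L2_vec_add[OF assms L2_vec_scaleC[OF L2_E_vec[OF _ assms], of "{- real n..real n}" "-1"]]
      by (intro expH_add) (auto simp: L2_E_vec scaleC_minus_left)
    moreover have "expH z (cut n x) = cut n (expH z x)" using assms by (simp add: E_expH)
    ultimately show ?thesis unfolding eq_diff_eq by simp
  qed
  thus ?thesis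
    using tendsto_diff[OF tendsto_const[of "expH z x"] cut_tendsto[of "expH z x"]] by simp
qed

lemma pr_cut_diff_tendsto:
  assumes "analytic r x" shows "(\<lambda>n. pr r (x - cut n x)) \<longlonglongrightarrow> 0"
  unfolding pr_def
  using assms
  by (auto simp: analytic_def intro!: tendsto_add_zero tendsto_norm_zero expH_cut_diff_tendsto)

lemma pr_cut_le:
  assumes "analytic r x" shows "pr r (cut n x) \<le> pr r x"
  using assms unfolding pr_def analytic_def
  by (auto simp: E_expH[symmetric] intro!: add_mono norm_E_le)

text \<open>Pointwise \<open>1 \<le> exp (r t) + exp (- r t)\<close>. Consequently
  \<open>pr r x = 0\<close> forces \<open>x = 0\<close>.\<close>

lemma norm_le_pr:
  assumes "analytic r x" "r \<ge> 0" shows "norm x \<le> pr r x"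
proof -
  let ?w = "\<lambda>t. ex (complex_of_real r) t + ex (complex_of_real (- r)) t"
  have L: "L2 x (ex (complex_of_real r))" "L2 x (ex (complex_of_real (- r)))"
    using assms by (auto simp: analytic_def)
  have w: "L2 x ?w" by (rule L2_add[OF L])
  have "ennreal ((norm x)\<^sup>2) = N2 x (\<lambda>_. 1)"
    using SI_norm[OF L2_bounded[of "\<lambda>_. 1" 1 x]] by (simp add: SI_const)
  also have "\<dots> \<le> N2 x ?w"
  proof (rule N2_mono)
    fix t
    have "?w t = complex_of_real (exp (r * t) + exp (- (r * t)))"
      by (simp flip: exp_of_real)
    moreover have "1 \<le> exp (r * t) + exp (- (r * t))"
      using exp_ge_add_one_self[of "r * t"] exp_ge_add_one_self[of "- (r * t)"] by linarith
    ultimately show "cmod 1 \<le> cmod (?w t)" by (simp only: norm_of_real) simp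
  qed
  also have "\<dots> = ennreal ((norm (SI ?w x))\<^sup>2)" using SI_norm[OF w] by simp
  finally have "(norm x)\<^sup>2 \<le> (norm (SI ?w x))\<^sup>2" by (subst (asm) ennreal_le_iff) auto
  hence "norm x \<le> norm (SI ?w x)" by (rule power2_le_imp_le) auto
  also have "\<dots> \<le> pr r x"
    unfolding pr_def expH_def SI_add[OF L] by (rule norm_triangle_ineq)
  finally show ?thesis .
qed

end

section \<open>Invariance of the analytic norms under \<open>U\<close> and \<open>J\<close>\<close>

context pvm_conjugation begin

lemma U_eq_expH: "U t x = expH (\<i> * complex_of_real t) x"
  by (simp add: U_def expH_def)

lemma L2_ex_imaginary: "L2 x (ex (\<i> * complex_of_real t))"
  by (rule L2_bounded[where B=1]) auto

text \<open>The symbol \<open>exp (i t s)\<close> of \<open>U t\<close> has modulus 1, so no L2 norm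
  changes.\<close>

lemma
  assumes "analytic r x"
  shows analytic_U: "analytic r (U t x)" and pr_U: "pr r (U t x) = pr r x"
proof -
  have L: "L2 x (ex (complex_of_real q + \<i> * complex_of_real t))"
    if "L2 x (ex (complex_of_real q))" for q
    by (rule L2_mono[OF that]) auto
  have N: "L2 (U t x) (ex (complex_of_real q)) \<and>
      norm (expH (complex_of_real q) (U t x)) = norm (expH (complex_of_real q) x)"
    if q: "L2 x (ex (complex_of_real q))" for q
  proof -
    have "ennreal ((norm (expH (complex_of_real q + \<i> * complex_of_real t) x))\<^sup>2) =
        ennreal ((norm (expH (complex_of_real q) x))\<^sup>2)"
      using L[OF q] q by (simp add: expH_def SI_norm N2_def)
    thus ?thesis using L[OF q] q
      by (simp add: U_eq_expH expH_expH L2_ex_imaginary)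
  qed
  show "analytic r (U t x)" "pr r (U t x) = pr r x"
    using assms N[of r] N[of "-r"] by (auto simp: analytic_def pr_def)
qed

lemma J_expH:
  assumes "L2 x (ex z)"
  shows "L2 (J x) (ex (- cnj z))" and "J (expH z x) = expH (- cnj z) (J x)"
proof -
  have *: "(\<lambda>t. cnj (exp (z * complex_of_real (- t)))) = ex (- cnj z)"
    by (simp add: exp_cnj)
  show "L2 (J x) (ex (- cnj z))"
    using L2_cnj[OF L2_J[OF assms]] unfolding * .
  show "J (expH z x) = expH (- cnj z) (J x)"
    using J_SI[OF assms] unfolding * expH_def .
qed

text \<open>\<open>J\<close> turns \<open>exp (r H)\<close> into \<open>exp (- r H)\<close>, hence
  interchanges the two summands of \<open>pr r\<close>.\<close>

lemma
  assumes "analytic r x"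
  shows analytic_J: "analytic r (J x)" and pr_J: "pr r (J x) = pr r x"
proof -
  have "expH (- complex_of_real r) (J x) = J (expH (complex_of_real r) x)"
    "expH (complex_of_real r) (J x) = J (expH (- complex_of_real r) x)"
    "L2 (J x) (ex (- complex_of_real r))" "L2 (J x) (ex (complex_of_real r))"
    using assms J_expH[of x "complex_of_real r"] J_expH[of x "complex_of_real (- r)"]
    by (auto simp: analytic_def)
  thus "analytic r (J x)" "pr r (J x) = pr r x" by (auto simp: analytic_def pr_def)
qed

lemma cut_J: "J (cut n x) = cut n (J x)"
proof -
  have "uminus -` {- real n..real n} = {- real n..real n}" by auto
  thus ?thesis using J_E[of "{- real n..real n}" x] by simp
qed

lemma band_J: "band a x \<Longrightarrow> band a (J x)"
proof -
  assume "band a x"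
  moreover have "uminus -` {- a..a} = {- a..a}" by auto
  ultimately show ?thesis using J_E[of "{- a..a}" x] by (simp add: band_def)
qed

lemma band_U: "band a x \<Longrightarrow> band a (U t x)"
  unfolding U_eq_expH by (rule band_expH)

lemma cut_U: "U t (cut n x) = cut n (U t x)"
  unfolding U_eq_expH by (simp add: E_expH L2_ex_imaginary)

end

section \<open>Hyperfunction vectors\<close>

text \<open>\<open>op_exp_eq\<close> puts one fixed spectral measure in place of the existential in
  \<open>fun_calculus\<close>; uniqueness of the spectral measure of \<open>H\<close> justifies
  it.\<close>

locale hyperfunction = pvm_conjugation +
  fixes H :: "'a operator"
  assumes op_exp_eq: "op_exp z H = {(x, expH z x) |x. L2 x (ex z)}"
begin

abbreviation AV :: "'a set" where "AV \<equiv> analytic_vectors H"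
abbreviation HV :: "('a \<Rightarrow> complex) set" where "HV \<equiv> hyperfunction_vectors H"

lemma op_app_exp: "L2 x (ex z) \<Longrightarrow> op_app (op_exp z H) x = expH z x"
  unfolding op_app_def op_exp_eq by auto

lemma analytic_vectors_at_eq: "analytic_vectors_at H r = {x. analytic r x}"
  by (auto simp: analytic_vectors_at_def op_exp_eq analytic_def Domain_unfold)

lemma analytic_vectors_iff: "x \<in> AV \<longleftrightarrow> (\<exists>r>0. analytic r x)"
  by (auto simp: analytic_vectors_def analytic_vectors_at_eq)

lemma band_AV: "band a x \<Longrightarrow> x \<in> AV"
  using band_analytic[of a x 1] by (auto simp: analytic_vectors_iff intro!: exI[of _ "1::real"])

lemma cut_AV: "cut n x \<in> AV"
  by (rule band_AV[OF band_cut])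

lemma AV_common:
  assumes "x \<in> AV" "y \<in> AV" obtains r where "r > 0" "analytic r x" "analytic r y"
proof -
  obtain r s where "r > 0" "analytic r x" "s > 0" "analytic s y"
    using assms by (auto simp: analytic_vectors_iff)
  thus ?thesis
    by (intro that[of "min r s"]) (auto intro: analytic_mono)
qed

lemma AV_add: "x \<in> AV \<Longrightarrow> y \<in> AV \<Longrightarrow> x + y \<in> AV"
  by (meson AV_common analytic_add analytic_vectors_iff)

lemma AV_scaleC: "x \<in> AV \<Longrightarrow> c *\<^sub>C x \<in> AV"
  by (meson analytic_scaleC analytic_vectors_iff)

lemma AV_J: "x \<in> AV \<Longrightarrow> J x \<in> AV"
  by (meson analytic_J analytic_vectors_iff)

lemma AV_U: "x \<in> AV \<Longrightarrow> U t x \<in> AV"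
  by (meson analytic_U analytic_vectors_iff)

lemma openin_at:
  "openin (analytic_vectors_at_topology H r) S \<longleftrightarrow>
    (\<exists>T. open T \<and> S = {v. analytic r v \<and> (expH (complex_of_real r) v, expH (complex_of_real (- r)) v) \<in> T})"
proof -
  have "(\<lambda>v. (op_app (op_exp (complex_of_real r) H) v, op_app (op_exp (complex_of_real (- r)) H) v)) -` T \<inter>
      analytic_vectors_at H r =
      {v. analytic r v \<and> (expH (complex_of_real r) v, expH (complex_of_real (- r)) v) \<in> T}" for T
    by (auto simp: analytic_vectors_at_eq) (auto simp: analytic_def op_app_exp)
  thus ?thesis
    unfolding analytic_vectors_at_topology_def openin_pullback_topology by auto
qed

lemma analytic_0: "analytic r 0"
  using analytic_scaleC[of r _ 0] band_analytic[OF band_cut, of r 0 0] by simp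

lemma expH_zero [simp]: "expH z 0 = 0"
proof -
  have "L2 (cut 0 0) (ex z)" by (rule band_L2_ex[OF band_cut])
  from expH_scaleC[OF this, of 0] show ?thesis by simp
qed

lemma pr_ball_open:
  "openin (analytic_vectors_at_topology H r) {v. analytic r v \<and> pr r v < e}"
  unfolding openin_at
proof (intro exI conjI)
  show "open {p :: 'a \<times> 'a. norm (fst p) + norm (snd p) < e}"
    by (intro open_Collect_less continuous_intros)
qed (auto simp: pr_def)

lemma openin_at_pr_ball:
  assumes "openin (analytic_vectors_at_topology H r) S" "0 \<in> S"
  obtains e where "e > 0" "\<And>v. analytic r v \<Longrightarrow> pr r v < e \<Longrightarrow> v \<in> S"
proof -
  obtain T where T: "open T"
    "S = {v. analytic r v \<and> (expH (complex_of_real r) v, expH (complex_of_real (- r)) v) \<in> T}"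
    using assms(1) unfolding openin_at by auto
  with assms(2) have "(0, 0) \<in> T" by simp
  then obtain e where e: "e > 0" "ball (0, 0) e \<subseteq> T"
    using T(1) by (auto simp: open_contains_ball)
  show ?thesis
  proof (rule that[OF e(1)])
    fix v assume v: "analytic r v" "pr r v < e"
    have "norm (expH (complex_of_real r) v, expH (complex_of_real (- r)) v) \<le> pr r v"
      unfolding pr_def norm_Pair by (rule sqrt_sum_squares_le_sum) auto
    hence "(expH (complex_of_real r) v, expH (complex_of_real (- r)) v) \<in> ball (0, 0) e"
      using v(2) unfolding zero_prod_def[symmetric] mem_ball_0 by simp
    with e(2) v(1) show "v \<in> S" unfolding T(2) by blast
  qed
qed

lemma
  assumes "\<eta> \<in> HV"
  shows HV_add: "x \<in> AV \<Longrightarrow> y \<in> AV \<Longrightarrow> \<eta> (x + y) = \<eta> x + \<eta> y"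
    and HV_scaleC: "x \<in> AV \<Longrightarrow> \<eta> (c *\<^sub>C x) = cnj c * \<eta> x"
  using assms by (auto simp: hyperfunction_vectors_def)

lemma HV_diff: "\<eta> \<in> HV \<Longrightarrow> x \<in> AV \<Longrightarrow> y \<in> AV \<Longrightarrow> \<eta> (x - y) = \<eta> x - \<eta> y"
  by (rule antilinear_diff[where P="\<lambda>x. x \<in> AV"]) (auto simp: HV_add HV_scaleC AV_scaleC)

lemma topspace_AV: "topspace (analytic_vectors_topology H) = AV"
proof
  show "topspace (analytic_vectors_topology H) \<subseteq> AV"
    using openin_topspace[of "analytic_vectors_topology H"]
    unfolding openin_analytic_vectors_topology by blast
  have W: "limit_nhd_0 H AV"
    unfolding limit_nhd_0_def absolutely_convex_def
  proof (intro conjI allI impI ballI)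
    show "convex AV"
      by (rule convexI) (auto simp: scaleR_scaleC intro!: AV_add AV_scaleC)
    fix r :: real assume "r > 0"
    thus "\<exists>S. openin (analytic_vectors_at_topology H r) S \<and> 0 \<in> S \<and> S \<subseteq> AV"
      using pr_ball_open[of r 1] by (intro exI[of _ "{v. analytic r v \<and> pr r v < 1}"])
        (auto simp: analytic_0 pr_def analytic_vectors_iff)
  qed (auto intro: AV_scaleC)
  have "openin (analytic_vectors_topology H) AV"
    unfolding openin_analytic_vectors_topology using W by (auto intro!: exI[of _ AV] AV_add)
  thus "AV \<subseteq> topspace (analytic_vectors_topology H)" by (rule openin_subset)
qed

text \<open>A neighbourhood of 0 in the limit contains a \<open>pr r\<close> ball for every
  \<open>r\<close>; homogeneity turns this into a linear estimate, with a constant depending on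
  \<open>r\<close>.\<close>

lemma HV_bound:
  assumes \<eta>: "\<eta> \<in> HV" and r: "r > 0"
  obtains C where "C \<ge> 0" "\<And>x. analytic r x \<Longrightarrow> cmod (\<eta> x) \<le> C * pr r x"
proof -
  have "continuous_map (analytic_vectors_topology H) euclidean \<eta>"
    using \<eta> by (simp add: hyperfunction_vectors_def)
  hence "openin (analytic_vectors_topology H) {x \<in> AV. \<eta> x \<in> ball 0 1}"
    using openin_continuous_map_preimage[of _ _ \<eta> "ball 0 1"] unfolding topspace_AV[symmetric] by simp
  moreover have "\<eta> 0 = 0" "0 \<in> AV"
    using HV_scaleC[OF \<eta> cut_AV, of 0] cut_AV[of 0 0] AV_scaleC[OF cut_AV, of 0] by auto
  ultimately obtain W where W: "limit_nhd_0 H W" "(\<lambda>w. 0 + w) ` W \<subseteq> {x \<in> AV. \<eta> x \<in> ball 0 1}"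
    unfolding openin_analytic_vectors_topology by force
  then obtain S where "openin (analytic_vectors_at_topology H r) S" "0 \<in> S" "S \<subseteq> W"
    using r unfolding limit_nhd_0_def by blast
  then obtain e where e: "e > 0" "\<And>v. analytic r v \<Longrightarrow> pr r v < e \<Longrightarrow> v \<in> W"
    by (meson openin_at_pr_ball subsetD)
  have small: "cmod (\<eta> v) < 1" if "analytic r v" "pr r v < e" for v
    using e(2)[OF that] W(2) by auto
  show ?thesis
  proof (rule that[of "2 / e"])
    fix x assume x: "analytic r x"
    hence AV: "x \<in> AV" using r by (auto simp: analytic_vectors_iff)
    show "cmod (\<eta> x) \<le> 2 / e * pr r x"
    proof (cases "pr r x = 0")
      case True
      hence "x = 0" using norm_le_pr[OF x] r by simp
      thus ?thesis using \<open>\<eta> 0 = 0\<close> by (simp add: pr_def)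
    next
      case False
      hence p: "pr r x > 0" using pr_nonneg[of r x] by simp
      \<comment> \<open>Scales \<open>x\<close> to \<open>pr r\<close> equal to
        \<open>e / 2\<close>, strictly inside the ball; this is where \<open>2 / e\<close> comes
        from.\<close>
      let ?c = "complex_of_real (e / (2 * pr r x))"
      have "cmod (\<eta> (?c *\<^sub>C x)) < 1"
        using x p e(1) by (intro small analytic_scaleC) (auto simp: pr_scaleC norm_mult norm_divide)
      hence "e / (2 * pr r x) * cmod (\<eta> x) < 1"
        using p e(1) by (simp add: HV_scaleC[OF \<eta> AV] norm_mult norm_divide)
      thus ?thesis using p e(1) by (simp add: field_simps)
    qed
  qed (use e in auto)
qed

text \<open>The converse of \<open>HV_bound\<close>. The sets where an antilinear functional has
  modulus below \<open>e\<close> are absolutely convex, so the estimates make them neighbourhoods in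
  the locally convex limit: continuity can be tested step by step.\<close>

lemma HV_I:
  assumes ext: "\<eta> \<in> extensional AV"
    and add: "\<And>x y. x \<in> AV \<Longrightarrow> y \<in> AV \<Longrightarrow> \<eta> (x + y) = \<eta> x + \<eta> y"
    and scale: "\<And>c x. x \<in> AV \<Longrightarrow> \<eta> (c *\<^sub>C x) = cnj c * \<eta> x"
    and bound: "\<And>r. r > 0 \<Longrightarrow> \<exists>C\<ge>0. \<forall>x. analytic r x \<longrightarrow> cmod (\<eta> x) \<le> C * pr r x"
  shows "\<eta> \<in> HV"
proof -
  have nhd: "limit_nhd_0 H {w \<in> AV. cmod (\<eta> w) < e}" if e: "e > 0" for e
    unfolding limit_nhd_0_def absolutely_convex_def
  proof (intro conjI allI impI ballI)
    show "convex {w \<in> AV. cmod (\<eta> w) < e}"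
    proof (rule convexI)
      fix x y :: 'a and u v :: real
      assume *: "x \<in> {w \<in> AV. cmod (\<eta> w) < e}" "y \<in> {w \<in> AV. cmod (\<eta> w) < e}"
        "0 \<le> u" "0 \<le> v" "u + v = 1"
      have "u *\<^sub>R \<eta> x + v *\<^sub>R \<eta> y \<in> ball 0 e"
        using convexD[OF convex_ball, of "\<eta> x" 0 e "\<eta> y" u v] * by auto
      thus "u *\<^sub>R x + v *\<^sub>R y \<in> {w \<in> AV. cmod (\<eta> w) < e}"
        using * by (simp add: scaleR_scaleC AV_add AV_scaleC add scale scaleR_conv_of_real)
    qed
    show "c *\<^sub>C x \<in> {w \<in> AV. cmod (\<eta> w) < e}"
      if "x \<in> {w \<in> AV. cmod (\<eta> w) < e}" "cmod c \<le> 1" for c x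
      using that mult_left_le_one_le[of "cmod (\<eta> x)" "cmod c"]
      by (auto simp: AV_scaleC scale norm_mult)
    fix r :: real assume r: "r > 0"
    obtain C where C: "C \<ge> 0" "\<And>x. analytic r x \<Longrightarrow> cmod (\<eta> x) \<le> C * pr r x"
      using bound[OF r] by auto
    \<comment> \<open>\<open>C + 1\<close> guards against \<open>C = 0\<close>.\<close>
    have "{v. analytic r v \<and> pr r v < e / (C + 1)} \<subseteq> {w \<in> AV. cmod (\<eta> w) < e}"
    proof safe
      fix x assume x: "analytic r x" "pr r x < e / (C + 1)"
      show "x \<in> AV" using x r by (auto simp: analytic_vectors_iff)
      have "cmod (\<eta> x) \<le> (C + 1) * pr r x"
        using C(2)[OF x(1)] pr_nonneg[of r x] by (simp add: distrib_right)
      also have "\<dots> < e" using x(2) C(1) by (simp add: field_simps)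
      finally show "cmod (\<eta> x) < e" .
    qed
    moreover have "0 \<in> {v. analytic r v \<and> pr r v < e / (C + 1)}"
      using e C(1) by (simp add: analytic_0 pr_def)
    ultimately show "\<exists>S. openin (analytic_vectors_at_topology H r) S \<and> 0 \<in> S \<and>
        S \<subseteq> {w \<in> AV. cmod (\<eta> w) < e}"
      using pr_ball_open by blast
  qed auto
  have "continuous_map (analytic_vectors_topology H) euclidean \<eta>"
    unfolding continuous_map_def topspace_AV
  proof (intro conjI allI impI)
    fix O' :: "complex set" assume O': "openin euclidean O'"
    show "openin (analytic_vectors_topology H) {x \<in> AV. \<eta> x \<in> O'}"
      unfolding openin_analytic_vectors_topology
    proof (intro conjI ballI)
      fix x assume x: "x \<in> {x \<in> AV. \<eta> x \<in> O'}"
      then obtain e where e: "e > 0" "ball (\<eta> x) e \<subseteq> O'"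
        using O' by (auto simp: open_contains_ball)
      have "(\<lambda>w. x + w) ` {w \<in> AV. cmod (\<eta> w) < e} \<subseteq> {x \<in> AV. \<eta> x \<in> O'}"
        using x e(2) by (auto simp: AV_add add dist_norm intro!: subsetD[OF e(2)])
      with nhd[OF e(1)]
      show "\<exists>W. limit_nhd_0 H W \<and> (\<lambda>w. x + w) ` W \<subseteq> {x \<in> AV. \<eta> x \<in> O'}" by blast
    qed auto
  qed auto
  thus ?thesis
    using ext add scale by (auto simp: hyperfunction_vectors_def)
qed

lemma HV_cut_tendsto:
  assumes \<eta>: "\<eta> \<in> HV" and x: "x \<in> AV" shows "(\<lambda>n. \<eta> (cut n x)) \<longlonglongrightarrow> \<eta> x"
proof -
  obtain r where r: "r > 0" "analytic r x" using x by (auto simp: analytic_vectors_iff)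
  obtain C where C: "C \<ge> 0" "\<And>x. analytic r x \<Longrightarrow> cmod (\<eta> x) \<le> C * pr r x"
    using HV_bound[OF \<eta> r(1)] by blast
  have "(\<lambda>n. \<eta> x - \<eta> (cut n x)) \<longlonglongrightarrow> 0"
  proof (rule Lim_null_comparison[OF always_eventually], rule allI)
    fix n
    have "\<eta> x - \<eta> (cut n x) = \<eta> (x - cut n x)" by (simp add: HV_diff \<eta> x cut_AV)
    also have "cmod \<dots> \<le> C * pr r (x - cut n x)"
      by (intro C analytic_diff analytic_cut r)
    finally show "norm (\<eta> x - \<eta> (cut n x)) \<le> C * pr r (x - cut n x)" .
    show "(\<lambda>n. C * pr r (x - cut n x)) \<longlonglongrightarrow> 0"
      using tendsto_mult_left[OF pr_cut_diff_tendsto[OF r(2)], of C] by simp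
  qed
  from tendsto_diff[OF tendsto_const[of "\<eta> x"] this] show ?thesis by simp
qed

text \<open>On a fixed band \<open>pr 1\<close> is bounded by a multiple of the Hilbert norm, so
  \<open>\<eta>\<close> is norm bounded there and \<open>antilinear_expH_has_derivative\<close>
  applies at every \<open>z\<close>. Passing from \<open>a\<close> to \<open>max a 0\<close> makes
  the bandwidth nonnegative.\<close>

lemma HV_orbit_entire:
  assumes \<eta>: "\<eta> \<in> HV" and x: "band a x"
  shows "(\<lambda>z. \<eta> (expH (cnj (\<i> * z)) x)) holomorphic_on A"
proof -
  obtain C where C: "C \<ge> 0" "\<And>x. analytic 1 x \<Longrightarrow> cmod (\<eta> x) \<le> C * pr 1 x"
    using HV_bound[OF \<eta>, of 1] by auto
  define b where "b = max a 0"
  have x: "band b x" and "b \<ge> 0" using band_mono[OF x, of b] by (auto simp: b_def)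
  have bound: "cmod (\<eta> y) \<le> (C * (2 * exp b)) * norm y" if "band b y" for y
  proof -
    have "cmod (\<eta> y) \<le> C * pr 1 y" by (rule C(2)[OF band_analytic[OF that]])
    also have "\<dots> \<le> C * (2 * exp b * norm y)"
      using pr_band_le[OF that, of 1] C(1) by (intro mult_left_mono) auto
    finally show ?thesis by (simp add: mult_ac)
  qed
  have "(\<lambda>z. \<eta> (expH (cnj z) x)) holomorphic_on UNIV"
    unfolding holomorphic_on_open[OF open_UNIV]
  proof (intro ballI exI)
    fix z
    show "((\<lambda>z. \<eta> (expH (cnj z) x)) has_field_derivative
        \<eta> (SI (\<lambda>t. complex_of_real t * ex (cnj z) t) x)) (at z)"
      by (rule antilinear_expH_has_derivative[OF x \<open>b \<ge> 0\<close> _ _ bound])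
        (use C(1) in \<open>auto simp: HV_add[OF \<eta>] HV_scaleC[OF \<eta>] band_AV\<close>)
  qed
  hence "((\<lambda>z. \<eta> (expH (cnj z) x)) \<circ> (\<lambda>z. \<i> * z)) holomorphic_on UNIV"
    by (intro holomorphic_on_compose_gen holomorphic_intros) auto
  thus ?thesis by (auto simp: o_def intro: holomorphic_on_subset)
qed

end

section \<open>The KMS condition and the boundary identity on band-limited vectors\<close>

context hyperfunction begin

lemma cnj_i_real: "cnj (\<i> * complex_of_real t) = \<i> * complex_of_real (- t)"
  by simp

lemma cnj_i_pi: "cnj (\<i> * (complex_of_real pi * \<i>)) = complex_of_real (- pi)"
  by (simp add: complex_eq_iff)

text \<open>The given extension and the entire function agree on the real line, hence on the closed
  strip, since a function continuous there and holomorphic inside is determined by one boundary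
  line. Comparing at \<open>pi i\<close> gives the identity.\<close>

lemma KMS_imp_boundary:
  assumes KMS: "\<eta> \<in> hyperfunction_vectors_KMS H U J" and x: "band a x"
  shows "\<eta> (expH (complex_of_real (- pi)) x) = cnj (\<eta> (J x))"
proof -
  obtain F where \<eta>: "\<eta> \<in> HV"
    and F: "\<And>t. F (complex_of_real t) = hyper_U H U t \<eta>"
      "continuous_map (top_of_set (closure strip_pi)) (weak_star_topology H) F"
      "\<And>\<xi>. \<xi> \<in> AV \<Longrightarrow> (\<lambda>z. F z \<xi>) holomorphic_on strip_pi"
      "F (complex_of_real pi * \<i>) = hyper_J H J \<eta>"
    using KMS unfolding hyperfunction_vectors_KMS_def by blast
  have AV: "x \<in> AV" by (rule band_AV[OF x])
  let ?f = "\<lambda>z. \<eta> (expH (cnj (\<i> * z)) x)"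
  have "F (complex_of_real pi * \<i>) x - ?f (complex_of_real pi * \<i>) = 0"
  proof (rule strip_pi_eq_0[where g="\<lambda>z. F z x - ?f z"])
    have "continuous_map (top_of_set (closure strip_pi)) (product_topology (\<lambda>_. euclidean) AV) F"
      using F(2) unfolding weak_star_topology_def continuous_map_in_subtopology by blast
    hence "continuous_map (top_of_set (closure strip_pi)) euclidean (\<lambda>z. F z x)"
      using AV unfolding continuous_map_componentwise by blast
    thus "continuous_on (closure strip_pi) (\<lambda>z. F z x - ?f z)"
      by (intro continuous_on_diff holomorphic_on_imp_continuous_on[OF HV_orbit_entire[OF \<eta> x]])
        (simp only: continuous_map_iff_continuous)
    show "(\<lambda>z. F z x - ?f z) holomorphic_on strip_pi"
      by (rule holomorphic_on_diff[OF F(3)[OF AV] HV_orbit_entire[OF \<eta> x]])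
    show "F (complex_of_real t) x - ?f (complex_of_real t) = 0" for t
      using AV by (simp add: F(1) hyper_U_def U_eq_expH)
  qed (auto simp: closure_strip_pi)
  thus ?thesis using AV unfolding cnj_i_pi by (simp add: F(4) hyper_J_def)
qed

text \<open>\<open>orbit \<eta> z\<close> is \<open>U\<^sup>\<eta>(z)\<close>; it is only meaningful on the closed strip, where the limit exists.\<close>

definition orbit :: "('a \<Rightarrow> complex) \<Rightarrow> complex \<Rightarrow> 'a \<Rightarrow> complex" where
  "orbit \<eta> z = (\<lambda>\<xi>\<in>AV. lim (\<lambda>n. \<eta> (expH (cnj (\<i> * z)) (cut n \<xi>))))"

context
  fixes \<eta> assumes \<eta>: "\<eta> \<in> HV"
    and boundary: "\<And>a x. band a x \<Longrightarrow> \<eta> (expH (complex_of_real (- pi)) x) = cnj (\<eta> (J x))"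
begin

text \<open>The bound does not involve the bandwidth \<open>a\<close>, which is what lets it survive
  the removal of the cut-off.\<close>

lemma orbit_bound_band:
  assumes r: "r > 0" and C: "C \<ge> 0" "\<And>x. analytic r x \<Longrightarrow> cmod (\<eta> x) \<le> C * pr r x"
    and x: "band a x" and z: "z \<in> closure strip_pi"
  shows "cmod (\<eta> (expH (cnj (\<i> * z)) x)) \<le> C * pr r x"
proof (rule three_lines_strip_pi[where f="\<lambda>z. \<eta> (expH (cnj (\<i> * z)) x)", OF _ _ _ _ z])
  show "(\<lambda>z. \<eta> (expH (cnj (\<i> * z)) x)) holomorphic_on UNIV"
    by (rule HV_orbit_entire[OF \<eta> x])
  define b where "b = max a 0"
  have x: "band b x" and "b \<ge> 0" using band_mono[OF x, of b] by (auto simp: b_def)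
  note analytic = band_analytic[OF x]
  \<comment> \<open>An a priori bound that grows with the bandwidth; the three lines theorem asks
    only for some \<open>K\<close> and does not pass it on.\<close>
  show "cmod (\<eta> (expH (cnj (\<i> * z)) x)) \<le> C * (2 * exp (\<bar>r\<bar> * b) * (exp (pi * b) * norm x))"
    if z: "z \<in> closure strip_pi" for z
  proof -
    have "cmod (\<eta> (expH (cnj (\<i> * z)) x)) \<le> C * pr r (expH (cnj (\<i> * z)) x)"
      by (rule C(2)[OF band_analytic[OF band_expH[OF x]]])
    also have "\<dots> \<le> C * (2 * exp (\<bar>r\<bar> * b) * norm (expH (cnj (\<i> * z)) x))"
      by (rule mult_left_mono[OF pr_band_le[OF band_expH[OF x]] C(1)])
    also have "norm (expH (cnj (\<i> * z)) x) \<le> exp (\<bar>Re (cnj (\<i> * z))\<bar> * b) * norm x"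
      by (rule band_norm_expH_le[OF x])
    also have "\<dots> \<le> exp (pi * b) * norm x"
      using z \<open>b \<ge> 0\<close> by (intro mult_right_mono) (auto simp: closure_strip_pi intro!: mult_right_mono)
    finally show ?thesis using C(1) by (simp add: mult_left_mono)
  qed
  show "cmod (\<eta> (expH (cnj (\<i> * complex_of_real t)) x)) \<le> C * pr r x" for t
    using C(2)[OF analytic_U[OF analytic], of "- t"]
    unfolding cnj_i_real U_eq_expH[symmetric] pr_U[OF analytic] .
  show "cmod (\<eta> (expH (cnj (\<i> * (complex_of_real t + complex_of_real pi * \<i>))) x)) \<le> C * pr r x" for t
  proof -
    have "cnj (\<i> * (complex_of_real t + complex_of_real pi * \<i>)) =
        complex_of_real (- pi) + \<i> * complex_of_real (- t)"
      by (simp add: complex_eq_iff)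
    \<comment> \<open>The commuting exponentials split off \<open>U (- t)\<close>, which keeps the
      band, so \<open>boundary\<close> applies to \<open>U (- t) x\<close>.\<close>
    hence "expH (cnj (\<i> * (complex_of_real t + complex_of_real pi * \<i>))) x =
        expH (complex_of_real (- pi)) (U (- t) x)"
      unfolding U_eq_expH by (simp only: band_expH_expH[OF x])
    hence "\<eta> (expH (cnj (\<i> * (complex_of_real t + complex_of_real pi * \<i>))) x) =
        cnj (\<eta> (J (U (- t) x)))"
      using boundary[OF band_U[OF x, of "-t"]] by simp
    moreover have "cmod (\<eta> (J (U (- t) x))) \<le> C * pr r x"
      using C(2)[OF analytic_J[OF analytic_U[OF analytic]], of "-t"]
      by (simp add: pr_J analytic_U analytic pr_U)
    ultimately show ?thesis by simp
  qed
qed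

lemma orbit_approx_diff:
  "\<eta> (expH w (cut m x)) - \<eta> (expH w (cut n x)) = \<eta> (expH w (cut m x - cut n x))"
proof -
  let ?b = "max (real m) (real n)"
  have b: "band ?b (cut m x)" "band ?b (cut n x)"
    by (rule band_mono[OF band_cut]; simp)+
  have diff: "expH w (cut m x - cut n x) = expH w (cut m x) - expH w (cut n x)"
    using expH_add[OF band_L2_ex[OF band_diff[OF b]] band_L2_ex[OF b(2)], of w]
    unfolding eq_diff_eq by simp
  show ?thesis
    unfolding diff using b by (intro HV_diff[OF \<eta>, symmetric] band_AV band_expH)
qed

lemma pr_cut_diff_le:
  assumes x: "analytic r x"
  shows "pr r (cut m x - cut n x) \<le> pr r (x - cut n x) + pr r (x - cut m x)"
proof -
  have "pr r (cut m x - cut n x) = pr r ((x - cut n x) + (-1) *\<^sub>C (x - cut m x))"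
    by (simp add: scaleC_minus_left)
  also have "\<dots> \<le> pr r (x - cut n x) + pr r ((-1) *\<^sub>C (x - cut m x))"
    by (intro pr_add analytic_diff analytic_scaleC analytic_cut x)
  also have "pr r ((-1) *\<^sub>C (x - cut m x)) = pr r (x - cut m x)"
    by (subst pr_scaleC) (auto intro: analytic_diff analytic_cut x)
  finally show ?thesis .
qed

text \<open>The difference of two cut-offs is itself band-limited, so the strip estimate applies to
  it; the right side is independent of \<open>z\<close>.\<close>

lemma orbit_approx_diff_bound:
  assumes r: "r > 0" and C: "C \<ge> 0" "\<And>x. analytic r x \<Longrightarrow> cmod (\<eta> x) \<le> C * pr r x"
    and x: "analytic r x" and z: "z \<in> closure strip_pi"
  shows "cmod (\<eta> (expH (cnj (\<i> * z)) (cut m x)) - \<eta> (expH (cnj (\<i> * z)) (cut n x))) \<le>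
    C * (pr r (x - cut n x) + pr r (x - cut m x))"
proof -
  have b: "band (max (real m) (real n)) (cut m x - cut n x)"
    by (intro band_diff; rule band_mono[OF band_cut]; simp)
  show ?thesis
    unfolding orbit_approx_diff
    by (rule order_trans[OF orbit_bound_band[OF r C b z] mult_left_mono[OF pr_cut_diff_le[OF x] C(1)]])
qed

lemma orbit_tendsto:
  assumes x: "x \<in> AV" and z: "z \<in> closure strip_pi"
  shows "(\<lambda>n. \<eta> (expH (cnj (\<i> * z)) (cut n x))) \<longlonglongrightarrow> orbit \<eta> z x"
proof -
  let ?s = "\<lambda>n. \<eta> (expH (cnj (\<i> * z)) (cut n x))"
  obtain r where r: "r > 0" "analytic r x" using x by (auto simp: analytic_vectors_iff)
  obtain C where C: "C \<ge> 0" "\<And>x. analytic r x \<Longrightarrow> cmod (\<eta> x) \<le> C * pr r x"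
    using HV_bound[OF \<eta> r(1)] by blast
  have lim: "(\<lambda>n. C * pr r (x - cut n x)) \<longlonglongrightarrow> 0"
    using tendsto_mult_left[OF pr_cut_diff_tendsto[OF r(2)], of C] by simp
  have "Cauchy ?s"
  proof (rule CauchyI)
    fix e :: real assume "e > 0"
    hence "e / 2 > 0" by simp
    from order_tendstoD(2)[OF lim this] obtain N where N: "\<And>n. n \<ge> N \<Longrightarrow> C * pr r (x - cut n x) < e / 2"
      by (auto simp: eventually_sequentially)
    have "norm (?s m - ?s n) < e" if "m \<ge> N" "n \<ge> N" for m n
      using orbit_approx_diff_bound[OF r(1) C r(2) z, of m n] N[OF that(1)] N[OF that(2)]
      by (simp add: distrib_left)
    thus "\<exists>M. \<forall>m\<ge>M. \<forall>n\<ge>M. norm (?s m - ?s n) < e" by blast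
  qed
  hence "convergent ?s" by (rule Cauchy_convergent)
  thus ?thesis using x by (simp add: orbit_def convergent_LIMSEQ_iff)
qed

lemma orbit_bound:
  assumes r: "r > 0" and C: "C \<ge> 0" "\<And>x. analytic r x \<Longrightarrow> cmod (\<eta> x) \<le> C * pr r x"
    and x: "analytic r x" and z: "z \<in> closure strip_pi"
  shows "cmod (orbit \<eta> z x) \<le> C * pr r x"
proof (rule LIMSEQ_le_const2)
  have "x \<in> AV" using r x by (auto simp: analytic_vectors_iff)
  thus "(\<lambda>n. cmod (\<eta> (expH (cnj (\<i> * z)) (cut n x)))) \<longlonglongrightarrow> cmod (orbit \<eta> z x)"
    by (intro tendsto_norm orbit_tendsto z)
  have "cmod (\<eta> (expH (cnj (\<i> * z)) (cut n x))) \<le> C * pr r x" for n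
    by (rule order_trans[OF orbit_bound_band[OF r C band_cut z] mult_left_mono[OF pr_cut_le[OF x] C(1)]])
  thus "\<exists>N. \<forall>n\<ge>N. cmod (\<eta> (expH (cnj (\<i> * z)) (cut n x))) \<le> C * pr r x" by blast
qed

text \<open>The constant of \<open>\<eta>\<close> at level \<open>r\<close> works along the whole
  orbit, so \<open>HV_I\<close> yields continuity; additivity and scaling pass to the limit.\<close>

lemma orbit_HV:
  assumes z: "z \<in> closure strip_pi" shows "orbit \<eta> z \<in> HV"
proof (rule HV_I)
  show "orbit \<eta> z \<in> extensional AV" by (simp add: orbit_def)
  let ?e = "expH (cnj (\<i> * z))"
  show "orbit \<eta> z (x + y) = orbit \<eta> z x + orbit \<eta> z y" if "x \<in> AV" "y \<in> AV" for x y
  proof (rule LIMSEQ_unique[OF orbit_tendsto[OF AV_add[OF that] z]])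
    have "\<eta> (?e (cut n (x + y))) = \<eta> (?e (cut n x)) + \<eta> (?e (cut n y))" for n
      by (subst E_add, simp, subst expH_add[OF band_L2_ex[OF band_cut] band_L2_ex[OF band_cut]])
        (rule HV_add[OF \<eta> band_AV[OF band_expH[OF band_cut]] band_AV[OF band_expH[OF band_cut]]])
    thus "(\<lambda>n. \<eta> (?e (cut n (x + y)))) \<longlonglongrightarrow> orbit \<eta> z x + orbit \<eta> z y"
      using tendsto_add[OF orbit_tendsto[OF that(1) z] orbit_tendsto[OF that(2) z]] by simp
  qed
  show "orbit \<eta> z (c *\<^sub>C x) = cnj c * orbit \<eta> z x" if "x \<in> AV" for c x
  proof (rule LIMSEQ_unique[OF orbit_tendsto[OF AV_scaleC[OF that] z]])
    have "\<eta> (?e (cut n (c *\<^sub>C x))) = cnj c * \<eta> (?e (cut n x))" for n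
      by (subst E_scaleC, simp, subst expH_scaleC[OF band_L2_ex[OF band_cut]])
        (rule HV_scaleC[OF \<eta> band_AV[OF band_expH[OF band_cut]]])
    thus "(\<lambda>n. \<eta> (?e (cut n (c *\<^sub>C x)))) \<longlonglongrightarrow> cnj c * orbit \<eta> z x"
      using tendsto_mult_left[OF orbit_tendsto[OF that z]] by simp
  qed
  show "\<exists>C\<ge>0. \<forall>x. analytic r x \<longrightarrow> cmod (orbit \<eta> z x) \<le> C * pr r x" if r: "r > 0" for r
  proof -
    obtain C where C: "C \<ge> 0" "\<And>x. analytic r x \<Longrightarrow> cmod (\<eta> x) \<le> C * pr r x"
      using HV_bound[OF \<eta> r] by blast
    show ?thesis using C(1) orbit_bound[OF r C _ z] by blast
  qed
qed

lemma orbit_uniform_limit: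
  assumes x: "x \<in> AV"
  shows "uniform_limit (closure strip_pi) (\<lambda>n z. \<eta> (expH (cnj (\<i> * z)) (cut n x)))
    (\<lambda>z. orbit \<eta> z x) sequentially"
proof (rule uniform_limitI)
  fix e :: real assume e: "e > 0"
  obtain r where r: "r > 0" "analytic r x" using x by (auto simp: analytic_vectors_iff)
  obtain C where C: "C \<ge> 0" "\<And>x. analytic r x \<Longrightarrow> cmod (\<eta> x) \<le> C * pr r x"
    using HV_bound[OF \<eta> r(1)] by blast
  have lim: "(\<lambda>n. C * pr r (x - cut n x)) \<longlonglongrightarrow> 0"
    using tendsto_mult_left[OF pr_cut_diff_tendsto[OF r(2)], of C] by simp
  \<comment> \<open>Letting \<open>m\<close> tend to infinity in the Cauchy estimate gives a tail
    bound free of \<open>z\<close>.\<close>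
  have le: "dist (\<eta> (expH (cnj (\<i> * z)) (cut n x))) (orbit \<eta> z x) \<le> C * pr r (x - cut n x)"
    if z: "z \<in> closure strip_pi" for n z
  proof -
    let ?s = "\<lambda>n. \<eta> (expH (cnj (\<i> * z)) (cut n x))"
    have "(\<lambda>m. cmod (?s n - ?s m)) \<longlonglongrightarrow> cmod (?s n - orbit \<eta> z x)"
      by (intro tendsto_norm tendsto_diff tendsto_const orbit_tendsto x z)
    moreover have "(\<lambda>m. C * pr r (x - cut m x) + C * pr r (x - cut n x)) \<longlonglongrightarrow> 0 + C * pr r (x - cut n x)"
      by (intro tendsto_add tendsto_const lim)
    moreover have "cmod (?s n - ?s m) \<le> C * pr r (x - cut m x) + C * pr r (x - cut n x)" for m
      using orbit_approx_diff_bound[OF r(1) C r(2) z, of n m] by (simp add: distrib_left)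
    ultimately have "cmod (?s n - orbit \<eta> z x) \<le> 0 + C * pr r (x - cut n x)"
      by (intro LIMSEQ_le) auto
    thus ?thesis by (simp add: dist_norm)
  qed
  show "\<forall>\<^sub>F n in sequentially. \<forall>z\<in>closure strip_pi.
      dist (\<eta> (expH (cnj (\<i> * z)) (cut n x))) (orbit \<eta> z x) < e"
    using order_tendstoD(2)[OF lim e] by eventually_elim (use le le_less_trans in blast)
qed

lemma boundary_imp_KMS: "\<eta> \<in> hyperfunction_vectors_KMS H U J"
proof -
  have cont: "continuous_on (closure strip_pi) (\<lambda>z. orbit \<eta> z x)" if "x \<in> AV" for x
  proof (rule uniform_limit_theorem[OF always_eventually orbit_uniform_limit[OF that]], rule allI)
    show "continuous_on (closure strip_pi) (\<lambda>z. \<eta> (expH (cnj (\<i> * z)) (cut n x)))" for n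
      by (rule holomorphic_on_imp_continuous_on[OF HV_orbit_entire[OF \<eta> band_cut]])
  qed simp
  have hol: "(\<lambda>z. orbit \<eta> z x) holomorphic_on strip_pi" if "x \<in> AV" for x
  proof (rule holomorphic_uniform_sequence[OF open_strip_pi])
    show "(\<lambda>z. \<eta> (expH (cnj (\<i> * z)) (cut n x))) holomorphic_on strip_pi" for n
      by (rule HV_orbit_entire[OF \<eta> band_cut])
    fix z assume "z \<in> strip_pi"
    then obtain d where d: "d > 0" "cball z d \<subseteq> strip_pi"
      using open_strip_pi by (auto simp: open_contains_cball)
    thus "\<exists>d>0. cball z d \<subseteq> strip_pi \<and> uniform_limit (cball z d)
        (\<lambda>n z. \<eta> (expH (cnj (\<i> * z)) (cut n x))) (\<lambda>z. orbit \<eta> z x) sequentially"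
      using uniform_limit_on_subset[OF orbit_uniform_limit[OF that], of "cball z d"]
        closure_subset by blast
  qed
  have "continuous_map (top_of_set (closure strip_pi)) (weak_star_topology H) (orbit \<eta>)"
    unfolding weak_star_topology_def continuous_map_in_subtopology continuous_map_componentwise
    using cont orbit_HV by (auto simp: orbit_def[of \<eta>] extensional_def)
  moreover have "orbit \<eta> (complex_of_real t) = hyper_U H U t \<eta>" for t
  proof
    fix x
    show "orbit \<eta> (complex_of_real t) x = hyper_U H U t \<eta> x"
    proof (cases "x \<in> AV")
      case True
      have "(\<lambda>n. \<eta> (cut n (U (- t) x))) \<longlonglongrightarrow> orbit \<eta> (complex_of_real t) x"
        using orbit_tendsto[OF True, of "complex_of_real t"]
        unfolding cnj_i_real U_eq_expH[symmetric] cut_U by (simp add: closure_strip_pi)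
      from LIMSEQ_unique[OF this HV_cut_tendsto[OF \<eta> AV_U[OF True]]] show ?thesis
        using True by (simp add: hyper_U_def)
    qed (simp add: orbit_def hyper_U_def)
  qed
  moreover have "orbit \<eta> (complex_of_real pi * \<i>) = hyper_J H J \<eta>"
  proof
    fix x
    show "orbit \<eta> (complex_of_real pi * \<i>) x = hyper_J H J \<eta> x"
    proof (cases "x \<in> AV")
      case True
      \<comment> \<open>At height \<open>pi\<close> the boundary identity replaces the exponential
        by \<open>J\<close>, which commutes with the cut-offs since \<open>[- n, n]\<close> is
        symmetric.\<close>
      have "(\<lambda>n. cnj (\<eta> (cut n (J x)))) \<longlonglongrightarrow> orbit \<eta> (complex_of_real pi * \<i>) x"
        using orbit_tendsto[OF True, of "complex_of_real pi * \<i>"]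
        unfolding cnj_i_pi boundary[OF band_cut] cut_J by (simp add: closure_strip_pi)
      from LIMSEQ_unique[OF this tendsto_cnj[OF HV_cut_tendsto[OF \<eta> AV_J[OF True]]]] show ?thesis
        using True by (simp add: hyper_J_def)
    qed (simp add: orbit_def hyper_J_def)
  qed
  ultimately show ?thesis
    using \<eta> hol unfolding hyperfunction_vectors_KMS_def by blast
qed

end

lemma KMS_iff:
  "\<eta> \<in> hyperfunction_vectors_KMS H U J \<longleftrightarrow> \<eta> \<in> HV \<and>
    (\<forall>a x. band a x \<longrightarrow> \<eta> (expH (complex_of_real (- pi)) x) = cnj (\<eta> (J x)))"
proof (intro iffI conjI allI impI)
  assume KMS: "\<eta> \<in> hyperfunction_vectors_KMS H U J"
  thus "\<eta> \<in> HV" by (simp add: hyperfunction_vectors_KMS_def)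
  show "\<eta> (expH (complex_of_real (- pi)) x) = cnj (\<eta> (J x))" if "band a x" for a x
    by (rule KMS_imp_boundary[OF KMS that])
next
  assume "\<eta> \<in> HV \<and> (\<forall>a x. band a x \<longrightarrow> \<eta> (expH (complex_of_real (- pi)) x) = cnj (\<eta> (J x)))"
  thus "\<eta> \<in> hyperfunction_vectors_KMS H U J" by (intro boundary_imp_KMS) blast+
qed

end

section \<open>The symplectic complement of the standard subspace\<close>

text \<open>Two consequences of \<open>V\<close> being the fixed space of
  \<open>J exp (- pi H)\<close>, phrased on bands, where \<open>exp (- pi H)\<close> is bounded and
  no domain question arises. They carry the whole description of the symplectic complement.\<close>

locale hyperfunction_standard = hyperfunction +
  fixes V :: "'a set"
  assumes V_cut: "v \<in> V \<Longrightarrow> J (expH (complex_of_real (- pi)) (cut n v)) = cut n v"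
    and V_band: "band a v \<Longrightarrow> J (expH (complex_of_real (- pi)) v) = v \<Longrightarrow> v \<in> V"
begin

lemma J_expH_pi: "band a x \<Longrightarrow> J (expH (complex_of_real (- pi)) x) = expH (complex_of_real pi) (J x)"
  using J_expH(2)[OF band_L2_ex, of a x "complex_of_real (- pi)"] by simp

lemma expH_pi_cancel:
  assumes "band a x"
  shows "expH (complex_of_real (- pi)) (expH (complex_of_real pi) x) = x"
    "expH (complex_of_real pi) (expH (complex_of_real (- pi)) x) = x"
  using band_expH_expH[OF assms, of "complex_of_real (- pi)" "complex_of_real pi"]
    band_expH_expH[OF assms, of "complex_of_real pi" "complex_of_real (- pi)"] by simp_all

lemma expH_pi_cinner:
  assumes "band a x" "band b y"
  shows "cinner (expH (complex_of_real (- pi)) x) y = cinner x (expH (complex_of_real (- pi)) y)"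
  using expH_cinner[OF band_L2_ex[OF assms(1)] band_L2_ex[OF assms(2)], of "complex_of_real (- pi)"]
  by simp

lemma cut_symplectic_complement:
  assumes "w \<in> symplectic_complement V" shows "cut n w \<in> symplectic_complement V"
  unfolding symplectic_complement_def
proof safe
  fix v assume v: "v \<in> V"
  have "cut n v \<in> V" by (rule V_band[OF band_cut V_cut[OF v]])
  thus "Im (cinner (cut n w) v) = 0"
    using assms by (simp add: E_cinner symplectic_complement_def)
qed

text \<open>Testing against \<open>v = \<xi> + J exp (- \<pi> H) \<xi>\<close>.\<close>

lemma band_symplectic_complement_imp:
  assumes w: "band a w" and S: "w \<in> symplectic_complement V"
  shows "expH (complex_of_real (- pi)) (J w) = w"
proof -
  let ?e = "expH (complex_of_real (- pi))"
  define d where "d = w - ?e (J w)"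
  have orth: "Im (cinner d x) = 0" if x: "band a x" for x
  proof -
    let ?v = "x + J (?e x)"
    have bJ: "band a (?e x)" "band a (J (?e x))" by (intro band_expH band_J x)+
    have "?e ?v = ?e x + ?e (J (?e x))"
      by (rule expH_add[OF band_L2_ex[OF x] band_L2_ex[OF bJ(2)]])
    also have "?e (J (?e x)) = J x"
      using J_expH_pi[OF x] expH_pi_cancel(1)[OF band_J[OF x]] by simp
    finally have "J (?e ?v) = ?v" by (simp add: J_add add.commute)
    hence "?v \<in> V" by (rule V_band[OF band_add[OF x bJ(2)]])
    hence "Im (cinner w ?v) = 0" using S by (simp add: symplectic_complement_def)
    moreover have "cinner w (J (?e x)) = cinner x (?e (J w))"
    proof -
      have "cinner w (J (?e x)) = cinner (?e x) (J w)" using J_cinner[of "J w" "?e x"] by simp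
      also have "\<dots> = cinner x (?e (J w))" by (rule expH_pi_cinner[OF x band_J[OF w]])
      finally show ?thesis .
    qed
    moreover have "Im (cinner x (?e (J w))) = - Im (cinner (?e (J w)) x)"
      using cinner_commute[of x "?e (J w)"] by (simp add: complex_eq_iff)
    moreover have "cinner d x = cinner w x - cinner (?e (J w)) x"
      using cinner_add_left[of d "?e (J w)" x] by (simp add: d_def)
    ultimately show ?thesis by (simp add: cinner_add_right)
  qed
  have "band a d" unfolding d_def by (intro band_diff band_expH band_J w)
  \<comment> \<open>At \<open>x = i d\<close> the imaginary part of \<open>cinner d x\<close> is the
    squared norm of \<open>d\<close>.\<close>
  from orth[OF band_scaleC[OF this, of \<i>]] have "d = 0"
    by (simp add: cinner_scaleC_right cinner_self)
  thus ?thesis by (simp add: d_def)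
qed

text \<open>Moving \<open>exp (- pi H)\<close> and then \<open>J\<close> to the other side shows
  \<open>cinner w v = cinner v w\<close>, so the product equals its own conjugate.\<close>

lemma band_symplectic_complementI:
  assumes w: "band (real n) w" and e: "expH (complex_of_real (- pi)) (J w) = w"
  shows "w \<in> symplectic_complement V"
  unfolding symplectic_complement_def
proof safe
  fix v assume v: "v \<in> V"
  let ?e = "expH (complex_of_real (- pi))"
  have "cinner w v = cinner (cut n w) v" using w by (simp add: band_def)
  also have "\<dots> = cinner (?e (J w)) (cut n v)" unfolding e by (simp add: E_cinner)
  also have "\<dots> = cinner (J w) (?e (cut n v))" by (rule expH_pi_cinner[OF band_J[OF w] band_cut])
  also have "?e (cut n v) = J (cut n v)" using V_cut[OF v, of n] J_J by metis
  also have "cinner (J w) (J (cut n v)) = cinner (cut n v) w" by (rule J_cinner)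
  also have "\<dots> = cinner v (cut n w)" by (simp add: E_cinner)
  also have "\<dots> = cinner v w" using w by (simp add: band_def)
  finally have "cinner w v = cinner v w" .
  thus "Im (cinner w v) = 0" using cinner_commute[of w v] by (simp add: complex_eq_iff)
qed

lemma KMS_eq:
  "hyperfunction_vectors_KMS H U J =
    {\<eta> \<in> HV. \<forall>v \<in> symplectic_complement V \<inter> AV. \<eta> v \<in> \<real>}"
proof -
  let ?e = "expH (complex_of_real (- pi))"
  have "(\<forall>a x. band a x \<longrightarrow> \<eta> (?e x) = cnj (\<eta> (J x))) \<longleftrightarrow>
      (\<forall>v \<in> symplectic_complement V \<inter> AV. \<eta> v \<in> \<real>)" if \<eta>: "\<eta> \<in> HV" for \<eta>
  proof (intro iffI allI ballI impI)
    fix v assume b: "\<forall>a x. band a x \<longrightarrow> \<eta> (?e x) = cnj (\<eta> (J x))"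
      and v: "v \<in> symplectic_complement V \<inter> AV"
    have "Im (\<eta> (cut n v)) = 0" for n
    proof -
      have "?e (J (cut n v)) = cut n v"
        using v by (intro band_symplectic_complement_imp[OF band_cut] cut_symplectic_complement) auto
      moreover have "\<eta> (?e (J (cut n v))) = cnj (\<eta> (J (J (cut n v))))"
        using b band_J[OF band_cut] by blast
      ultimately show ?thesis by (simp add: complex_eq_iff)
    qed
    moreover have "(\<lambda>n. Im (\<eta> (cut n v))) \<longlonglongrightarrow> Im (\<eta> v)"
      using v by (intro tendsto_Im HV_cut_tendsto[OF \<eta>]) auto
    ultimately have "Im (\<eta> v) = 0" by (simp add: LIMSEQ_const_iff)
    thus "\<eta> v \<in> \<real>" by (simp add: complex_is_Real_iff)
  next
    fix a x assume R: "\<forall>v \<in> symplectic_complement V \<inter> AV. \<eta> v \<in> \<real>" and "band a x"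
    \<comment> \<open>Rounds the bandwidth up, because membership in the complement was derived for
      the integer cut-offs.\<close>
    obtain n :: nat where "a \<le> real n" using real_arch_simple by blast
    with \<open>band a x\<close> have x: "band (real n) x" by (rule band_mono)
    have b: "band (real n) (?e x)" "band (real n) (J x)" by (intro band_expH band_J x)+
    have eJ: "?e (J (?e x)) = J x"
      using J_expH_pi[OF x] expH_pi_cancel(1)[OF band_J[OF x]] by simp
    \<comment> \<open>\<open>exp (- pi H) J\<close> interchanges the two summands, since the
      antilinear \<open>J\<close> conjugates the coefficients; the vector is therefore fixed and
      lies in the complement.\<close>
    have real: "Im (\<eta> (c *\<^sub>C ?e x + cnj c *\<^sub>C J x)) = 0" for c
    proof -
      let ?v = "c *\<^sub>C ?e x + cnj c *\<^sub>C J x"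
      have v: "band (real n) ?v" by (intro band_add band_scaleC b)
      have "J ?v = cnj c *\<^sub>C J (?e x) + c *\<^sub>C x" by (simp add: J_add J_scaleC)
      hence "?e (J ?v) = cnj c *\<^sub>C ?e (J (?e x)) + c *\<^sub>C ?e x"
        by (simp only: expH_add[OF band_L2_ex[OF band_scaleC[OF band_J[OF b(1)]]] band_L2_ex[OF band_scaleC[OF x]]]
            expH_scaleC[OF band_L2_ex[OF band_J[OF b(1)]]] expH_scaleC[OF band_L2_ex[OF x]])
      hence "?e (J ?v) = ?v" by (simp only: eJ add.commute)
      hence "\<eta> ?v \<in> \<real>"
        using R band_symplectic_complementI[OF v] band_AV[OF v] by blast
      thus ?thesis by (simp add: complex_is_Real_iff)
    qed
    have "Im (cnj c * \<eta> (?e x) + c * \<eta> (J x)) = 0" for c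
      using real[of c] b by (simp add: HV_add[OF \<eta>] HV_scaleC[OF \<eta>] AV_scaleC band_AV)
    \<comment> \<open>\<open>c = 1\<close> shows that the imaginary parts cancel,
      \<open>c = i\<close> that the real parts agree.\<close>
    from this[of 1] this[of \<i>] show "\<eta> (?e x) = cnj (\<eta> (J x))"
      by (simp add: complex_eq_iff)
  qed
  thus ?thesis by (auto simp: KMS_iff)
qed

end

section \<open>The modular operator\<close>

context pvm begin

lemma vimage_borel: "g \<in> borel_measurable borel \<Longrightarrow> A \<in> sets borel \<Longrightarrow> g -` A \<in> sets borel"
  for g :: "real \<Rightarrow> real"
  using measurable_sets[of g borel borel A] by simp

text \<open>The image of \<open>E\<close> under \<open>g\<close> is the spectral measure to be
  expected for \<open>g(H)\<close>; an exponential \<open>g\<close> yields the modular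
  operator.\<close>

lemma pvm_vimage:
  assumes g: "g \<in> borel_measurable borel" shows "pvm (\<lambda>A. E (g -` A))"
proof (unfold_locales, unfold projection_valued_measure_def, intro conjI ballI allI impI)
  show "orthogonal_projection (E (g -` A))" if "A \<in> sets borel" for A
    by (rule proj[OF vimage_borel[OF g that]])
  show "E (g -` UNIV) x = x" for x by simp
  show "E (g -` (A \<inter> B)) x = E (g -` A) (E (g -` B) x)" if "A \<in> sets borel" "B \<in> sets borel" for A B x
    by (simp add: E_Int vimage_borel[OF g] that)
  show "(\<lambda>n. E (g -` A n) x) sums E (g -` (\<Union>n. A n)) x"
    if "range A \<subseteq> sets borel" "disjoint_family A" for A :: "nat \<Rightarrow> real set" and x
    unfolding vimage_UN
    by (rule E_sums) (use that vimage_borel[OF g] in \<open>auto simp: disjoint_family_on_def\<close>)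
qed

lemma spectral_integral_vimage:
  assumes g [measurable]: "g \<in> borel_measurable borel" and f [measurable]: "f \<in> borel_measurable borel"
  shows "spectral_integral (\<lambda>A. E (g -` A)) f = spectral_integral E (\<lambda>t. f (g t))"
proof -
  interpret P: pvm "\<lambda>A. E (g -` A)" by (rule pvm_vimage[OF g])
  have mu: "P.mu x = distr (mu x) borel g" for x
  proof (rule measure_eqI)
    fix A assume "A \<in> sets (P.mu x)"
    thus "emeasure (P.mu x) A = emeasure (distr (mu x) borel g) A"
      using vimage_borel[OF g, of A]
      by (simp add: P.emeasure_mu emeasure_mu emeasure_distr)
  qed simp
  have N2: "P.N2 x h = N2 x (\<lambda>t. h (g t))" if [measurable]: "h \<in> borel_measurable borel" for x h
    unfolding P.N2_def N2_def mu by (subst nn_integral_distr) auto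
  have L2: "P.L2 x f \<longleftrightarrow> L2 x (\<lambda>t. f (g t))" for x
    by (simp add: P.L2_def L2_def N2)
  have comp: "simple (\<lambda>t. s (g t))" if "simple s" for s :: "real \<Rightarrow> complex"
    using simple_function_comp[of g borel borel s] that by simp
  have SSI: "P.SSI s x = SSI (\<lambda>t. s (g t)) x" if s: "simple s" for s x
    unfolding simple_spectral_integral_def
  proof (rule sum.mono_neutral_cong_right)
    show "finite (range s)" by (rule simple_range[OF s])
    show "\<forall>c\<in>range s - range (\<lambda>t. s (g t)). c *\<^sub>C E (g -` s -` {c}) x = 0"
    proof
      fix c assume "c \<in> range s - range (\<lambda>t. s (g t))"
      hence "c \<notin> range (\<lambda>t. s (g t))" by blast
      hence "(\<lambda>t. s (g t)) -` {c} = {}" by (rule vimage_singleton_empty)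
      moreover have "g -` s -` {c} = (\<lambda>t. s (g t)) -` {c}" by auto
      ultimately have "g -` s -` {c} = {}" by simp
      thus "c *\<^sub>C E (g -` s -` {c}) x = 0" by simp
    qed
  qed (auto simp: vimage_def)
  have SI: "P.SI f x = SI (\<lambda>t. f (g t)) x" if x: "L2 x (\<lambda>t. f (g t))" for x
  proof (rule LIMSEQ_unique)
    let ?s = "simple_approx f"
    have x': "P.L2 x f" using x L2 by simp
    show "(\<lambda>n. P.SSI (?s n) x) \<longlonglongrightarrow> P.SI f x" by (rule P.SI_simple_approx[OF x'])
    have "(\<lambda>n. SSI (\<lambda>t. ?s n (g t)) x) \<longlonglongrightarrow> SI (\<lambda>t. f (g t)) x"
      using P.N2_simple_approx_diff[OF x'] by (intro SI_tendsto x comp simple_approx f) (simp add: N2)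
    thus "(\<lambda>n. P.SSI (?s n) x) \<longlonglongrightarrow> SI (\<lambda>t. f (g t)) x"
      by (simp add: SSI simple_approx)
  qed
  have "spectral_integral E (\<lambda>t. f (g t)) = {(x, SI (\<lambda>t. f (g t)) x) |x. L2 x (\<lambda>t. f (g t))}"
    by (rule spectral_integral_eq) measurable
  thus ?thesis unfolding P.spectral_integral_eq[OF f] using L2 SI by auto
qed

end

text \<open>Two decompositions \<open>a + i b = c + i d\<close> differ by an element of both
  \<open>V\<close> and \<open>i V\<close>, which is 0. Through \<open>modular_objects\<close> this
  makes the graph of the square root of the modular operator single-valued.\<close>

lemma tomita_operator_unique:
  assumes V: "standard_subspace V" and "(x, y) \<in> tomita_operator V" "(x, y') \<in> tomita_operator V"
  shows "y = y'"
proof -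
  obtain a b c d where *: "a \<in> V" "b \<in> V" "c \<in> V" "d \<in> V"
    "x = a + \<i> *\<^sub>C b" "y = a - \<i> *\<^sub>C b" "x = c + \<i> *\<^sub>C d" "y' = c - \<i> *\<^sub>C d"
    using assms(2,3) by (auto simp: tomita_operator_def)
  have sub: "a - c \<in> V" "d - b \<in> V"
    using V * by (auto simp: standard_subspace_def intro: subspace_diff)
  have "a - c = \<i> *\<^sub>C (d - b)"
    using *(5,7) by (simp add: scaleC_diff_right algebra_simps)
  hence "a - c \<in> V \<inter> {\<i> *\<^sub>C y |y. y \<in> V}" using sub by auto
  hence "a - c = 0" using V unfolding standard_subspace_def by blast
  thus ?thesis using * by simp
qed

context hyperfunction begin

lemma modular_operator_spectral_measure:
  "is_spectral_measure (op_exp (complex_of_real (- 2 * pi)) H) (\<lambda>A. E ((\<lambda>t. exp (- 2 * pi * t)) -` A))"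
proof -
  have "op_exp (complex_of_real (- 2 * pi)) H = spectral_integral E (ex (complex_of_real (- 2 * pi)))"
    by (subst spectral_integral_eq) (auto simp: op_exp_eq expH_def)
  also have "ex (complex_of_real (- 2 * pi)) = (\<lambda>t. complex_of_real (exp (- 2 * pi * t)))"
    by (simp flip: exp_of_real)
  also have "spectral_integral E \<dots> = spectral_integral (\<lambda>A. E ((\<lambda>t. exp (- 2 * pi * t)) -` A)) complex_of_real"
    by (rule spectral_integral_vimage[symmetric]) auto
  finally show ?thesis
    using pvm_vimage[of "\<lambda>t. exp (- 2 * pi * t)"] by (simp add: is_spectral_measure_def pvm_def)
qed

text \<open>The image of \<open>E\<close> under the exponential is a witness for the existential in
  \<open>fun_calculus\<close>, and \<open>sqrt (exp (- 2 pi t)) = exp (- pi t)\<close>.\<close>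

lemma op_sqrt_modular_operatorI:
  assumes "L2 x (ex (complex_of_real (- pi)))"
  shows "(x, expH (complex_of_real (- pi)) x) \<in> op_sqrt (op_exp (complex_of_real (- 2 * pi)) H)"
proof -
  have sqrt: "sqrt (exp (- 2 * pi * t)) = exp (- pi * t)" for t
    by (rule real_sqrt_unique) (simp_all add: power2_eq_square flip: exp_add)
  have "spectral_integral (\<lambda>A. E ((\<lambda>t. exp (- 2 * pi * t)) -` A)) (\<lambda>t. complex_of_real (sqrt t)) =
      spectral_integral E (\<lambda>t. complex_of_real (sqrt (exp (- 2 * pi * t))))"
    by (rule spectral_integral_vimage) auto
  also have "(\<lambda>t. complex_of_real (sqrt (exp (- 2 * pi * t)))) = ex (complex_of_real (- pi))"
    unfolding sqrt by (simp flip: exp_of_real)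
  also have "spectral_integral E (ex (complex_of_real (- pi))) =
      {(x, expH (complex_of_real (- pi)) x) |x. L2 x (ex (complex_of_real (- pi)))}"
    unfolding expH_def by (rule spectral_integral_eq) auto
  finally show ?thesis
    using assms modular_operator_spectral_measure unfolding op_sqrt_def fun_calculus_def by blast
qed

text \<open>A spectral measure \<open>E'\<close> of \<open>\<Delta>\<close> need not be the image of \<open>E\<close> a priori. However the Tomita
  operator is single-valued and \<open>D(\<Delta>)\<close> is a core of \<open>\<Delta>\<^sup>1\<^sup>/\<^sup>2\<close>, which is enough to compare the
  two square roots after a spectral cut-off.\<close>

lemma op_sqrt_modular_operator_cut:
  assumes unique: "\<And>x y y'. (x, y) \<in> op_sqrt (op_exp (complex_of_real (- 2 * pi)) H) \<Longrightarrow>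
      (x, y') \<in> op_sqrt (op_exp (complex_of_real (- 2 * pi)) H) \<Longrightarrow> y = y'"
    and xy: "(x, y) \<in> op_sqrt (op_exp (complex_of_real (- 2 * pi)) H)"
  shows "expH (complex_of_real (- pi)) (cut n x) = cut n y"
proof -
  let ?D = "op_exp (complex_of_real (- 2 * pi)) H" and ?e = "expH (complex_of_real (- pi))"
  let ?sqrt = "\<lambda>t. complex_of_real (sqrt t)"
  obtain E' where E': "is_spectral_measure ?D E'" "(x, y) \<in> spectral_integral E' ?sqrt"
    using xy by (auto simp: op_sqrt_def fun_calculus_def)
  interpret P: pvm E' using E'(1) by unfold_locales (simp add: is_spectral_measure_def)
  have sqrt_eq: "spectral_integral E' ?sqrt = {(x, P.SI ?sqrt x) |x. P.L2 x ?sqrt}"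
    by (rule P.spectral_integral_eq) auto
  have x: "P.L2 x ?sqrt" "y = P.SI ?sqrt x" using E'(2) unfolding sqrt_eq by auto
  \<comment> \<open>The \<open>E'\<close> cut-offs of \<open>x\<close> lie in the domain of the
    modular operator, which is described by \<open>E\<close> as well as by \<open>E'\<close>; they
    link the two sides.\<close>
  define v where "v m = P.cut m x" for m
  have v_lim: "v \<longlonglongrightarrow> x" unfolding v_def by (rule P.cut_tendsto)
  have v: "L2 (v m) (ex (complex_of_real (- pi))) \<and> ?e (v m) = P.cut m y" for m
  proof -
    have "P.L2 (v m) complex_of_real"
      unfolding v_def by (rule P.band_L2[OF P.band_cut, of _ "real m"]) auto
    hence "(v m, P.SI complex_of_real (v m)) \<in> spectral_integral E' complex_of_real"
      by (subst P.spectral_integral_eq) auto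
    hence "L2 (v m) (ex (complex_of_real (- 2 * pi)))"
      using E'(1) unfolding is_spectral_measure_def by (auto simp: op_exp_eq)
    moreover have "L2 (v m) (\<lambda>_. 1)" by (rule L2_bounded[where B=1]) auto
    ultimately have w: "L2 (v m) (\<lambda>t. ex (complex_of_real (- 2 * pi)) t + 1)" by (rule L2_add)
    \<comment> \<open>The domain of \<open>exp (- 2 pi H)\<close> lies in that of
      \<open>exp (- pi H)\<close>: the symbol \<open>exp (- pi t)\<close> is at most 1 for
      \<open>t \<ge> 0\<close> and at most \<open>exp (- 2 pi t)\<close> otherwise.\<close>
    have L: "L2 (v m) (ex (complex_of_real (- pi)))"
    proof (rule L2_mono[OF w])
      fix t
      have "ex (complex_of_real (- 2 * pi)) t + 1 = complex_of_real (exp (- 2 * pi * t) + 1)"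
        by (simp flip: exp_of_real)
      hence "cmod (ex (complex_of_real (- 2 * pi)) t + 1) = exp (- 2 * pi * t) + 1"
        by (simp only: norm_of_real) (simp add: add_pos_pos)
      moreover have "exp (- pi * t) \<le> exp (- 2 * pi * t) + 1"
      proof (cases "t \<ge> 0")
        case True
        hence "exp (- pi * t) \<le> exp 0" by (subst exp_le_cancel_iff) simp
        thus ?thesis using exp_gt_zero[of "- 2 * pi * t"] unfolding exp_zero by linarith
      next
        case False
        hence "exp (- pi * t) \<le> exp (- 2 * pi * t)"
          by (subst exp_le_cancel_iff) (simp add: mult_le_0_iff)
        thus ?thesis by linarith
      qed
      ultimately show "cmod (ex (complex_of_real (- pi)) t) \<le> cmod (ex (complex_of_real (- 2 * pi)) t + 1)"
        by simp
    qed auto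
    have "P.L2 (v m) ?sqrt" unfolding v_def by (rule P.L2_E_vec[OF _ x(1)]) simp
    hence "(v m, P.SI ?sqrt (v m)) \<in> spectral_integral E' ?sqrt" unfolding sqrt_eq by auto
    hence "(v m, P.SI ?sqrt (v m)) \<in> op_sqrt ?D"
      using E'(1) by (auto simp: op_sqrt_def fun_calculus_def)
    \<comment> \<open>The two values come from \<open>E\<close> and from \<open>E'\<close>; both lie
      in the graph of the square root, so they agree.\<close>
    from unique[OF op_sqrt_modular_operatorI[OF L] this]
    have "?e (v m) = P.SI ?sqrt (v m)" .
    also have "\<dots> = P.cut m y"
      unfolding v_def x(2) by (rule P.E_SI_commute[symmetric, OF _ x(1)]) simp
    finally show ?thesis using L by simp
  qed
  have "(\<lambda>m. ?e (cut n (v m))) \<longlonglongrightarrow> cut n y"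
    using v E_tendsto[OF _ P.cut_tendsto[of y], of "{- real n..real n}"]
    by (simp flip: E_expH del: of_real_minus)
  \<comment> \<open>After the \<open>E\<close> cut-off at \<open>n\<close> the operator
    \<open>exp (- pi H)\<close> is bounded, so the limit in \<open>m\<close> may be taken
    inside.\<close>
  moreover have "(\<lambda>m. ?e (cut n (v m))) \<longlonglongrightarrow> ?e (cut n x)"
  proof -
    have "(\<lambda>m. ?e (cut n (v m)) - ?e (cut n x)) \<longlonglongrightarrow> 0"
    proof (rule Lim_null_comparison[OF always_eventually], rule allI)
      fix m
      have "?e (cut n (v m)) = ?e (cut n (v m - x)) + ?e (cut n x)"
        using expH_add[OF band_L2_ex[OF band_cut[of n "v m - x"]] band_L2_ex[OF band_cut[of n x]]]
        by (simp add: E_diff)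
      hence "?e (cut n (v m)) - ?e (cut n x) = ?e (cut n (v m - x))" by simp
      also have "norm \<dots> \<le> exp (\<bar>Re (complex_of_real (- pi))\<bar> * real n) * norm (cut n (v m - x))"
        by (rule band_norm_expH_le[OF band_cut])
      also have "\<dots> \<le> exp (\<bar>Re (complex_of_real (- pi))\<bar> * real n) * norm (v m - x)"
        by (intro mult_left_mono norm_E_le) auto
      finally show "norm (?e (cut n (v m)) - ?e (cut n x)) \<le>
        exp (\<bar>Re (complex_of_real (- pi))\<bar> * real n) * norm (v m - x)" .
      show "(\<lambda>m. exp (\<bar>Re (complex_of_real (- pi))\<bar> * real n) * norm (v m - x)) \<longlonglongrightarrow> 0"
        using v_lim by (intro tendsto_mult_right_zero tendsto_norm_zero) (simp add: LIM_zero_iff)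
    qed
    thus ?thesis by (simp add: LIM_zero_iff)
  qed
  ultimately show ?thesis by (rule LIMSEQ_unique[symmetric])
qed

end

section \<open>From the hypotheses to the locale assumptions\<close>

theorem theorem2p16:
  fixes H :: "'a::complex_hilbert_space operator"
    and U :: "real \<Rightarrow> 'a \<Rightarrow> 'a"
    and J :: "'a \<Rightarrow> 'a"
    and V :: "'a set"
  assumes "selfadjoint H"
    and "unitary_one_parameter_group U"
    and "\<And>t. {(x, U t x) |x. True} = op_exp (\<i> * complex_of_real t) H"
    and "conjugation J"
    and "\<And>t x. J (U t x) = U t (J x)"
    and "standard_subspace V"
    and "modular_objects V J (op_exp (complex_of_real (- 2 * pi)) H)"
    and "V = op_Fix (conj_comp J (op_sqrt (op_exp (complex_of_real (- 2 * pi)) H)))"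
  shows "hyperfunction_vectors_KMS H U J =
    {\<eta> \<in> hyperfunction_vectors H.
       \<forall>v \<in> symplectic_complement V \<inter> analytic_vectors H. \<eta> v \<in> \<real>}"
proof -
  \<comment> \<open>Membership in \<open>op_exp\<close> unfolds to an existential over spectral
    measures, so any element of the graph yields an \<open>E\<close>; the pair at
    \<open>t = 0\<close> serves.\<close>
  have "(0, U 0 0) \<in> op_exp (\<i> * complex_of_real 0) H" using assms(3)[of 0] by blast
  then obtain E where E: "is_spectral_measure H E"
    unfolding op_exp_def fun_calculus_def by blast
  have is_pvm: "pvm E'" if "is_spectral_measure H E'" for E'
    using that by (simp add: pvm_def is_spectral_measure_def)
  have U: "U t x = pvm.SI E' (\<lambda>s. exp (\<i> * complex_of_real t * complex_of_real s)) x"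
    if E': "is_spectral_measure H E'" for E' t x
  proof -
    interpret P: pvm E' by (rule is_pvm[OF E'])
    let ?f = "\<lambda>s. exp (\<i> * complex_of_real t * complex_of_real s)"
    have "P.L2 x ?f" by (rule P.L2_bounded[where B=1]) auto
    hence "(x, P.SI ?f x) \<in> spectral_integral E' ?f" by (subst P.spectral_integral_eq) auto
    hence "(x, P.SI ?f x) \<in> op_exp (\<i> * complex_of_real t) H"
      using E' unfolding op_exp_def fun_calculus_def by blast
    thus ?thesis unfolding assms(3)[symmetric] by simp
  qed
  interpret pvm E by (rule is_pvm[OF E])
  \<comment> \<open>Any two spectral measures of \<open>H\<close> produce the given
    \<open>U\<close>, hence coincide on Borel sets and define the same integrals.\<close>
  have spectral: "spectral_integral E' f = spectral_integral E f" if "is_spectral_measure H E'" for E' f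
    by (rule spectral_integral_cong, rule pvm_unique[OF is_pvm[OF that] is_pvm[OF E]])
      (simp_all flip: U[OF that] U[OF E])
  interpret hyperfunction E U J H
  proof unfold_locales
    show "op_exp z H = {(x, expH z x) |x. L2 x (ex z)}" for z
    proof -
      have "op_exp z H = spectral_integral E (ex z)"
        unfolding op_exp_def fun_calculus_def using E spectral by blast
      thus ?thesis unfolding expH_def by (subst (asm) spectral_integral_eq) auto
    qed
  qed (fact U[OF E] assms(4,5))+
  let ?S = "op_sqrt (op_exp (complex_of_real (- 2 * pi)) H)"
  have tomita: "tomita_operator V = conj_comp J ?S"
    using assms(7) by (simp add: modular_objects_def)
  \<comment> \<open>\<open>J\<close> is injective, so single-valuedness passes from the Tomita
    operator to the square root.\<close>
  have unique: "y = y'" if "(x, y) \<in> ?S" "(x, y') \<in> ?S" for x y y'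
  proof -
    have "(x, J y) \<in> tomita_operator V" "(x, J y') \<in> tomita_operator V"
      using that unfolding tomita by (auto simp: conj_comp_def)
    from tomita_operator_unique[OF assms(6) this] show ?thesis by (metis J_J)
  qed
  interpret hyperfunction_standard E U J H V
  proof unfold_locales
    fix v n assume "v \<in> V"
    then obtain y where y: "(v, y) \<in> ?S" "v = J y"
      by (subst (asm) assms(8)) (auto simp: op_Fix_def conj_comp_def)
    have "J (expH (complex_of_real (- pi)) (cut n v)) = J (cut n y)"
      using op_sqrt_modular_operator_cut[OF unique y(1)] by simp
    thus "J (expH (complex_of_real (- pi)) (cut n v)) = cut n v"
      by (simp add: cut_J y(2))
  next
    fix a v assume v: "band a v" "J (expH (complex_of_real (- pi)) v) = v"
    have "(v, J (expH (complex_of_real (- pi)) v)) \<in> conj_comp J ?S"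
      using op_sqrt_modular_operatorI[OF band_L2_ex[OF v(1)]] unfolding conj_comp_def by blast
    thus "v \<in> V" unfolding v(2) by (subst assms(8)) (simp add: op_Fix_def)
  qed
  show ?thesis by (rule KMS_eq)
qed

end
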